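(* Fix $t\ge 0$ and $\alpha>\frac12$. There exist $N_0\in\mathbb{N}$ and $\eta>0$ such that for all $N\ge N_0$, $$\eta\,|t|\,\ln(N)^{\frac12}\;\le\;\big\|\mathcal{I}_{\mathbb{S}^2}(t,P_{\le N}\phi_\alpha^\omega)\big\|_{L^2(\Omega;H^{\alpha-1}(\mathbb{S}^2))}.$$
   Context: $\mathbb{S}^2$ is the unit sphere of $\mathbb{R}^3$ with the rotation-invariant measure $\sigma$ normalized so that $\sigma(\mathbb{S}^2)=1$; $L^2(\mathbb{S}^2)$ has scalar product $\langle f|g\rangle=\int_{\mathbb{S}^2}f\overline{g}\,d\sigma$. $\Delta$ is the Laplace–Beltrami operator of $\mathbb{S}^2$. The operator $-\Delta+1$ has eigenvalues $\lambda_n^2=n^2+n+1$, $n\in\mathbb{N}=\{0,1,2,\dots\}$ ($\lambda_n>0$), with eigenspaces $\mathcal{E}_n$ of complex dimension $2n+1$; $\pi_n$ is the orthogonal projector of $L^2(\mathbb{S}^2)$ onto $\mathcal{E}_n$, and $P_{\le N}u=\sum_{n:\lambda_n\le N}\pi_n u$. The Sobolev norm is $\|f\|_{H^s(\mathbb{S}^2)}=\big(\sum_{n\ge0}\lambda_n^{2s}\|\pi_nf\|_{L^2}^2\big)^{1/2}$. Random data: $(\Omega,\mathcal{F},\mathbb{P})$ is a probability space, $(\mathbf{b}_{n,k})_{|k|\le n}$ is an orthonormal basis of $\mathcal{E}_n$ for each $n$, and $(g_{n,k})_{n\in\mathbb{N},|k|\le n}$ are i.i.d. complex standard Gaussian variables,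 i.e. $g_{n,k}=\frac1{\sqrt2}(\mathfrak{g}_{n,k}+i\mathfrak{h}_{n,k})$ with $\mathfrak{g}_{n,k},\mathfrak{h}_{n,k}$ independent real standard Gaussians. Set $$\phi_\alpha^\omega=\sum_{n\ge0}\lambda_n^{-\alpha}\sum_{|k|\le n}g_{n,k}(\omega)\mathbf{b}_{n,k}.$$ The Wick ordered cubic nonlinearity is $:|u|^2u:(x)=\big(|u(x)|^2-2\|u\|_{L^2(\mathbb{S}^2)}^2\big)u(x)$. The second Picard iteration of $i\partial_tu-(-\Delta+1)u=\,:|u|^2u:$ is $$\mathcal{I}_{\mathbb{S}^2}(t,u_0)=-i\int_0^te^{i(t-t')(\Delta-1)}\Big(:|e^{it'(\Delta-1)}u_0|^2e^{it'(\Delta-1)}u_0:\Big)dt'.$$ For a random function $F$, $\|F\|_{L^2(\Omega;H^s)}=\big(\mathbb{E}\|F\|_{H^s}^2\big)^{1/2}$. *)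

theory Defs
  imports "HOL-Probability.Probability"
begin

type_synonym R3 = "real^3"

abbreviation S2 :: "R3 set" where
  "S2 \<equiv> sphere 0 1"

text \<open>
  A function on the sphere is represented by a function of type \<open>R3 \<Rightarrow> complex\<close>; the elements
  of the eigenspaces below are required to vanish off the sphere, so that equality of functions
  on the sphere is equality in HOL.
\<close>

subsection \<open>The normalized rotation-invariant measure on the sphere\<close>

text \<open>
  Radial projection of the uniform distribution on the unit ball. That this is the
  rotation-invariant probability measure on the sphere is shown in
  \<open>prob_space_sphere_measure\<close> and \<open>sphere_measure_rotation_invariant\<close>.
\<close>

definition sphere_measure :: "R3 measure" where
  "sphere_measure = restrict_space (distr (uniform_measure lborel (ball 0 1)) borel sgn) S2"

lemma sgn_borel_measurable_R3 [measurable]: "(sgn :: R3 \<Rightarrow> R3) \<in> borel_measurable borel"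
  unfolding sgn_div_norm by measurable

lemma space_sphere_measure [simp]: "space sphere_measure = S2"
  by (simp add: sphere_measure_def space_restrict_space)

lemma sets_sphere_measure: "sets sphere_measure = sets (restrict_space borel S2)"
  unfolding sphere_measure_def by (intro sets_restrict_space_cong) simp

lemma emeasure_sphere_measure:
  assumes A: "A \<in> sets borel" "A \<subseteq> S2"
  shows "emeasure sphere_measure A
    = emeasure lborel (ball 0 1 \<inter> sgn -` A) / emeasure lborel (ball 0 1 :: R3 set)"
proof -
  have 1: "(sgn :: R3 \<Rightarrow> R3) \<in> measurable (uniform_measure lborel (ball 0 1)) borel"
    by simp
  have 2: "(sgn :: R3 \<Rightarrow> R3) -` A \<in> sets borel"
    using measurable_sets[OF sgn_borel_measurable_R3 A(1)] by simp
  have "emeasure sphere_measure A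
      = emeasure (distr (uniform_measure lborel (ball 0 1)) borel sgn) A"
    unfolding sphere_measure_def using A by (intro emeasure_restrict_space) auto
  also have "\<dots> = emeasure (uniform_measure lborel (ball 0 1 :: R3 set)) (sgn -` A)"
    using A(1) by (subst emeasure_distr[OF 1]) auto
  also have "\<dots> = emeasure lborel (ball 0 1 \<inter> sgn -` A) / emeasure lborel (ball 0 1 :: R3 set)"
    using 2 by (intro emeasure_uniform_measure) auto
  finally show ?thesis .
qed

lemma emeasure_unit_ball_R3:
  "emeasure lborel (ball 0 1 :: R3 set) \<noteq> 0" "emeasure lborel (ball 0 1 :: R3 set) \<noteq> \<infinity>"
proof -
  show "emeasure lborel (ball 0 1 :: R3 set) \<noteq> 0"
    by (simp add: emeasure_ball unit_ball_vol_pos less_imp_neq[symmetric])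
  show "emeasure lborel (ball 0 1 :: R3 set) \<noteq> \<infinity>"
    by (simp add: emeasure_ball)
qed

lemma prob_space_sphere_measure: "prob_space sphere_measure"
proof
  have *: "ball 0 1 \<inter> sgn -` S2 = ball 0 1 - {0 :: R3}"
    by (auto simp: norm_sgn)
  have "emeasure lborel (ball 0 1 - {0 :: R3}) = emeasure lborel (ball 0 1 :: R3 set)"
    by (subst emeasure_Diff_null_set) (auto simp: null_sets_def)
  moreover have "emeasure sphere_measure S2
      = emeasure lborel (ball 0 1 - {0 :: R3}) / emeasure lborel (ball 0 1 :: R3 set)"
    by (subst emeasure_sphere_measure) (auto simp: * borel_closed)
  ultimately show "emeasure sphere_measure (space sphere_measure) = 1"
    using ennreal_divide_self[of "emeasure lborel (ball 0 1 :: R3 set)"] emeasure_unit_ball_R3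
    by (simp add: less_top infinity_ennreal_def del: ennreal_divide_self)
qed

lemma lborel_distr_orthogonal:
  fixes f :: "R3 \<Rightarrow> R3"
  assumes f: "orthogonal_transformation f"
  shows "distr lborel borel f = lborel"
proof (rule lborel_eqI[symmetric])
  have [measurable]: "f \<in> borel_measurable borel"
    using f by (intro borel_measurable_continuous_onI linear_continuous_on)
      (simp add: linear_linear orthogonal_transformation_linear)
  fix l u :: R3 assume lu: "\<And>b. b \<in> Basis \<Longrightarrow> l \<bullet> b \<le> u \<bullet> b"
  have oi: "orthogonal_transformation (inv f)"
    using f by (rule orthogonal_transformation_inv)
  have vi: "f -` box l u = inv f ` box l u"
    using f by (simp add: bij_vimage_eq_inv_image orthogonal_transformation_bij)
  have lm: "inv f ` box l u \<in> lmeasurable"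
    using measurable_orthogonal_image[OF oi, of "box l u"] by simp
  have bs: "f -` box l u \<in> sets borel"
    using measurable_sets[of f borel borel "box l u"] by simp
  have "emeasure (distr lborel borel f) (box l u) = emeasure lborel (f -` box l u)"
    by (rule trans[OF emeasure_distr]) simp_all
  also have "\<dots> = emeasure lebesgue (inv f ` box l u)"
    unfolding vi[symmetric] using bs by simp
  also have "\<dots> = ennreal (measure lebesgue (inv f ` box l u))"
    using lm by (rule emeasure_eq_measure2)
  also have "\<dots> = ennreal (measure lebesgue (box l u))"
    using measure_orthogonal_image[OF oi, of "box l u"] by simp
  also have "\<dots> = (\<Prod>b\<in>Basis. (u - l) \<bullet> b)"
    using lu by (simp add: measure_lborel_box)
  finally show "emeasure (distr lborel borel f) (box l u) = (\<Prod>b\<in>Basis. (u - l) \<bullet> b)" .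
qed simp

lemma sphere_measure_rotation_invariant:
  assumes f: "orthogonal_transformation f"
  shows "distr sphere_measure sphere_measure f = sphere_measure"
proof (rule measure_eqI)
  have fb [measurable]: "f \<in> borel_measurable borel"
    using f by (intro borel_measurable_continuous_onI linear_continuous_on)
      (simp add: linear_linear orthogonal_transformation_linear)
  have nf: "norm (f x) = norm x" for x
    using f by (simp add: orthogonal_transformation_norm)
  have fs: "f (sgn x) = sgn (f x)" for x
    by (simp add: sgn_div_norm nf orthogonal_transformation_scaleR[OF f])
  have mf: "f \<in> measurable sphere_measure sphere_measure"
    unfolding measurable_cong_sets[OF sets_sphere_measure sets_sphere_measure]
    by (intro measurable_restrict_space3) (auto simp: nf)
  fix A assume "A \<in> sets (distr sphere_measure sphere_measure f)"
  then have As: "A \<in> sets sphere_measure" by simp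
  then have A: "A \<in> sets borel" "A \<subseteq> S2"
    by (auto simp: sets_sphere_measure sets_restrict_space)
  have sub: "f -` A \<subseteq> S2"
  proof
    fix x assume "x \<in> f -` A"
    then have "f x \<in> S2" using A(2) by auto
    then show "x \<in> S2" by (simp add: nf)
  qed
  have fA: "f -` A \<in> sets borel"
    using measurable_sets[OF fb A(1)] by simp
  have sA: "(sgn :: R3 \<Rightarrow> R3) -` A \<in> sets borel"
    using measurable_sets[OF sgn_borel_measurable_R3 A(1)] by simp
  have "emeasure (distr sphere_measure sphere_measure f) A = emeasure sphere_measure (f -` A)"
    using As sub by (subst emeasure_distr[OF mf]) (auto simp: Int_absorb2)
  also have "\<dots> = emeasure lborel (ball 0 1 \<inter> sgn -` (f -` A)) / emeasure lborel (ball 0 1 :: R3 set)"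
    using fA sub by (rule emeasure_sphere_measure)
  also have "ball 0 1 \<inter> sgn -` (f -` A) = f -` (ball 0 1 \<inter> sgn -` A)"
    by (auto simp: fs nf)
  also have "emeasure lborel (f -` (ball 0 1 \<inter> sgn -` A))
      = emeasure (distr lborel borel f) (ball 0 1 \<inter> sgn -` A)"
    using sA by (subst emeasure_distr) auto
  also have "\<dots> = emeasure lborel (ball 0 1 \<inter> sgn -` A)"
    by (simp add: lborel_distr_orthogonal[OF f])
  also have "\<dots> / emeasure lborel (ball 0 1 :: R3 set) = emeasure sphere_measure A"
    using emeasure_sphere_measure[OF A] by simp
  finally show "emeasure (distr sphere_measure sphere_measure f) A = emeasure sphere_measure A" .
qed simp

definition l2_inner :: "(R3 \<Rightarrow> complex) \<Rightarrow> (R3 \<Rightarrow> complex) \<Rightarrow> complex" where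
  "l2_inner f h = (\<integral>x. f x * cnj (h x) \<partial>sphere_measure)"

definition l2_norm :: "(R3 \<Rightarrow> complex) \<Rightarrow> real" where
  "l2_norm f = sqrt (\<integral>x. (cmod (f x))\<^sup>2 \<partial>sphere_measure)"

subsection \<open>The Laplace--Beltrami operator and its eigenspaces\<close>

definition partial :: "R3 \<Rightarrow> (R3 \<Rightarrow> complex) \<Rightarrow> R3 \<Rightarrow> complex" where
  "partial v F x = vector_derivative (\<lambda>h. F (x + h *\<^sub>R v)) (at 0)"

text \<open>\<open>C_class k U F\<close> says that \<open>F\<close> is of class \<open>C\<^sup>k\<close> on the open set \<open>U\<close>.\<close>

primrec C_class :: "nat \<Rightarrow> R3 set \<Rightarrow> (R3 \<Rightarrow> complex) \<Rightarrow> bool" where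
  "C_class 0 U F \<longleftrightarrow> continuous_on U F"
| "C_class (Suc k) U F \<longleftrightarrow> continuous_on U F \<and>
     (\<forall>v\<in>Basis. (\<forall>x\<in>U. (\<lambda>h. F (x + h *\<^sub>R v)) differentiable (at 0)) \<and> C_class k U (partial v F))"

text \<open>
  \<open>f \<circ> sgn\<close> is the extension of \<open>f\<close> from the sphere to \<open>- {0}\<close> that is constant along rays.
  The Laplace--Beltrami operator is the Euclidean Laplacian of this extension, restricted
  to the sphere.
\<close>

definition smooth_S2 :: "(R3 \<Rightarrow> complex) \<Rightarrow> bool" where
  "smooth_S2 f \<longleftrightarrow> (\<forall>k. C_class k (- {0}) (f \<circ> sgn))"

definition laplace_beltrami :: "(R3 \<Rightarrow> complex) \<Rightarrow> R3 \<Rightarrow> complex" where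
  "laplace_beltrami f x = (\<Sum>v\<in>Basis. partial v (partial v (f \<circ> sgn)) x)"

definition lam :: "nat \<Rightarrow> real" where
  "lam n = sqrt ((real n)\<^sup>2 + real n + 1)"

definition eigenspace :: "nat \<Rightarrow> (R3 \<Rightarrow> complex) set" where
  "eigenspace n = {f. smooth_S2 f \<and> (\<forall>x. x \<notin> S2 \<longrightarrow> f x = 0) \<and>
     (\<forall>x\<in>S2. - laplace_beltrami f x + f x = of_real ((lam n)\<^sup>2) * f x)}"

definition orthonormal_basis_eigenspace :: "nat \<Rightarrow> (int \<Rightarrow> R3 \<Rightarrow> complex) \<Rightarrow> bool" where
  "orthonormal_basis_eigenspace n B \<longleftrightarrow>
     (\<forall>k\<in>{-int n..int n}. B k \<in> eigenspace n) \<and>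
     (\<forall>j\<in>{-int n..int n}. \<forall>k\<in>{-int n..int n}. l2_inner (B j) (B k) = (if j = k then 1 else 0)) \<and>
     (\<forall>f\<in>eigenspace n. \<exists>c :: int \<Rightarrow> complex. f = (\<lambda>x. \<Sum>k=-int n..int n. c k * B k x))"

subsection \<open>Spectral projectors\<close>

text \<open>
  For \<open>\<alpha> \<le> 1\<close> the random series \<open>\<phi>\<^sub>\<alpha>\<close> is almost surely not in \<open>L\<^sup>2\<close>, only a distribution.
  A distribution \<open>T\<close> on the sphere is represented by the antilinear functional
  \<open>\<psi> \<mapsto> \<langle>T|\<psi>\<rangle>\<close> on test functions; a function \<open>u\<close> is identified with \<open>l2_inner u\<close>.
  The projection of \<open>T\<close> to the \<open>n\<close>-th eigenspace is the \<open>p\<close> in the eigenspace such that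
  \<open>\<langle>T - p|e\<rangle> = 0\<close> for all \<open>e\<close> in the eigenspace. For \<open>T = l2_inner u\<close> this is the
  orthogonal projection of \<open>u\<close>.
\<close>

type_synonym distribution_S2 = "(R3 \<Rightarrow> complex) \<Rightarrow> complex"

definition proj_dist :: "nat \<Rightarrow> distribution_S2 \<Rightarrow> R3 \<Rightarrow> complex" where
  "proj_dist n T = (THE p. p \<in> eigenspace n \<and> (\<forall>e\<in>eigenspace n. l2_inner p e = T e))"

definition proj :: "nat \<Rightarrow> (R3 \<Rightarrow> complex) \<Rightarrow> R3 \<Rightarrow> complex" where
  "proj n u = proj_dist n (l2_inner u)"

definition P_le :: "real \<Rightarrow> distribution_S2 \<Rightarrow> R3 \<Rightarrow> complex" where
  "P_le N T x = (\<Sum>n | lam n \<le> N. proj_dist n T x)"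

subsection \<open>Norms\<close>

definition ennreal_sqrt :: "ennreal \<Rightarrow> ennreal" where
  "ennreal_sqrt a = (if a = \<infinity> then \<infinity> else ennreal (sqrt (enn2real a)))"

definition Hs_norm :: "real \<Rightarrow> (R3 \<Rightarrow> complex) \<Rightarrow> ennreal" where
  "Hs_norm s f = ennreal_sqrt (\<Sum>n. ennreal (lam n powr (2 * s) * (l2_norm (proj n f))\<^sup>2))"

definition L2_Hs_norm :: "'w measure \<Rightarrow> real \<Rightarrow> ('w \<Rightarrow> R3 \<Rightarrow> complex) \<Rightarrow> ennreal" where
  "L2_Hs_norm M s F = ennreal_sqrt (\<integral>\<^sup>+\<omega>. (Hs_norm s (F \<omega>))\<^sup>2 \<partial>M)"

subsection \<open>The random data\<close>

definition std_complex_gaussian :: "'w measure \<Rightarrow> ('w \<Rightarrow> complex) \<Rightarrow> bool" where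
  "std_complex_gaussian M X \<longleftrightarrow> (\<exists>G H :: 'w \<Rightarrow> real.
     distributed M lborel G std_normal_density \<and>
     distributed M lborel H std_normal_density \<and>
     prob_space.indep_var M borel G borel H \<and>
     X = (\<lambda>\<omega>. of_real (1 / sqrt 2) * (of_real (G \<omega>) + \<i> * of_real (H \<omega>))))"

definition iid_std_complex_gaussian :: "'w measure \<Rightarrow> (nat \<Rightarrow> int \<Rightarrow> 'w \<Rightarrow> complex) \<Rightarrow> bool" where
  "iid_std_complex_gaussian M g \<longleftrightarrow>
     (\<forall>n. \<forall>k\<in>{-int n..int n}. std_complex_gaussian M (g n k)) \<and>
     prob_space.indep_vars M (\<lambda>_. borel) (\<lambda>(n, k). g n k) {(n, k). \<bar>k\<bar> \<le> int n}"

definition phi :: "real \<Rightarrow> (nat \<Rightarrow> int \<Rightarrow> R3 \<Rightarrow> complex) \<Rightarrow> (nat \<Rightarrow> int \<Rightarrow> 'w \<Rightarrow> complex) \<Rightarrow>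
    'w \<Rightarrow> distribution_S2" where
  "phi \<alpha> b g \<omega> \<psi> = (\<Sum>n. of_real (lam n powr (-\<alpha>)) *
     (\<Sum>k=-int n..int n. g n k \<omega> * l2_inner (b n k) \<psi>))"

subsection \<open>The second Picard iteration\<close>

text \<open>
  \<open>propagator t u\<close> is \<open>e\<^bsup>it(\<Delta>-1)\<^esup>u\<close>, summed pointwise. For \<open>u\<close> with finitely many
  spectral components (finite sums of eigenfunctions and products of such) the sum is finite.
  Likewise the time integral in \<open>picard2\<close> is taken pointwise.
\<close>

definition propagator :: "real \<Rightarrow> (R3 \<Rightarrow> complex) \<Rightarrow> R3 \<Rightarrow> complex" where
  "propagator t u x = (\<Sum>n. exp (- \<i> * of_real (t * (lam n)\<^sup>2)) * proj n u x)"

definition wick_cubic :: "(R3 \<Rightarrow> complex) \<Rightarrow> R3 \<Rightarrow> complex" where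
  "wick_cubic u x = of_real ((cmod (u x))\<^sup>2 - 2 * (l2_norm u)\<^sup>2) * u x"

definition picard2 :: "real \<Rightarrow> (R3 \<Rightarrow> complex) \<Rightarrow> R3 \<Rightarrow> complex" where
  "picard2 t u0 x =
     - \<i> * (LBINT t'=0..t. propagator (t - t') (wick_cubic (propagator t' u0)) x)"

end

theory Submission
  imports Defs "HOL-Library.Function_Algebras"
begin

text \<open>
  Write \<open>o = (1, 0)\<close> for one of the modes of degree 1. The coefficient of the second iteration along
  \<open>b n k\<close> is a cubic polynomial in the Gaussians; it is tested against the orthonormal variables
  \<open>(|g\<^sub>o|\<^sup>2 - 1) g n j\<close>, \<open>|j| \<le> n\<close>. Only resonant terms survive, so the time integral contributes
  a factor \<open>t\<close>, and the correlation has modulus \<open>2 t \<lambda>\<^sub>1 powr (- 2 \<alpha>) \<lambda>\<^sub>n powr (- \<alpha>)\<close> times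
  the matrix element \<open>\<langle>f b n j, b n k\<rangle>\<close> of multiplication by \<open>f = |b\<^sub>o|\<^sup>2 - 1\<close>, the \<open>- 1\<close> coming
  from the Wick ordering. The squared Hilbert--Schmidt norm of this matrix is at least \<open>C n\<close>: pair it
  with \<open>L\<^sup>2\<close>, where \<open>L\<close> is the infinitesimal rotation about a vector \<open>p\<close>. Rotation invariance
  makes \<open>\<Sum>\<^sub>k |L b n k|\<^sup>2\<close> equal to \<open>n (n + 1) (2 n + 1) / 2\<close> times \<open>|p \<times> x|\<^sup>2\<close>, so the trace
  is of order \<open>n\<^sup>3\<close>, while \<open>L\<^sup>2\<close> has Hilbert--Schmidt norm of order \<open>n powr (5/2)\<close>. By Bessel's
  inequality degree \<open>n\<close> contributes at least a multiple of \<open>t\<^sup>2 / n\<close> to the expected square of the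
  \<open>H powr (\<alpha> - 1)\<close> norm, and summing over \<open>n < N\<close> gives the logarithm.

  The products entering the nonlinearity are handled as restrictions of polynomials on \<open>R3\<close>: the
  eigenspaces consist of such restrictions because powers of isotropic linear forms already span
  \<open>2 n + 1\<close> dimensions, and every polynomial of degree \<open>d\<close> is a sum of harmonics of degree at most
  \<open>d\<close>.
\<close>

section \<open>Polynomial functions\<close>

text \<open>The second power of L is the first that detects anything: pairing multiplication by f
  with the identity only sees the mean of f, which is 0, and pairing with L itself gives 0. L^2
  brings in the weight (p . x)^2, and this is just enough, because the squared modulus of a degree 1
  mode is a quadratic form and its excess over 1 cannot be orthogonal to all such weights. Degree 0
  would not do as the low mode: its modulus is constant, so f would vanish.

  The test variables are normalized because E (|g|^2 - 1)^2 = 1. Subtracting 1 decorrelates them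
  from every cubic monomial whose conjugated factor is not the low mode, so no description of the
  resonant set and no control of the oscillating terms is required.

  The power 1/n comes from lam^(2 alpha - 2) in the norm, lam^(-2 alpha) in the data and the n of
  the Hilbert-Schmidt bound. As only a lower bound with values in the extended nonnegative reals is
  claimed, square integrability of the iteration never has to be established.\<close>

type_synonym cfun = "R3 \<Rightarrow> complex"

abbreviation cx :: "3 \<Rightarrow> cfun" where
  "cx i x \<equiv> complex_of_real (x $ i)"

abbreviation pd :: "3 \<Rightarrow> cfun \<Rightarrow> cfun" where
  "pd i \<equiv> partial (axis i 1)"

text \<open>Polynomial functions of degree at most \<open>d\<close>, built in the manner of Horner
  by multiplying with one coordinate at a time, so that closure properties have a single
  multiplicative case. With functions instead of formal polynomials, restriction to the sphere and
  composition with rotations need no evaluation map.\<close>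

inductive pf :: "nat \<Rightarrow> cfun \<Rightarrow> bool" where
  pf_const [simp, intro]: "pf d (\<lambda>_. c)"
| pf_add: "pf d p \<Longrightarrow> pf d q \<Longrightarrow> pf d (\<lambda>x. p x + q x)"
| pf_cx_mult: "pf d p \<Longrightarrow> pf (Suc d) (\<lambda>x. cx i x * p x)"

definition polyf :: "cfun \<Rightarrow> bool" where
  "polyf p \<longleftrightarrow> (\<exists>d. pf d p)"

lemma pf_Suc: "pf d p \<Longrightarrow> pf (Suc d) p"
  by (induction rule: pf.induct) (auto intro: pf.intros)

lemma pf_mono: "pf d p \<Longrightarrow> d \<le> e \<Longrightarrow> pf e p"
  by (induction e) (auto simp: le_Suc_eq intro: pf_Suc)

lemma pf_cmult: "pf d p \<Longrightarrow> pf d (\<lambda>x. c * p x)"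
proof (induction rule: pf.induct)
  case (pf_cx_mult d p i)
  then show ?case using pf.pf_cx_mult[of d "\<lambda>x. c * p x" i] by (simp add: mult_ac)
qed (auto simp: distrib_left intro: pf.intros)

lemma pf_diff: "pf d p \<Longrightarrow> pf d q \<Longrightarrow> pf d (\<lambda>x. p x - q x)"
  using pf_add[of d p "\<lambda>x. - 1 * q x"] pf_cmult[of d q "-1"] by simp

lemma pf_mult:
  assumes p: "pf d p" and q: "pf e q"
  shows "pf (d + e) (\<lambda>x. p x * q x)"
  using p
proof (induction rule: pf.induct)
  case (pf_const d c)
  then show ?case using pf_mono[OF pf_cmult[OF q, of c], of "d + e"] by simp
next
  case (pf_cx_mult d p i)
  then show ?case using pf.pf_cx_mult[of "d + e" "\<lambda>x. p x * q x" i] by (simp add: mult_ac)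
qed (auto simp: distrib_right intro: pf.intros)

lemma pf_cx: "pf 1 (cx i)"
  using pf_cx_mult[of 0 "\<lambda>_. 1" i] by simp

lemma pf_sum: "(\<And>i. i \<in> I \<Longrightarrow> pf d (p i)) \<Longrightarrow> pf d (\<lambda>x. \<Sum>i\<in>I. p i x)"
  by (induction I rule: infinite_finite_induct) (auto intro: pf_add)

lemma pf_power: "pf d p \<Longrightarrow> pf (n * d) (\<lambda>x. p x ^ n)"
  by (induction n) (auto intro: pf_mult)

lemma pf_cnj: "pf d p \<Longrightarrow> pf d (\<lambda>x. cnj (p x))"
proof (induction rule: pf.induct)
  case (pf_cx_mult d p i)
  then show ?case using pf.pf_cx_mult[of d "\<lambda>x. cnj (p x)" i] by simp
qed (auto intro: pf.intros)

lemma pf_linear_form: "pf 1 (\<lambda>x. \<Sum>i\<in>UNIV. c i * cx i x)"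
  by (intro pf_sum pf_cmult pf_cx)

lemma pf_compose_linear:
  assumes p: "pf d p" and S: "linear (S :: R3 \<Rightarrow> R3)"
  shows "pf d (\<lambda>x. p (S x))"
  using p
proof (induction rule: pf.induct)
  case (pf_cx_mult d p i)
  define c where "c j = complex_of_real (S (axis j 1) $ i)" for j
  have "cx i (S x) = (\<Sum>j\<in>UNIV. c j * cx j x)" for x
  proof -
    have "S x = (\<Sum>j\<in>UNIV. x $ j *\<^sub>R S (axis j 1))"
      by (subst basis_expansion[symmetric, of x]) (simp add: linear_sum[OF S] linear_scale[OF S] scalar_mult_eq_scaleR)
    then show ?thesis unfolding c_def by (simp add: mult.commute)
  qed
  then have "(\<lambda>x. cx i (S x)) = (\<lambda>x. \<Sum>j\<in>UNIV. c j * cx j x)"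
    by (simp add: fun_eq_iff)
  then have "pf 1 (\<lambda>x. cx i (S x))" using pf_linear_form by simp
  from pf_mult[OF this pf_cx_mult.IH] show ?case by simp
qed (auto intro: pf.intros)

text \<open>On \<open>nat\<close> the degree \<open>0 - 1\<close> is 0, so the degree bound alone
  would not force the gradient of a constant to vanish; the extra clause does. The gradient starts
  as a witness for a Frechet derivative because \<open>partial\<close>, defined through
  \<open>vector_derivative\<close>, has no usable value before differentiability is known.\<close>

definition gradient_of :: "nat \<Rightarrow> cfun \<Rightarrow> (3 \<Rightarrow> R3 \<Rightarrow> complex) \<Rightarrow> bool" where
  "gradient_of d p p' \<longleftrightarrow> (\<forall>i. pf (d - 1) (p' i) \<and> (d = 0 \<longrightarrow> p' i = (\<lambda>_. 0))) \<and>
    (\<forall>x. (p has_derivative (\<lambda>h. \<Sum>i\<in>UNIV. cx i h * p' i x)) (at x))"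

lemma gradient_ofD:
  assumes "gradient_of d p p'"
  shows "pf (d - 1) (p' i)" "d = 0 \<Longrightarrow> p' i = (\<lambda>_. 0)"
    "(p has_derivative (\<lambda>h. \<Sum>i\<in>UNIV. cx i h * p' i x)) (at x)"
  using assms unfolding gradient_of_def by auto

lemma pf_gradient_ex:
  assumes "pf d p"
  shows "\<exists>p'. gradient_of d p p'"
  using assms
proof (induction rule: pf.induct)
  case (pf_const d c)
  show ?case by (rule exI[of _ "\<lambda>_ _. 0"]) (simp add: gradient_of_def)
next
  case (pf_add d p q)
  then obtain p' q' where p': "gradient_of d p p'" and q': "gradient_of d q q'" by blast
  note * = gradient_ofD[OF p'] gradient_ofD[OF q']
  have "((\<lambda>x. p x + q x) has_derivative (\<lambda>h. \<Sum>i\<in>UNIV. cx i h * (p' i x + q' i x))) (at x)" for x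
    using has_derivative_add[OF *(3)[of x] *(6)[of x]] by (simp add: distrib_left sum.distrib)
  moreover have "pf (d - 1) (\<lambda>x. p' i x + q' i x)" for i
    by (intro pf.pf_add *)
  moreover have "(\<lambda>x. p' i x + q' i x) = (\<lambda>_. 0)" if "d = 0" for i
    using *(2,5)[OF that] by (simp add: fun_eq_iff)
  ultimately have "gradient_of d (\<lambda>x. p x + q x) (\<lambda>i x. p' i x + q' i x)"
    unfolding gradient_of_def by blast
  then show ?case by blast
next
  case (pf_cx_mult d p j)
  then obtain p' where p': "gradient_of d p p'" by blast
  note * = gradient_ofD[OF p']
  define q where "q i x = (if i = j then 1 else 0) * p x + cx j x * p' i x" for i x
  have "pf d (q i)" for i
    unfolding q_def
  proof (rule pf_add)
    show "pf d (\<lambda>x. (if i = j then 1 else 0) * p x)" using pf_cx_mult.hyps by (rule pf_cmult)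
    show "pf d (\<lambda>x. cx j x * p' i x)"
      using *(1,2)[of i] pf.pf_cx_mult[of "d - 1" "p' i" j] by (cases d) auto
  qed
  moreover have "((\<lambda>x. cx j x * p x) has_derivative (\<lambda>h. \<Sum>i\<in>UNIV. cx i h * q i x)) (at x)" for x
  proof -
    have "(cx j has_derivative cx j) (at x)"
      by (intro has_derivative_of_real bounded_linear_imp_has_derivative bounded_linear_vec_nth)
    moreover have "(\<Sum>i\<in>UNIV. cx i h * q i x) = cx j h * p x + cx j x * (\<Sum>i\<in>UNIV. cx i h * p' i x)" for h
      unfolding q_def distrib_left sum.distrib
      by (simp add: if_distrib if_distribR sum_distrib_left mult_ac cong: if_cong)
    ultimately show ?thesis
      using has_derivative_mult[OF _ *(3)[of x], of "cx j" "cx j"] by (simp add: add_ac)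
  qed
  ultimately have "gradient_of (Suc d) (\<lambda>x. cx j x * p x) q"
    unfolding gradient_of_def by simp
  then show ?case by blast
qed

lemma partial_of_has_derivative:
  assumes "(F has_derivative F') (at x)"
  shows "partial v F x = F' v" "(\<lambda>h. F (x + h *\<^sub>R v)) differentiable (at 0)"
proof -
  have *: "((\<lambda>h::real. x + h *\<^sub>R v) has_derivative (\<lambda>h. h *\<^sub>R v)) (at 0)"
    by (auto intro!: derivative_eq_intros)
  have F: "(F has_derivative F') (at (x + 0 *\<^sub>R v))" using assms by simp
  have D: "((\<lambda>h. F (x + h *\<^sub>R v)) has_derivative (\<lambda>h. F' (h *\<^sub>R v))) (at 0)"
    using has_derivative_compose[OF * F] by simp
  then have "((\<lambda>h. F (x + h *\<^sub>R v)) has_vector_derivative F' v) (at 0)"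
    unfolding has_vector_derivative_def
    by (simp add: linear_scale[OF has_derivative_linear[OF assms]])
  then show "partial v F x = F' v" unfolding partial_def by (rule vector_derivative_at)
  show "(\<lambda>h. F (x + h *\<^sub>R v)) differentiable (at 0)" using D by (rule differentiableI)
qed

lemma
  assumes "pf d p"
  shows pf_has_derivative: "(p has_derivative (\<lambda>h. \<Sum>i\<in>UNIV. cx i h * pd i p x)) (at x)"
    and pf_pd: "pf (d - 1) (pd i p)"
    and pf_0_pd: "d = 0 \<Longrightarrow> pd i p x = 0"
proof -
  from pf_gradient_ex[OF assms] obtain p' where p': "gradient_of d p p'" by blast
  note * = gradient_ofD[OF p']
  have "pd i p x = p' i x" for i x
    using partial_of_has_derivative(1)[OF *(3)[of x], of "axis i 1"]
    by (simp add: axis_def if_distrib if_distribR cong: if_cong)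
  then have eq: "pd i p = p' i" for i by blast
  show "(p has_derivative (\<lambda>h. \<Sum>i\<in>UNIV. cx i h * pd i p x)) (at x)" using * by (simp add: eq)
  show "pf (d - 1) (pd i p)" using * by (simp add: eq)
  show "d = 0 \<Longrightarrow> pd i p x = 0" using * by (simp add: eq)
qed

lemma polyf_intros [simp, intro]:
  shows "polyf (\<lambda>_. c)"
    and "polyf (cx i)"
    and "polyf p \<Longrightarrow> polyf q \<Longrightarrow> polyf (\<lambda>x. p x + q x)"
    and "polyf p \<Longrightarrow> polyf q \<Longrightarrow> polyf (\<lambda>x. p x - q x)"
    and "polyf p \<Longrightarrow> polyf q \<Longrightarrow> polyf (\<lambda>x. p x * q x)"
    and "polyf p \<Longrightarrow> polyf (\<lambda>x. p x ^ n)"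
    and "polyf p \<Longrightarrow> polyf (\<lambda>x. cnj (p x))"
    and "polyf p \<Longrightarrow> polyf (pd i p)"
    and "polyf p \<Longrightarrow> polyf (\<lambda>x. - p x)"
proof -
  show "polyf (\<lambda>_. c)" "polyf (cx i)" unfolding polyf_def using pf_cx by auto
  show "polyf p \<Longrightarrow> polyf q \<Longrightarrow> polyf (\<lambda>x. p x + q x)" unfolding polyf_def
    by (metis pf_add pf_mono max.cobounded1 max.cobounded2)
  show "polyf p \<Longrightarrow> polyf q \<Longrightarrow> polyf (\<lambda>x. p x - q x)" unfolding polyf_def
    by (metis pf_diff pf_mono max.cobounded1 max.cobounded2)
  show "polyf p \<Longrightarrow> polyf q \<Longrightarrow> polyf (\<lambda>x. p x * q x)" unfolding polyf_def
    by (blast intro: pf_mult)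
  show "polyf p \<Longrightarrow> polyf (\<lambda>x. p x ^ n)" unfolding polyf_def by (blast intro: pf_power)
  show "polyf p \<Longrightarrow> polyf (\<lambda>x. cnj (p x))" unfolding polyf_def by (blast intro: pf_cnj)
  show "polyf p \<Longrightarrow> polyf (pd i p)" unfolding polyf_def by (blast intro: pf_pd)
  show "polyf p \<Longrightarrow> polyf (\<lambda>x. - p x)" unfolding polyf_def using pf_cmult[of _ p "-1"] by auto
qed

lemma polyf_sum [simp, intro]: "(\<And>i. i \<in> I \<Longrightarrow> polyf (p i)) \<Longrightarrow> polyf (\<lambda>x. \<Sum>i\<in>I. p i x)"
  by (induction I rule: infinite_finite_induct) auto

lemma polyf_has_derivative:
  "polyf p \<Longrightarrow> (p has_derivative (\<lambda>h. \<Sum>i\<in>UNIV. cx i h * pd i p x)) (at x)"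
  unfolding polyf_def using pf_has_derivative by blast

lemma polyf_partial: "polyf p \<Longrightarrow> partial v p x = (\<Sum>i\<in>UNIV. cx i v * pd i p x)"
  using partial_of_has_derivative(1)[OF polyf_has_derivative] .

lemma polyf_continuous_on: "polyf p \<Longrightarrow> continuous_on A p"
  by (meson continuous_at_imp_continuous_on has_derivative_continuous polyf_has_derivative)

lemma sum_axis_mult: "(\<Sum>j\<in>UNIV. cx j (axis i 1) * q j) = q i"
  by (simp add: axis_def if_distrib if_distribR cong: if_cong)

lemma pd_const [simp]: "pd i (\<lambda>_. c) x = 0"
  using partial_of_has_derivative(1)[of "\<lambda>_. c" "\<lambda>_. 0"] by simp

lemma pd_cx: "pd i (cx j) x = (if i = j then 1 else 0)"
proof -
  have "(cx j has_derivative cx j) (at x)"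
    by (intro has_derivative_of_real bounded_linear_imp_has_derivative bounded_linear_vec_nth)
  from partial_of_has_derivative(1)[OF this, of "axis i 1"] show ?thesis by (simp add: axis_def)
qed

lemma pd_add:
  assumes "polyf p" "polyf q"
  shows "pd i (\<lambda>x. p x + q x) x = pd i p x + pd i q x"
  using partial_of_has_derivative(1)[OF has_derivative_add[OF
    polyf_has_derivative[OF assms(1)] polyf_has_derivative[OF assms(2)]], of "axis i 1"]
  by (simp add: sum_axis_mult)

lemma pd_diff:
  assumes "polyf p" "polyf q"
  shows "pd i (\<lambda>x. p x - q x) x = pd i p x - pd i q x"
  using partial_of_has_derivative(1)[OF has_derivative_diff[OF
    polyf_has_derivative[OF assms(1)] polyf_has_derivative[OF assms(2)]], of "axis i 1"]
  by (simp add: sum_axis_mult)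

lemma pd_mult:
  assumes "polyf p" "polyf q"
  shows "pd i (\<lambda>x. p x * q x) x = p x * pd i q x + pd i p x * q x"
  using partial_of_has_derivative(1)[OF has_derivative_mult[OF
    polyf_has_derivative[OF assms(1)] polyf_has_derivative[OF assms(2)]], of "axis i 1"]
  by (simp add: sum_axis_mult)

lemma pd_cnj:
  assumes "polyf p"
  shows "pd i (\<lambda>x. cnj (p x)) x = cnj (pd i p x)"
  using partial_of_has_derivative(1)[OF has_derivative_cnj[OF
    polyf_has_derivative[OF assms(1)]], of "axis i 1"]
  by (simp add: axis_def if_distrib if_distribR cong: if_cong)

lemma pd_sum:
  assumes "\<And>j. j \<in> I \<Longrightarrow> polyf (p j)"
  shows "pd i (\<lambda>x. \<Sum>j\<in>I. p j x) x = (\<Sum>j\<in>I. pd i (p j) x)"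
  using assms by (induction I rule: infinite_finite_induct) (simp_all add: pd_add)

lemma pd_cmult: "polyf p \<Longrightarrow> pd i (\<lambda>x. c * p x) x = c * pd i p x"
  by (simp add: pd_mult)

text \<open>Symmetry of second derivatives is read off from the inductive construction;
  \<open>polyf p\<close> travels through the induction so that the sum and product rules
  apply.\<close>

lemma pd_commute:
  assumes "polyf p"
  shows "pd i (pd j p) x = pd j (pd i p) x"
proof -
  obtain d where "pf d p" using assms by (auto simp: polyf_def)
  then have "polyf p \<and> (\<forall>x. pd i (pd j p) x = pd j (pd i p) x)"
  proof (induction rule: pf.induct)
    case (pf_const d c)
    have "pd i (\<lambda>_. c) = (\<lambda>_. 0)" for i by (simp add: fun_eq_iff)
    then show ?case by simp
  next
    case (pf_add d p q)
    then have "pd i (\<lambda>x. p x + q x) = (\<lambda>x. pd i p x + pd i q x)" for i by (simp add: fun_eq_iff pd_add)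
    then show ?case using pf_add.IH by (simp add: pd_add)
  next
    case (pf_cx_mult d p k)
    then have "pd i (\<lambda>x. cx k x * p x) = (\<lambda>x. cx k x * pd i p x + (if i = k then 1 else 0) * p x)" for i
      by (simp add: fun_eq_iff pd_mult pd_cx)
    then show ?case using pf_cx_mult.IH by (simp add: pd_add pd_mult pd_cx)
  qed
  then show ?thesis by blast
qed

section \<open>The Laplace--Beltrami operator on polynomials\<close>

definition rs :: "cfun \<Rightarrow> cfun" where
  "rs p x = (if x \<in> S2 then p x else 0)"

definition eu :: "cfun \<Rightarrow> cfun" where
  "eu p x = (\<Sum>i\<in>UNIV. cx i x * pd i p x)"

definition lap :: "cfun \<Rightarrow> cfun" where
  "lap p x = (\<Sum>i\<in>UNIV. pd i (pd i p) x)"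

text \<open>In polar coordinates the Laplacian is r^(-2) ((r d/dr)^2 + r d/dr + Delta_S). With
  \<open>eu\<close> for r d/dr, setting r = 1 and solving for Delta_S gives this expression.\<close>

definition lapS :: "cfun \<Rightarrow> cfun" where
  "lapS p x = lap p x - eu p x - eu (eu p) x"

lemma polyf_eu [simp, intro]: "polyf p \<Longrightarrow> polyf (eu p)"
  unfolding eu_def[abs_def] by (intro polyf_intros polyf_sum)

lemma polyf_lap [simp, intro]: "polyf p \<Longrightarrow> polyf (lap p)"
  unfolding lap_def[abs_def] by (intro polyf_intros polyf_sum)

lemma eu_add: "polyf p \<Longrightarrow> polyf q \<Longrightarrow> eu (\<lambda>x. p x + q x) x = eu p x + eu q x"
  by (simp add: eu_def pd_add distrib_left sum.distrib)

lemma eu_diff: "polyf p \<Longrightarrow> polyf q \<Longrightarrow> eu (\<lambda>x. p x - q x) x = eu p x - eu q x"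
  by (simp add: eu_def pd_diff right_diff_distrib sum_subtractf)

lemma eu_mult: "polyf p \<Longrightarrow> polyf q \<Longrightarrow> eu (\<lambda>x. p x * q x) x = p x * eu q x + eu p x * q x"
  by (simp add: eu_def pd_mult distrib_left sum.distrib sum_distrib_left sum_distrib_right mult_ac)

lemma eu_sum:
  "(\<And>j. j \<in> I \<Longrightarrow> polyf (p j)) \<Longrightarrow> eu (\<lambda>x. \<Sum>j\<in>I. p j x) x = (\<Sum>j\<in>I. eu (p j) x)"
  by (simp add: eu_def pd_sum sum_distrib_left sum.swap[of _ I])

lemma eu_cmult: "polyf p \<Longrightarrow> eu (\<lambda>x. c * p x) x = c * eu p x"
  by (simp add: eu_def pd_cmult sum_distrib_left mult_ac)

lemma eu_cx: "eu (cx i) x = cx i x"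
  by (simp add: eu_def pd_cx if_distrib cong: if_cong)

lemma Basis_R3: "(Basis :: R3 set) = range (\<lambda>i. axis i 1)"
  by (auto simp: Basis_vec_def)

lemma sum_Basis_R3: "(\<Sum>v\<in>Basis. f (v :: R3)) = (\<Sum>i\<in>UNIV. f (axis i 1))"
  unfolding Basis_R3 by (subst sum.reindex) (auto simp: inj_on_def axis_eq_axis)

section \<open>Smoothness of the extension along rays\<close>

lemma sgn_has_derivative_R3:
  fixes x :: R3
  assumes "x \<noteq> 0"
  shows "(sgn has_derivative (\<lambda>h. (h - (sgn x \<bullet> h) *\<^sub>R sgn x) /\<^sub>R norm x)) (at x)"
proof -
  have "((\<lambda>x::R3. x /\<^sub>R norm x) has_derivative
      (\<lambda>h. (h - (sgn x \<bullet> h) *\<^sub>R sgn x) /\<^sub>R norm x)) (at x)"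
    using assms
    by (auto intro!: derivative_eq_intros has_derivative_norm simp: sgn_div_norm fun_eq_iff algebra_simps inner_commute)
  moreover have "(sgn :: R3 \<Rightarrow> R3) = (\<lambda>x. x /\<^sub>R norm x)"
    by (simp add: fun_eq_iff sgn_div_norm)
  ultimately show ?thesis by simp
qed

text \<open>The functions |x|^(-m) q(x/|x|) form a class closed under partial derivatives, each of
  which raises \<open>m\<close> by one. The extension constant along rays is the case
  \<open>m = 0\<close>, so smoothness of every order becomes an induction.\<close>

definition ray_ext :: "nat \<Rightarrow> cfun \<Rightarrow> cfun" where
  "ray_ext m q x = of_real (inverse (norm x) ^ m) * q (sgn x)"

text \<open>The three terms are the Euclidean gradient of \<open>q\<close>, the removal of its
  radial part by the derivative of \<open>sgn\<close>, and the derivative of the power of the norm.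
  \<open>F\<close> agrees with \<open>ray_ext\<close> only off the origin because iterated partial
  derivatives are known to have this form only there.\<close>

lemma ray_ext_differentiable:
  assumes q: "polyf q" and x: "x \<noteq> 0" and F: "\<And>x. x \<noteq> 0 \<Longrightarrow> F x = ray_ext m q x"
  shows "\<exists>F'. (F has_derivative F') (at x) \<and>
    (\<forall>i. F' (axis i 1) = ray_ext (Suc m) (\<lambda>y. pd i q y - cx i y * eu q y - of_nat m * (cx i y * q y)) x)"
proof -
  have q': "((\<lambda>x. q (sgn x)) has_derivative
      (\<lambda>h. \<Sum>i\<in>UNIV. cx i ((h - (sgn x \<bullet> h) *\<^sub>R sgn x) /\<^sub>R norm x) * pd i q (sgn x))) (at x)"
    by (rule has_derivative_compose[OF sgn_has_derivative_R3[OF x] polyf_has_derivative[OF q]])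
  have n': "((\<lambda>x. complex_of_real (inverse (norm x) ^ m)) has_derivative
      (\<lambda>h. of_real (- of_nat m * inverse (norm x) ^ Suc m * (sgn x \<bullet> h)))) (at x)"
  proof (rule has_derivative_of_real)
    show "((\<lambda>x. inverse (norm x) ^ m) has_derivative
      (\<lambda>h. - of_nat m * inverse (norm x) ^ Suc m * (sgn x \<bullet> h))) (at x)"
    proof (induction m)
      case (Suc m)
      have "((\<lambda>x. inverse (norm x)) has_derivative (\<lambda>h. - (inverse (norm x) * (sgn x \<bullet> h) * inverse (norm x)))) (at x)"
        by (rule has_derivative_eq_rhs[OF Deriv.has_derivative_inverse[OF _ has_derivative_norm]])
          (use x in \<open>auto simp: inner_commute\<close>)
      from has_derivative_mult[OF this Suc] show ?case
        by (simp add: algebra_simps)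
    qed simp
  qed
  define F' where "F' h = complex_of_real (inverse (norm x) ^ m) *
      (\<Sum>i\<in>UNIV. cx i ((h - (sgn x \<bullet> h) *\<^sub>R sgn x) /\<^sub>R norm x) * pd i q (sgn x)) +
      of_real (- of_nat m * inverse (norm x) ^ Suc m * (sgn x \<bullet> h)) * q (sgn x)" for h
  have "(ray_ext m q has_derivative F') (at x)"
    using has_derivative_mult[OF n' q'] by (simp add: ray_ext_def[abs_def] F'_def[abs_def])
  then have "(F has_derivative F') (at x)"
    by (rule has_derivative_transform_within_open[of _ _ _ _ "- {0}"]) (use x F in auto)
  moreover have "F' (axis i 1) =
     ray_ext (Suc m) (\<lambda>y. pd i q y - cx i y * eu q y - of_nat m * (cx i y * q y)) x" for i
  proof -
    have e: "(\<Sum>j\<in>UNIV. cx j ((axis i 1 - (sgn x \<bullet> axis i 1) *\<^sub>R sgn x) /\<^sub>R norm x) * pd j q (sgn x))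
       = of_real (inverse (norm x)) * ((\<Sum>j\<in>UNIV. cx j (axis i 1) * pd j q (sgn x))
          - cx i (sgn x) * eu q (sgn x))"
      by (simp add: inner_axis eu_def right_diff_distrib left_diff_distrib sum_subtractf
          sum_distrib_left mult_ac)
    show ?thesis
      unfolding F'_def ray_ext_def e sum_axis_mult by (simp add: inner_axis algebra_simps)
  qed
  ultimately show ?thesis by blast
qed

lemma
  assumes q: "polyf q" and x: "x \<noteq> 0" and F: "\<And>x. x \<noteq> 0 \<Longrightarrow> F x = ray_ext m q x"
  shows partial_ray_ext:
      "pd i F x = ray_ext (Suc m) (\<lambda>y. pd i q y - cx i y * eu q y - of_nat m * (cx i y * q y)) x"
    and ray_ext_isCont: "isCont F x"
    and ray_ext_partial_differentiable: "(\<lambda>h. F (x + h *\<^sub>R v)) differentiable (at 0)"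
proof -
  obtain F' where F': "(F has_derivative F') (at x)"
    "F' (axis i 1) = ray_ext (Suc m) (\<lambda>y. pd i q y - cx i y * eu q y - of_nat m * (cx i y * q y)) x"
    using ray_ext_differentiable[OF assms] by blast
  show "pd i F x = ray_ext (Suc m) (\<lambda>y. pd i q y - cx i y * eu q y - of_nat m * (cx i y * q y)) x"
    using partial_of_has_derivative(1)[OF F'(1), of "axis i 1"] F'(2) by simp
  show "isCont F x" using F'(1) by (rule has_derivative_continuous)
  show "(\<lambda>h. F (x + h *\<^sub>R v)) differentiable (at 0)" using F'(1) by (rule partial_of_has_derivative)
qed

lemma C_class_ray_ext:
  assumes "polyf q" "\<And>x. x \<noteq> 0 \<Longrightarrow> F x = ray_ext m q x"
  shows "C_class k (- {0}) F"
  using assms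
proof (induction k arbitrary: F m q)
  case 0
  then show ?case by (auto intro!: continuous_at_imp_continuous_on ray_ext_isCont[OF 0(1)])
next
  case (Suc k)
  have "continuous_on (- {0}) F"
    using Suc.prems by (auto intro!: continuous_at_imp_continuous_on ray_ext_isCont)
  moreover have "C_class k (- {0}) (pd i F)" for i
  proof (rule Suc.IH)
    show "polyf (\<lambda>y. pd i q y - cx i y * eu q y - of_nat m * (cx i y * q y))"
      using Suc.prems(1) by (intro polyf_intros polyf_eu)
    show "pd i F x = ray_ext (Suc m) (\<lambda>y. pd i q y - cx i y * eu q y - of_nat m * (cx i y * q y)) x"
      if "x \<noteq> 0" for x
      using Suc.prems that by (intro partial_ray_ext)
  qed
  ultimately show ?case
    using Suc.prems by (auto simp: Basis_R3 intro: ray_ext_partial_differentiable)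
qed

lemma rs_sgn: "x \<noteq> 0 \<Longrightarrow> (rs p \<circ> sgn) x = ray_ext 0 p x"
  by (simp add: rs_def ray_ext_def norm_sgn)

lemma smooth_S2_rs: "polyf p \<Longrightarrow> smooth_S2 (rs p)"
  unfolding smooth_S2_def using C_class_ray_ext[OF _ rs_sgn] by blast

lemma sum_cx_square: "x \<in> S2 \<Longrightarrow> (\<Sum>i\<in>UNIV. cx i x * cx i x) = 1"
proof -
  assume "x \<in> S2"
  then have "x \<bullet> x = 1" by (simp add: power2_norm_eq_inner[symmetric])
  moreover have "(\<Sum>i\<in>UNIV. cx i x * cx i x) = of_real (x \<bullet> x)"
    by (simp add: inner_vec_def)
  ultimately show ?thesis by simp
qed

text \<open>\<open>partial_ray_ext\<close> is used with \<open>m = 0\<close> and then with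
  \<open>m = 1\<close>; this expresses the operator as the divergence of the tangential gradient
  \<open>q i\<close> with radial corrections.\<close>

lemma laplace_beltrami_rs:
  assumes p: "polyf p" and x: "x \<in> S2"
  shows "laplace_beltrami (rs p) x = lapS p x"
proof -
  have x0: "x \<noteq> 0" using x by auto
  have s: "sgn x = x" using x by (simp add: sgn_div_norm)
  define q where "q i y = pd i p y - cx i y * eu p y" for i y
  have q: "polyf (q i)" for i using p unfolding q_def[abs_def] by (intro polyf_intros polyf_eu)
  have 1: "pd i (rs p \<circ> sgn) y = ray_ext 1 (q i) y" if "y \<noteq> 0" for i y
    using partial_ray_ext[where F = "rs p \<circ> sgn", OF p that rs_sgn] by (simp add: q_def[abs_def])
  have 2: "pd i (pd i (rs p \<circ> sgn)) x = pd i (q i) x - cx i x * eu (q i) x - cx i x * q i x" for i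
    by (subst partial_ray_ext[OF q x0 1[of _ i]]) (use x in \<open>auto simp: ray_ext_def s\<close>)
  \<comment> \<open>The value is (1 - |y|^2) times \<open>eu p y\<close>. It vanishes on the sphere,
    but the identity is kept for all \<open>y\<close> because its radial derivative is taken
    below.\<close>
  have xq: "(\<Sum>i\<in>UNIV. cx i y * q i y) = eu p y - (\<Sum>i\<in>UNIV. cx i y * cx i y) * eu p y" for y
  proof -
    have "cx i y * q i y = cx i y * pd i p y - cx i y * cx i y * eu p y" for i
      by (simp add: q_def algebra_simps)
    then show ?thesis by (simp only: sum_subtractf sum_distrib_right[symmetric] eu_def)
  qed
  \<comment> \<open>The 3 is the dimension of space: each \<open>pd i (cx i)\<close> contributes one
    \<open>eu p x\<close>.\<close>
  have "(\<Sum>i\<in>UNIV. pd i (q i) x) = lap p x - 3 * eu p x - eu (eu p) x"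
  proof -
    have "pd i (q i) x = pd i (pd i p) x - (cx i x * pd i (eu p) x + eu p x)" for i
      unfolding q_def[abs_def] using p by (subst pd_diff) (auto simp: pd_mult pd_cx)
    then show ?thesis by (simp add: sum_subtractf sum.distrib lap_def eu_def[of "eu p"])
  qed
  moreover have 0: "(\<Sum>i\<in>UNIV. cx i x * q i x) = 0"
    by (simp only: xq sum_cx_square[OF x]) simp
  moreover have "(\<Sum>i\<in>UNIV. cx i x * eu (q i) x) = - 2 * eu p x"
  proof -
    have "cx i x * eu (q i) x = eu (\<lambda>y. cx i y * q i y) x - cx i x * q i x" for i
      using q by (simp add: eu_mult eu_cx)
    then have "(\<Sum>i\<in>UNIV. cx i x * eu (q i) x) = (\<Sum>i\<in>UNIV. eu (\<lambda>y. cx i y * q i y) x)"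
      using 0 by (simp add: sum_subtractf)
    also have "\<dots> = eu (\<lambda>y. \<Sum>i\<in>UNIV. cx i y * q i y) x"
      using q by (subst eu_sum) auto
    also have "\<dots> = eu (eu p) x - (1 * eu (eu p) x + 2 * eu p x)"
    proof -
      have "eu (\<lambda>y. \<Sum>i\<in>UNIV. cx i y * cx i y) x = 2 * (\<Sum>i\<in>UNIV. cx i x * cx i x)"
        by (simp add: eu_sum eu_mult eu_cx sum_distrib_left)
      then show ?thesis using p
        unfolding xq by (simp add: eu_diff eu_mult sum_cx_square[OF x])
    qed
    finally show ?thesis by simp
  qed
  ultimately have "(\<Sum>i\<in>UNIV. pd i (pd i (rs p \<circ> sgn)) x) = lapS p x"
    by (simp add: 2 sum_subtractf lapS_def)
  then show ?thesis by (simp add: laplace_beltrami_def sum_Basis_R3)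
qed

lemma rs_mem_eigenspace:
  assumes "polyf p" "\<And>x. x \<in> S2 \<Longrightarrow> lapS p x = - of_nat (n * Suc n) * p x"
  shows "rs p \<in> eigenspace n"
proof -
  have "(lam n)\<^sup>2 = real (n * Suc n) + 1"
    by (simp add: lam_def power2_eq_square algebra_simps)
  then have l: "complex_of_real ((lam n)\<^sup>2) = of_nat (n * Suc n) + 1" by simp
  have "- laplace_beltrami (rs p) x + rs p x = of_real ((lam n)\<^sup>2) * rs p x" if x: "x \<in> S2" for x
    unfolding l laplace_beltrami_rs[OF assms(1) x] assms(2)[OF x]
    using x by (simp add: rs_def algebra_simps)
  moreover have "rs p x = 0" if "x \<notin> S2" for x
    using that by (simp add: rs_def)
  ultimately show ?thesis
    using smooth_S2_rs[OF assms(1)] unfolding eigenspace_def by blast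
qed

section \<open>Integration over the sphere and infinitesimal rotations\<close>

abbreviation sphint :: "cfun \<Rightarrow> complex" where
  "sphint F \<equiv> integral\<^sup>L sphere_measure F"

abbreviation mean_square :: "cfun \<Rightarrow> real" where
  "mean_square F \<equiv> \<integral>x. (cmod (F x))\<^sup>2 \<partial>sphere_measure"

abbreviation quad_moment :: "(R3 \<Rightarrow> real) \<Rightarrow> R3 \<Rightarrow> real" where
  "quad_moment f p \<equiv> \<integral>x. f x * (p \<bullet> x)\<^sup>2 \<partial>sphere_measure"

lemma integrable_sphere_continuous:
  fixes F :: "R3 \<Rightarrow> 'a :: {banach, second_countable_topology}"
  assumes "continuous_on S2 F"
  shows "integrable sphere_measure F"
proof -
  interpret prob_space sphere_measure by (rule prob_space_sphere_measure)
  have "F \<in> borel_measurable (restrict_space borel S2)"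
    using assms by (rule borel_measurable_continuous_on_restrict)
  then have m: "F \<in> borel_measurable sphere_measure"
    by (simp add: measurable_cong_sets[OF sets_sphere_measure refl])
  have "bounded (F ` S2)"
    using assms by (intro compact_imp_bounded compact_continuous_image compact_sphere)
  then obtain B where "\<And>x. x \<in> S2 \<Longrightarrow> norm (F x) \<le> B" unfolding bounded_iff by blast
  then show ?thesis using m by (intro integrable_const_bound[of _ B] AE_I2) auto
qed

lemma integrable_sphere_polyf [simp, intro]: "polyf F \<Longrightarrow> integrable sphere_measure F"
  by (intro integrable_sphere_continuous polyf_continuous_on)

lemma sphint_cong: "(\<And>x. x \<in> S2 \<Longrightarrow> F x = G x) \<Longrightarrow> sphint F = sphint G"
  by (intro Bochner_Integration.integral_cong) auto

lemma sphint_orthogonal: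
  assumes S: "orthogonal_transformation (S :: R3 \<Rightarrow> R3)" and F: "polyf F"
  shows "sphint (\<lambda>x. F (S x)) = sphint F"
proof -
  have nS: "norm (S x) = norm x" for x using S by (simp add: orthogonal_transformation_norm)
  have Sb: "S \<in> borel_measurable borel"
    using S by (intro borel_measurable_continuous_onI linear_continuous_on)
      (simp add: linear_linear orthogonal_transformation_linear)
  have mS: "S \<in> measurable sphere_measure sphere_measure"
    unfolding measurable_cong_sets[OF sets_sphere_measure sets_sphere_measure]
    using Sb by (intro measurable_restrict_space3) (auto simp: nS)
  have "F \<in> borel_measurable sphere_measure" using F by (intro borel_measurable_integrable) simp
  from integral_distr[OF mS this] show ?thesis
    by (simp add: sphere_measure_rotation_invariant[OF S])
qed

section \<open>Infinitesimal rotations and integration by parts\<close>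

definition rot :: "R3 \<Rightarrow> cfun \<Rightarrow> cfun" where
  "rot p F x = (\<Sum>i\<in>UNIV. cx i (cross3 p x) * pd i F x)"

lemma pf_cross3: "pf 1 (\<lambda>x. cx i (cross3 p x))"
  using pf_compose_linear[OF pf_cx, of "cross3 p" i] bilinear_cross by (simp add: bilinear_def)

text \<open>Differentiation loses one degree and the linear field \<open>cross3 p x\<close> regains
  it. This preservation of degree later confines \<open>rot p\<close> to each eigenspace. In degree
  0 the truncated \<open>d - 1\<close> loses nothing, hence the case distinction.\<close>

lemma pf_rot:
  assumes "pf d F"
  shows "pf d (rot p F)"
proof (cases d)
  case 0
  then have "rot p F = (\<lambda>_. 0)" using assms by (auto simp: rot_def fun_eq_iff pf_0_pd)
  then show ?thesis by simp
next
  case (Suc e)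
  have "pf (1 + e) (\<lambda>x. cx i (cross3 p x) * pd i F x)" for i
    using pf_pd[OF assms, of i] Suc by (intro pf_mult pf_cross3) simp
  then show ?thesis unfolding rot_def[abs_def] using Suc by (intro pf_sum) simp
qed

lemma polyf_rot [simp, intro]: "polyf F \<Longrightarrow> polyf (rot p F)"
  unfolding polyf_def by (blast intro: pf_rot)

lemma rot_mult:
  "polyf F \<Longrightarrow> polyf G \<Longrightarrow> rot p (\<lambda>x. F x * G x) x = F x * rot p G x + rot p F x * G x"
  by (simp add: rot_def pd_mult distrib_left sum.distrib sum_distrib_left sum_distrib_right mult_ac)

lemma rot_cnj: "polyf F \<Longrightarrow> rot p (\<lambda>x. cnj (F x)) x = cnj (rot p F x)"
  by (simp add: rot_def pd_cnj)

lemma rot_axis_sum: "rot p F x = (\<Sum>a\<in>UNIV. of_real (p $ a) * rot (axis a 1) F x)"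
  by (simp add: rot_def sum_3 cross3_def axis_def algebra_simps)

text \<open>The Casimir identity. Summed over the axes, the products of the components i and j of
  \<open>cross3 (axis a 1) x\<close> equal |x|^2 delta_ij - x_i x_j, and the first-order terms add
  up to -2 \<open>eu F\<close>. This matches \<open>lapS\<close> because \<open>eu (eu F)\<close> is
  \<open>eu F\<close> plus the purely second-order radial part.\<close>

lemma sum_rot_rot:
  assumes F: "polyf F" and x: "x \<in> S2"
  shows "(\<Sum>a\<in>UNIV. rot (axis a 1) (rot (axis a 1) F) x) = lapS F x"
proof -
  have 1: "rot (axis a 1) (rot (axis a 1) F) x =
    (\<Sum>i\<in>UNIV. cx i (cross3 (axis a 1) x) *
      (\<Sum>j\<in>UNIV. cx j (cross3 (axis a 1) x) * pd i (pd j F) x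
        + pd i (\<lambda>x. cx j (cross3 (axis a 1) x)) x * pd j F x))" for a
  proof -
    have "polyf (\<lambda>x. cx j (cross3 (axis a 1) x))" for j
      unfolding polyf_def using pf_cross3 by blast
    then show ?thesis
      using F by (simp add: rot_def[abs_def] pd_sum pd_mult)
  qed
  have 2: "pd i (\<lambda>x. cx j (cross3 p x)) x = cx j (cross3 p (axis i 1))" for i j p
  proof -
    have "bounded_linear (\<lambda>x. cross3 p x $ j)"
      by (intro bounded_linear_compose[OF bounded_linear_vec_nth]) (use bilinear_cross in \<open>simp add: bilinear_def linear_linear\<close>)
    then have "((\<lambda>x. cx j (cross3 p x)) has_derivative (\<lambda>x. cx j (cross3 p x))) (at x)"
      by (intro has_derivative_of_real bounded_linear_imp_has_derivative)
    from partial_of_has_derivative(1)[OF this] show ?thesis .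
  qed
  have "eu (eu F) x = eu F x + (\<Sum>i\<in>UNIV. \<Sum>j\<in>UNIV. cx i x * cx j x * pd i (pd j F) x)"
  proof -
    have "pd i (eu F) x = (\<Sum>j\<in>UNIV. cx j x * pd i (pd j F) x + pd i (cx j) x * pd j F x)" for i
      using F by (simp add: eu_def[abs_def] pd_sum pd_mult)
    then have "pd i (eu F) x = (\<Sum>j\<in>UNIV. cx j x * pd i (pd j F) x) + pd i F x" for i
      unfolding sum.distrib pd_cx by (simp add: if_distrib[of "\<lambda>c. c * _"] cong: if_cong)
    then show ?thesis
      by (simp add: eu_def[of "eu F"] eu_def[of F x] distrib_left sum.distrib sum_distrib_left mult_ac)
  qed
  moreover have "(\<Sum>a\<in>UNIV. rot (axis a 1) (rot (axis a 1) F) x) =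
     (\<Sum>i\<in>UNIV. cx i x * cx i x) * lap F x - 2 * eu F x
      - (\<Sum>i\<in>UNIV. \<Sum>j\<in>UNIV. cx i x * cx j x * pd i (pd j F) x)"
    unfolding 1 2 lap_def eu_def
    by (simp add: sum_3 cross3_def axis_def pd_commute[OF F, of 2 1] pd_commute[OF F, of 3 1]
        pd_commute[OF F, of 3 2]) (simp add: algebra_simps)
  ultimately show ?thesis using sum_cx_square[OF x] by (simp add: lapS_def)
qed

text \<open>Separated functions of \<open>(s, x)\<close>: for these, differentiation in \<open>s\<close> commutes with integration
  over \<open>x\<close> for trivial reasons.\<close>

inductive separated :: "(real \<Rightarrow> R3 \<Rightarrow> complex) \<Rightarrow> bool" where
  separated_base: "polyf G \<Longrightarrow> (c has_vector_derivative c') (at 0) \<Longrightarrow> separated (\<lambda>s x. c s * G x)"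
| separated_add: "separated H \<Longrightarrow> separated K \<Longrightarrow> separated (\<lambda>s x. H s x + K s x)"

lemma separated_mult:
  assumes "separated H" "separated K"
  shows "separated (\<lambda>s x. H s x * K s x)"
  using assms
proof (induction rule: separated.induct)
  case (separated_base G c c')
  note 1 = separated_base.hyps
  from separated_base.prems show ?case
  proof (induction rule: separated.induct)
    case (separated_base G' e e')
    have "separated (\<lambda>s x. (c s * e s) * (G x * G' x))"
      using separated_base 1 by (intro separated.separated_base[OF _ has_vector_derivative_mult]) auto
    then show ?case by (simp add: mult_ac)
  qed (simp add: distrib_left separated_add)
qed (simp add: distrib_right separated_add)

lemma separated_derivative:
  assumes "separated H"
  shows "\<exists>H'. polyf H' \<and> (\<forall>s. polyf (H s)) \<and>
    (\<forall>x. ((\<lambda>s. H s x) has_vector_derivative H' x) (at 0)) \<and>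
    ((\<lambda>s. sphint (H s)) has_vector_derivative sphint H') (at 0)"
  using assms
proof (induction rule: separated.induct)
  case (separated_base G c c')
  have "((\<lambda>s. c s * a) has_vector_derivative c' * a) (at 0)" for a
    using separated_base(2) by (rule has_vector_derivative_mult_left)
  with separated_base(1) show ?case
    by (intro exI[of _ "\<lambda>x. c' * G x"]) auto
next
  case (separated_add H K)
  then obtain H' K' where *: "polyf H'" "polyf K'" "\<And>s. polyf (H s)" "\<And>s. polyf (K s)"
    "\<And>x. ((\<lambda>s. H s x) has_vector_derivative H' x) (at 0)"
    "\<And>x. ((\<lambda>s. K s x) has_vector_derivative K' x) (at 0)"
    "((\<lambda>s. sphint (H s)) has_vector_derivative sphint H') (at 0)"
    "((\<lambda>s. sphint (K s)) has_vector_derivative sphint K') (at 0)" by blast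
  have "((\<lambda>s. sphint (\<lambda>x. H s x + K s x)) has_vector_derivative sphint (\<lambda>x. H' x + K' x)) (at 0)"
    using has_vector_derivative_add[OF *(7,8)] *(1-4) by simp
  moreover have "((\<lambda>s. H s x + K s x) has_vector_derivative H' x + K' x) (at 0)" for x
    using *(5,6) by (rule has_vector_derivative_add)
  ultimately show ?case
    using *(1-4) by (intro exI[of _ "\<lambda>x. H' x + K' x"]) auto
qed

text \<open>Rodrigues' formula for the rotation by the angle \<open>s\<close> about a unit vector
  \<open>p\<close>. The angle enters only through coefficients cos and sin, which is why a
  polynomial composed with it is \<open>separated\<close>.\<close>

definition rotation :: "R3 \<Rightarrow> real \<Rightarrow> R3 \<Rightarrow> R3" where
  "rotation p s x = cos s *\<^sub>R x + sin s *\<^sub>R cross3 p x + ((1 - cos s) * (p \<bullet> x)) *\<^sub>R p"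

lemma rotation_orthogonal:
  assumes "norm p = 1"
  shows "orthogonal_transformation (rotation p s)"
proof -
  have pp: "p \<bullet> p = 1" using assms by (simp add: power2_norm_eq_inner[symmetric])
  have "linear (rotation p s)"
    by (rule linearI) (simp_all add: rotation_def cross_add_right cross_mult_right algebra_simps inner_simps)
  moreover have "norm (rotation p s x) = norm x" for x
  proof -
    have c: "cross3 p x \<bullet> cross3 p x = x \<bullet> x - (p \<bullet> x)\<^sup>2"
      using norm_cross_dot[of p x] assms by (simp add: power2_norm_eq_inner)
    have d: "cross3 p x \<bullet> x = 0" "x \<bullet> cross3 p x = 0" "cross3 p x \<bullet> p = 0" "p \<bullet> cross3 p x = 0"
      by (simp_all add: dot_cross_self)
    have "rotation p s x \<bullet> rotation p s x =
      (cos s)\<^sup>2 * (x \<bullet> x) + (sin s)\<^sup>2 * (x \<bullet> x - (p \<bullet> x)\<^sup>2) + (1 - cos s)\<^sup>2 * (p \<bullet> x)\<^sup>2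
        + 2 * cos s * (1 - cos s) * (p \<bullet> x)\<^sup>2"
      unfolding rotation_def
      by (simp add: inner_simps c d pp inner_commute[of x p]) (simp add: power2_eq_square algebra_simps)
    also have "\<dots> = x \<bullet> x"
      unfolding sin_squared_eq by (simp add: power2_eq_square algebra_simps)
    finally show ?thesis by (simp add: norm_eq_sqrt_inner)
  qed
  ultimately show ?thesis by (simp add: orthogonal_transformation)
qed

lemma rotation_0 [simp]: "rotation p 0 x = x"
  by (simp add: rotation_def)

lemma rotation_derivative: "((\<lambda>s. rotation p s x) has_vector_derivative cross3 p x) (at 0)"
  unfolding rotation_def by (auto intro!: derivative_eq_intros simp: has_vector_derivative_def)

lemma separated_rotation:
  assumes "polyf F"
  shows "separated (\<lambda>s x. F (rotation p s x))"
proof -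
  obtain d where "pf d F" using assms by (auto simp: polyf_def)
  then show ?thesis
  proof (induction rule: pf.induct)
    case (pf_const d c)
    show ?case using separated_base[of "\<lambda>_. c" "\<lambda>_. 1" 0] by simp
  next
    case (pf_add d p q)
    then show ?case by (intro separated_add)
  next
    case (pf_cx_mult d q i)
    have a: "polyf (\<lambda>x. cx i (cross3 p x))" "polyf (\<lambda>x. complex_of_real ((p \<bullet> x) * p $ i))"
      using pf_cross3 by (auto simp: polyf_def[of "\<lambda>x. cx i (cross3 p x)"] inner_vec_def)
    have c: "((\<lambda>s. of_real (f s)) has_vector_derivative complex_of_real f') (at 0)"
      if "(f has_real_derivative f') (at 0)" for f f'
      using that by (intro has_vector_derivative_of_real) (simp add: has_real_derivative_iff_has_vector_derivative)
    have "((\<lambda>s::real. 1 - cos s) has_real_derivative 0) (at 0)"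
      "(cos has_real_derivative 0) (at 0)" "(sin has_real_derivative 1) (at 0)"
      by (auto intro!: derivative_eq_intros)
    then have "separated (\<lambda>s x. of_real (cos s) * cx i x + of_real (sin s) * cx i (cross3 p x)
       + of_real (1 - cos s) * of_real ((p \<bullet> x) * p $ i))"
      by (intro separated_add separated_base[OF polyf_intros(2) c] separated_base[OF a(1) c]
            separated_base[OF a(2) c])
    then have "separated (\<lambda>s x. cx i (rotation p s x))"
      by (simp add: rotation_def mult_ac)
    from separated_mult[OF this pf_cx_mult.IH] show ?case .
  qed
qed

text \<open>The integral of \<open>F\<close> composed with a rotation does not depend on the angle,
  and its derivative at angle 0 is the integral of \<open>rot p F\<close>.\<close>

lemma sphint_rot_unit:
  assumes F: "polyf F" and p: "norm p = 1"
  shows "sphint (rot p F) = 0"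
proof -
  obtain H' where H': "\<And>x. ((\<lambda>s. F (rotation p s x)) has_vector_derivative H' x) (at 0)"
    "((\<lambda>s. sphint (\<lambda>x. F (rotation p s x))) has_vector_derivative sphint H') (at 0)"
    using separated_derivative[OF separated_rotation[OF F]] by blast
  have "H' x = rot p F x" for x
  proof -
    have "(F has_derivative (\<lambda>h. \<Sum>i\<in>UNIV. cx i h * pd i F x)) (at (rotation p 0 x))"
      using polyf_has_derivative[OF F] by simp
    from has_derivative_compose[OF rotation_derivative[unfolded has_vector_derivative_def] this]
    have "((\<lambda>s. F (rotation p s x)) has_vector_derivative rot p F x) (at 0)"
      by (simp add: has_vector_derivative_def rot_def sum_distrib_left scaleR_conv_of_real[where 'a = complex] mult_ac)
    then show ?thesis using H'(1) vector_derivative_unique_at by blast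
  qed
  then have "H' = rot p F" by blast
  moreover have "((\<lambda>s. sphint (\<lambda>x. F (rotation p s x))) has_vector_derivative 0) (at 0)"
    unfolding sphint_orthogonal[OF rotation_orthogonal[OF p] F] by simp
  ultimately show ?thesis using H'(2) vector_derivative_unique_at by blast
qed

lemma sphint_rot:
  assumes F: "polyf F"
  shows "sphint (rot p F) = 0"
proof -
  have "rot p F = (\<lambda>x. \<Sum>a\<in>UNIV. of_real (p $ a) * rot (axis a 1) F x)"
    using rot_axis_sum by blast
  then show ?thesis
    using F by (simp add: Bochner_Integration.integral_sum sphint_rot_unit)
qed

lemma sphint_rot_by_parts:
  assumes F: "polyf F" and G: "polyf G"
  shows "sphint (\<lambda>x. rot p F x * G x) = - sphint (\<lambda>x. F x * rot p G x)"
proof -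
  have "rot p (\<lambda>x. F x * G x) = (\<lambda>x. F x * rot p G x + rot p F x * G x)"
    using F G rot_mult by blast
  then have "sphint (\<lambda>x. F x * rot p G x) + sphint (\<lambda>x. rot p F x * G x) = 0"
    using sphint_rot[of "\<lambda>x. F x * G x" p] F G by simp
  then show ?thesis by (simp add: eq_neg_iff_add_eq_0 add.commute)
qed

lemma sphint_lapS:
  assumes F: "polyf F" and G: "polyf G"
  shows "sphint (\<lambda>x. lapS F x * G x) =
    - (\<Sum>a\<in>UNIV. sphint (\<lambda>x. rot (axis a 1) F x * rot (axis a 1) G x))"
proof -
  have "sphint (\<lambda>x. lapS F x * G x) =
     sphint (\<lambda>x. \<Sum>a\<in>UNIV. rot (axis a 1) (rot (axis a 1) F) x * G x)"
    using sum_rot_rot[OF F] by (intro sphint_cong) (simp flip: sum_distrib_right)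
  also have "\<dots> = (\<Sum>a\<in>UNIV. sphint (\<lambda>x. rot (axis a 1) (rot (axis a 1) F) x * G x))"
    using F G by (intro Bochner_Integration.integral_sum) auto
  also have "\<dots> = - (\<Sum>a\<in>UNIV. sphint (\<lambda>x. rot (axis a 1) F x * rot (axis a 1) G x))"
    using F G by (simp add: sphint_rot_by_parts sum_negf)
  finally show ?thesis .
qed

lemma sphint_lapS_symmetric:
  assumes F: "polyf F" and G: "polyf G"
  shows "sphint (\<lambda>x. lapS F x * G x) = sphint (\<lambda>x. F x * lapS G x)"
proof -
  have "sphint (\<lambda>x. F x * lapS G x) = sphint (\<lambda>x. lapS G x * F x)" by (simp add: mult.commute)
  then show ?thesis using sphint_lapS[OF F G] sphint_lapS[OF G F] by (simp add: mult.commute)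
qed

section \<open>Spherical harmonics\<close>

lemma pf_polyf: "pf d p \<Longrightarrow> polyf p"
  by (auto simp: polyf_def)

lemma lapS_diff:
  assumes "polyf p" "polyf q"
  shows "lapS (\<lambda>x. p x - q x) x = lapS p x - lapS q x"
proof -
  have "pd i (\<lambda>x. p x - q x) = (\<lambda>x. pd i p x - pd i q x)" for i
    using assms pd_diff by blast
  moreover have "eu (\<lambda>x. p x - q x) = (\<lambda>x. eu p x - eu q x)"
    using assms eu_diff by blast
  ultimately show ?thesis
    using assms by (simp add: lapS_def lap_def pd_diff eu_diff sum_subtractf)
qed

lemma lapS_cmult:
  assumes "polyf p"
  shows "lapS (\<lambda>x. c * p x) x = c * lapS p x"
proof -
  have "pd i (\<lambda>x. c * p x) = (\<lambda>x. c * pd i p x)" for i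
    using assms pd_cmult by blast
  moreover have "eu (\<lambda>x. c * p x) = (\<lambda>x. c * eu p x)"
    using assms eu_cmult by blast
  ultimately show ?thesis
    using assms by (simp add: lapS_def lap_def pd_cmult eu_cmult sum_distrib_left right_diff_distrib)
qed

lemma lapS_sum:
  assumes "\<And>j. j \<in> I \<Longrightarrow> polyf (p j)"
  shows "lapS (\<lambda>x. \<Sum>j\<in>I. p j x) x = (\<Sum>j\<in>I. lapS (p j) x)"
proof -
  have "pd i (\<lambda>x. \<Sum>j\<in>I. p j x) = (\<lambda>x. \<Sum>j\<in>I. pd i (p j) x)" for i
    using assms pd_sum by blast
  moreover have "eu (\<lambda>x. \<Sum>j\<in>I. p j x) = (\<lambda>x. \<Sum>j\<in>I. eu (p j) x)"
    using assms eu_sum by blast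
  ultimately show ?thesis
    using assms by (simp add: lapS_def lap_def pd_sum eu_sum sum_subtractf sum.swap[of _ I])
qed

lemma lapS_cnj:
  assumes "polyf p"
  shows "lapS (\<lambda>x. cnj (p x)) x = cnj (lapS p x)"
proof -
  have "pd i (\<lambda>x. cnj (p x)) = (\<lambda>x. cnj (pd i p x))" for i
    using assms pd_cnj by blast
  moreover have eu: "eu (\<lambda>x. cnj (q x)) x = cnj (eu q x)" if "polyf q" for q x
    using that by (simp add: eu_def pd_cnj)
  then have "eu (\<lambda>x. cnj (p x)) = (\<lambda>x. cnj (eu p x))"
    using assms by blast
  ultimately show ?thesis
    using assms by (simp add: lapS_def lap_def pd_cnj eu)
qed

text \<open>Euler's identity for inhomogeneous polynomials: it is exact on the part of top degree
  and wrong only in lower degrees. For \<open>d = 0\<close> the error has to be zero and not merely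
  constant, since there is no lower degree.\<close>

lemma eu_degree:
  assumes "pf d p"
  shows "\<exists>q. pf (d - 1) q \<and> (d = 0 \<longrightarrow> q = (\<lambda>_. 0)) \<and> eu p = (\<lambda>x. of_nat d * p x + q x)"
  using assms
proof (induction rule: pf.induct)
  case (pf_const d c)
  show ?case
    by (rule exI[of _ "\<lambda>_. - of_nat d * c"]) (auto simp: eu_def fun_eq_iff)
next
  case (pf_add d p1 p2)
  then obtain q1 q2 where *: "pf (d - 1) q1" "d = 0 \<longrightarrow> q1 = (\<lambda>_. 0)"
    "eu p1 = (\<lambda>x. of_nat d * p1 x + q1 x)" "pf (d - 1) q2" "d = 0 \<longrightarrow> q2 = (\<lambda>_. 0)"
    "eu p2 = (\<lambda>x. of_nat d * p2 x + q2 x)" by blast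
  then show ?case using pf_add.hyps[THEN pf_polyf]
    by (intro exI[of _ "\<lambda>x. q1 x + q2 x"])
      (auto simp: fun_eq_iff eu_add algebra_simps intro: pf.pf_add)
next
  case (pf_cx_mult d p i)
  then obtain q where *: "pf (d - 1) q" "d = 0 \<longrightarrow> q = (\<lambda>_. 0)"
    "eu p = (\<lambda>x. of_nat d * p x + q x)" by blast
  have "pf d (\<lambda>x. cx i x * q x)"
    using * pf.pf_cx_mult[of "d - 1" q i] by (cases d) auto
  then show ?case using * pf_cx_mult.hyps[THEN pf_polyf]
    by (intro exI[of _ "\<lambda>x. cx i x * q x"])
      (auto simp: fun_eq_iff eu_mult eu_cx algebra_simps)
qed

text \<open>\<open>lap\<close> lowers the degree, so the leading behaviour is that of
  \<open>eu\<close> and its square, namely -(d + d^2).\<close>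

lemma lapS_degree:
  assumes p: "pf d p"
  shows "\<exists>r. pf (d - 1) r \<and> (d = 0 \<longrightarrow> r = (\<lambda>_. 0)) \<and>
    lapS p = (\<lambda>x. - of_nat (d * Suc d) * p x + r x)"
proof -
  obtain q where q: "pf (d - 1) q" "d = 0 \<longrightarrow> q = (\<lambda>_. 0)" "eu p = (\<lambda>x. of_nat d * p x + q x)"
    using eu_degree[OF p] by blast
  obtain q' where q': "pf (d - 1 - 1) q'" "eu q = (\<lambda>x. of_nat (d - 1) * q x + q' x)"
    using eu_degree[OF q(1)] by blast
  have eq: "pf (d - 1) (eu q)"
    unfolding q'(2) using q(1) q'(1) by (intro pf_add pf_cmult) (auto intro: pf_mono)
  define r where "r x = lap p x - (of_nat d + 1) * q x - eu q x" for x
  have "pf (d - 1) (lap p)"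
    unfolding lap_def[abs_def] by (intro pf_sum pf_mono[OF pf_pd[OF pf_pd[OF p]]]) simp
  then have "pf (d - 1) r" unfolding r_def[abs_def] by (intro pf_diff pf_cmult q eq)
  moreover have "r = (\<lambda>_. 0)" if "d = 0"
  proof -
    have "pd i p = (\<lambda>_. 0)" for i using pf_0_pd[OF p that] by (simp add: fun_eq_iff)
    then have "lap p x = 0" for x by (simp add: lap_def)
    then show ?thesis using q(2) that by (simp add: r_def[abs_def] eu_def)
  qed
  moreover have "lapS p = (\<lambda>x. - of_nat (d * Suc d) * p x + r x)"
    using pf_polyf[OF p] pf_polyf[OF q(1)]
    by (simp add: fun_eq_iff lapS_def r_def q(3) eu_add eu_cmult) (simp add: algebra_simps)
  ultimately show ?thesis by blast
qed

text \<open>Neither homogeneity nor harmonicity in space is demanded: the components produced by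
  \<open>harmonic_decomposition\<close> need not have them, and a degree bound with the eigenvalue
  equation on the sphere is enough.\<close>

definition sph_harm :: "nat \<Rightarrow> cfun \<Rightarrow> bool" where
  "sph_harm n p \<longleftrightarrow> pf n p \<and> (\<forall>x\<in>S2. lapS p x = - of_nat (n * Suc n) * p x)"

lemma sph_harm_polyf: "sph_harm n p \<Longrightarrow> polyf p"
  by (auto simp: sph_harm_def polyf_def)

lemma sph_harm_cmult: "sph_harm n p \<Longrightarrow> sph_harm n (\<lambda>x. c * p x)"
  using sph_harm_polyf[of n p] by (auto simp: sph_harm_def lapS_cmult intro: pf_cmult)

lemma sph_harm_sum:
  assumes "\<And>j. j \<in> I \<Longrightarrow> sph_harm n (p j)"
  shows "sph_harm n (\<lambda>x. \<Sum>j\<in>I. p j x)"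
proof -
  have "lapS (\<lambda>x. \<Sum>j\<in>I. p j x) x = - of_nat (n * Suc n) * (\<Sum>j\<in>I. p j x)" if "x \<in> S2" for x
  proof -
    have "lapS (\<lambda>x. \<Sum>j\<in>I. p j x) x = (\<Sum>j\<in>I. lapS (p j) x)"
      using assms sph_harm_polyf by (intro lapS_sum) blast
    also have "\<dots> = (\<Sum>j\<in>I. - of_nat (n * Suc n) * p j x)"
      using assms that by (intro sum.cong) (auto simp: sph_harm_def)
    finally show ?thesis by (simp only: sum_distrib_left)
  qed
  then show ?thesis using assms by (auto simp: sph_harm_def intro: pf_sum)
qed

lemma sph_harm_eigenspace: "sph_harm n p \<Longrightarrow> rs p \<in> eigenspace n"
  by (rule rs_mem_eigenspace) (use sph_harm_polyf in \<open>auto simp: sph_harm_def\<close>)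

text \<open>With \<open>D\<close> the eigenvalue for the new degree, \<open>lapS p + D p\<close> has
  lower degree and decomposes by induction. Dividing its component of degree \<open>m\<close> by
  \<open>D - m (m + 1)\<close> solves \<open>lapS p' + D p' = r\<close> on the sphere, and
  \<open>p - p'\<close> is then the component of top degree.\<close>

lemma harmonic_decomposition:
  assumes "pf d p"
  shows "\<exists>q. (\<forall>m\<le>d. sph_harm m (q m)) \<and> (\<forall>x\<in>S2. p x = (\<Sum>m\<le>d. q m x))"
  using assms
proof (induction d arbitrary: p)
  case 0
  then have "sph_harm 0 p" using lapS_degree[of 0 p] by (auto simp: sph_harm_def)
  then show ?case by (intro exI[of _ "\<lambda>_. p"]) auto
next
  case (Suc d)
  define D :: complex where "D = of_nat (Suc d * Suc (Suc d))"
  obtain r where r: "pf d r" "lapS p = (\<lambda>x. - D * p x + r x)"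
    using lapS_degree[OF Suc.prems] unfolding D_def by auto
  obtain s where s: "\<And>m. m \<le> d \<Longrightarrow> sph_harm m (s m)" "\<And>x. x \<in> S2 \<Longrightarrow> r x = (\<Sum>m\<le>d. s m x)"
    using Suc.IH[OF r(1)] by blast
  have sp: "m \<le> d \<Longrightarrow> polyf (s m)" for m using s(1) sph_harm_polyf by blast
  have ne: "D - of_nat (m * Suc m) \<noteq> 0" if "m \<le> d" for m
  proof -
    have "m * Suc m < Suc d * Suc (Suc d)" using that by (intro mult_strict_mono) auto
    then have "Suc d * Suc (Suc d) \<noteq> m * Suc m" by linarith
    then show ?thesis unfolding D_def right_minus_eq of_nat_eq_iff .
  qed
  define e where "e m = 1 / (D - of_nat (m * Suc m))" for m
  define p' where "p' x = (\<Sum>m\<le>d. e m * s m x)" for x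
  have hs: "sph_harm m (\<lambda>x. e m * s m x)" if "m \<le> d" for m using s(1)[OF that] by (rule sph_harm_cmult)
  have pf': "pf (Suc d) p'" unfolding p'_def[abs_def]
    by (intro pf_sum pf_mono[OF sph_harm_def[THEN iffD1, OF hs, THEN conjunct1]]) auto
  have lp': "lapS p' x = - D * p' x + r x" if x: "x \<in> S2" for x
  proof -
    have "lapS p' x = (\<Sum>m\<le>d. lapS (\<lambda>x. e m * s m x) x)"
      unfolding p'_def[abs_def] by (intro lapS_sum polyf_intros sp) auto
    also have "\<dots> = (\<Sum>m\<le>d. e m * lapS (s m) x)"
      by (intro sum.cong refl lapS_cmult sp) auto
    finally have "lapS p' x = (\<Sum>m\<le>d. e m * lapS (s m) x)" .
    also have "\<dots> = (\<Sum>m\<le>d. - D * (e m * s m x) + s m x)"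
    proof (intro sum.cong refl)
      fix m assume m: "m \<in> {..d}"
      have "lapS (s m) x = - of_nat (m * Suc m) * s m x" using s(1)[of m] m x by (simp add: sph_harm_def)
      moreover have "e m * (D - of_nat (m * Suc m)) = 1" using ne[of m] m by (simp add: e_def)
      ultimately show "e m * lapS (s m) x = - D * (e m * s m x) + s m x" by algebra
    qed
    also have "\<dots> = - D * p' x + r x" unfolding s(2)[OF x] p'_def sum.distrib sum_distrib_left[symmetric] ..
    finally show ?thesis .
  qed
  define q where "q m x = (if m \<le> d then e m * s m x else p x - p' x)" for m x
  have "sph_harm (Suc d) (\<lambda>x. p x - p' x)"
  proof -
    have "lapS (\<lambda>x. p x - p' x) x = - D * (p x - p' x)" if "x \<in> S2" for x
      using lapS_diff[of p p' x] pf_polyf[OF Suc.prems] pf_polyf[OF pf'] lp'[OF that]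
      by (simp add: r(2) algebra_simps)
    then show ?thesis using pf_diff[OF Suc.prems pf'] by (simp add: sph_harm_def D_def)
  qed
  then have "sph_harm m (q m)" if "m \<le> Suc d" for m
    using hs[of m] that by (cases "m \<le> d") (auto simp: q_def[abs_def] le_Suc_eq)
  moreover have "p x = (\<Sum>m\<le>Suc d. q m x)" for x
    by (simp add: q_def p'_def)
  ultimately show ?case by blast
qed

text \<open>The vector \<open>(1 - w\<^sup>2, i (1 + w\<^sup>2), 2 w)\<close> is isotropic, which makes the powers of the
  corresponding linear form harmonic.\<close>

definition isotropic_power :: "nat \<Rightarrow> complex \<Rightarrow> cfun" where
  "isotropic_power n w x = ((1 - w\<^sup>2) * cx 1 x + \<i> * (1 + w\<^sup>2) * cx 2 x + 2 * w * cx 3 x) ^ n"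

lemma isotropic_power_scaleR: "isotropic_power n w (r *\<^sub>R x) = of_real r ^ n * isotropic_power n w x"
  unfolding isotropic_power_def power_mult_distrib[symmetric] by (simp add: algebra_simps)

lemma pd_power:
  assumes "polyf p"
  shows "pd i (\<lambda>x. p x ^ Suc n) x = of_nat (Suc n) * p x ^ n * pd i p x"
proof (induction n)
  case (Suc n)
  have "pd i (\<lambda>x. p x ^ Suc (Suc n)) x = pd i (\<lambda>x. p x * p x ^ Suc n) x" by simp
  also have "\<dots> = p x * pd i (\<lambda>x. p x ^ Suc n) x + pd i p x * p x ^ Suc n"
    using assms by (intro pd_mult) auto
  finally show ?case using Suc.IH by (simp add: algebra_simps)
qed simp

lemma sph_harm_isotropic_power: "sph_harm n (isotropic_power n w)"
proof -
  define c :: "3 \<Rightarrow> complex" where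
    "c i = (if i = 1 then 1 - w\<^sup>2 else if i = 2 then \<i> * (1 + w\<^sup>2) else 2 * w)" for i
  define L where "L x = (\<Sum>i\<in>UNIV. c i * cx i x)" for x
  have c0: "(\<Sum>i\<in>UNIV. c i * c i) = 0"
    unfolding sum_3 c_def by (simp add: power2_eq_square algebra_simps)
  have I: "isotropic_power m w = (\<lambda>x. L x ^ m)" for m
    by (simp add: fun_eq_iff isotropic_power_def L_def sum_3 c_def)
  have L1: "pf 1 L" unfolding L_def[abs_def] by (rule pf_linear_form)
  note L = pf_polyf[OF L1] L1
  have dL: "pd i L x = c i" for i x
    unfolding L_def[abs_def] by (simp add: pd_sum pd_cmult pd_cx if_distrib cong: if_cong)
  have d1: "pd i (\<lambda>x. L x ^ m) = (\<lambda>x. of_nat m * c i * L x ^ (m - 1))" for i m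
    using pd_power[OF L(1)] by (cases m) (auto simp: fun_eq_iff dL)
  have d2: "pd i (\<lambda>x. of_nat m * c i * L x ^ (m - 1)) x
      = of_nat m * (of_nat (m - 1) * L x ^ (m - 1 - 1)) * (c i * c i)" for i m x
    using L by (subst pd_cmult) (auto simp: d1)
  have eu: "eu (\<lambda>x. L x ^ m) = (\<lambda>x. of_nat m * L x ^ m)" for m
  proof -
    have "eu (\<lambda>x. L x ^ m) x = of_nat m * L x ^ (m - 1) * L x" for x
    proof -
      have "eu (\<lambda>x. L x ^ m) x = (\<Sum>i\<in>UNIV. of_nat m * L x ^ (m - 1) * (c i * cx i x))"
        by (simp add: eu_def d1 mult_ac)
      then show ?thesis by (simp only: sum_distrib_left[symmetric] L_def[symmetric])
    qed
    then show ?thesis by (cases m) (auto simp: fun_eq_iff)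
  qed
  have "lap (\<lambda>x. L x ^ n) x = 0" for x
    unfolding lap_def d1 d2 sum_distrib_left[symmetric] c0 by simp
  then have "lapS (\<lambda>x. L x ^ n) x = - of_nat (n * Suc n) * L x ^ n" for x
    using L by (simp add: lapS_def eu eu_cmult algebra_simps)
  moreover have "pf n (\<lambda>x. L x ^ n)" using pf_power[OF L(2), of n] by simp
  ultimately show ?thesis by (simp add: sph_harm_def I)
qed

text \<open>By homogeneity a linear relation on the sphere holds on all of space, and being polynomial it
  extends to complex \<open>x\<^sub>2\<close>. At \<open>x\<^sub>2 = - i x\<^sub>1\<close> and \<open>x\<^sub>2 = i x\<^sub>1\<close> the powers become
  \<open>(2 x\<^sub>1 + 2 w x\<^sub>3)\<^sup>n\<close> and \<open>(2 w x\<^sub>3 - 2 w\<^sup>2 x\<^sub>1)\<^sup>n\<close>, which yields the vanishing of the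
  moments \<open>\<Sum> c w * w ^ k\<close> for \<open>k \<le> n\<close> and for \<open>n \<le> k \<le> 2 n\<close>.\<close>

lemma isotropic_power_independent:
  assumes W: "finite W" "card W \<le> 2 * n + 1"
    and 0: "\<And>x. x \<in> S2 \<Longrightarrow> (\<Sum>w\<in>W. c w * isotropic_power n w x) = 0"
    and w: "w \<in> W"
  shows "c w = 0"
proof -
  have poly0: "P = 0" if "\<And>y::real. poly P (of_real y) = 0" for P :: "complex poly"
  proof (rule ccontr)
    assume "P \<noteq> 0"
    then have "finite {z. poly P z = 0}" by (rule poly_roots_finite)
    moreover have "range complex_of_real \<subseteq> {z. poly P z = 0}" using that by auto
    moreover have "infinite (range complex_of_real)"
      by (simp add: finite_image_iff inj_on_def infinite_UNIV_char_0)
    ultimately show False using finite_subset by blast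
  qed
  have all: "(\<Sum>w\<in>W. c w * isotropic_power n w x) = 0" if "x \<noteq> 0" for x
  proof -
    have "(\<Sum>w\<in>W. c w * isotropic_power n w x) =
      (\<Sum>w\<in>W. c w * isotropic_power n w (norm x *\<^sub>R sgn x))"
      using that by (simp add: sgn_div_norm)
    also have "\<dots> = of_real (norm x) ^ n * (\<Sum>w\<in>W. c w * isotropic_power n w (sgn x))"
      unfolding isotropic_power_scaleR by (simp add: sum_distrib_left mult_ac)
    also have "\<dots> = 0" using that by (simp add: 0 norm_sgn)
    finally show ?thesis .
  qed
  \<comment> \<open>The points (1/2, y, z/2) are never 0, and along them the relation is a
    polynomial in \<open>y\<close> with every real number as a root; hence it also holds for complex
    \<open>y\<close>.\<close>
  have ext: "(\<Sum>w\<in>W. c w * ((1 - w\<^sup>2) / 2 + \<i> * (1 + w\<^sup>2) * y + w * of_real z) ^ n) = 0"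
    for y :: complex and z :: real
  proof -
    define P where "P = (\<Sum>w\<in>W. smult (c w) ([:(1 - w\<^sup>2) / 2 + w * of_real z, \<i> * (1 + w\<^sup>2):] ^ n))"
    have P: "poly P y = (\<Sum>w\<in>W. c w * ((1 - w\<^sup>2) / 2 + \<i> * (1 + w\<^sup>2) * y + w * of_real z) ^ n)" for y
      unfolding P_def poly_sum poly_smult poly_power by (simp add: add_ac mult_ac)
    have "poly P (of_real y) = 0" for y
    proof -
      have v: "isotropic_power n w (vector [1/2, y, z/2]) =
          ((1 - w\<^sup>2) / 2 + \<i> * (1 + w\<^sup>2) * of_real y + w * of_real z) ^ n" for w
        unfolding isotropic_power_def by simp
      have "(vector [1/2, y, z/2] :: R3) \<noteq> 0" by (auto simp: vec_eq_iff forall_3)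
      from all[OF this] show ?thesis unfolding P v .
    qed
    then have "P = 0" by (rule poly0)
    then show ?thesis using P[of y] by simp
  qed
  have m1: "(\<Sum>w\<in>W. c w * w ^ k) = 0" if k: "k \<le> n" for k
  proof -
    \<comment> \<open>Taking \<open>y = - \<i> / 2\<close> reduces the base to 1 + w z, so the
      coefficient of z^k is the k-th moment times a binomial coefficient.\<close>
    define P where "P = (\<Sum>w\<in>W. smult (c w) ([:1, w:] ^ n))"
    have "poly P (of_real z) = 0" for z
      using ext[of "- \<i> / 2" z] by (simp add: P_def poly_sum algebra_simps flip: add_divide_distrib)
    then have "P = 0" by (rule poly0)
    then have "coeff P k = 0" by simp
    then have "(\<Sum>w\<in>W. of_nat (n choose k) * (c w * w ^ k)) = 0"
      using k by (simp add: P_def coeff_sum coeff_linear_poly_power mult_ac)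
    then show ?thesis using k by (simp add: sum_distrib_left[symmetric])
  qed
  have m2: "(\<Sum>w\<in>W. c w * w ^ (n + k)) = 0" if k: "k \<le> n" for k
  proof -
    \<comment> \<open>Taking \<open>y = \<i> / 2\<close> reduces the base to w (z - w); the
      coefficient of z^(n - k) then carries w^(n + k).\<close>
    define P where "P = (\<Sum>w\<in>W. smult (c w * w ^ n) ([:- w, 1:] ^ n))"
    have "poly P (of_real z) = 0" for z
    proof -
      have "(1 - w\<^sup>2) / 2 + \<i> * (1 + w\<^sup>2) * (\<i> / 2) + w * of_real z = w * (- w + of_real z)" for w
        by (simp add: field_simps power2_eq_square)
      then show ?thesis
        using ext[of "\<i> / 2" z] by (simp add: P_def poly_sum power_mult_distrib mult_ac)
    qed
    then have "P = 0" by (rule poly0)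
    then have "coeff P (n - k) = 0" by simp
    then have "(\<Sum>w\<in>W. of_nat (n choose (n - k)) * (c w * w ^ n * (- w) ^ k)) = 0"
      using k by (simp add: P_def coeff_sum coeff_linear_poly_power mult_ac)
    then have "(of_nat (n choose (n - k)) * (- 1) ^ k) * (\<Sum>w\<in>W. c w * w ^ (n + k)) = 0"
      unfolding sum_distrib_left power_add by (subst (asm) power_minus) (simp only: mult_ac)
    then show ?thesis using k by auto
  qed
  have m: "(\<Sum>w\<in>W. c w * w ^ k) = 0" if "k \<le> 2 * n" for k
    using m1[of k] m2[of "k - n"] that by (cases "k \<le> n") auto
  \<comment> \<open>The nodal polynomial of the other points. Its degree is at most 2 n because
    \<open>W\<close> has at most 2 n + 1 elements, so the vanishing moments annihilate it, while it
    is nonzero at \<open>w\<close>.\<close>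
  define P where "P = (\<Prod>v\<in>W - {w}. [:- v, 1:])"
  have dP: "degree P \<le> 2 * n"
  proof -
    have "degree P \<le> (\<Sum>v\<in>W - {w}. degree [:- v, 1:])"
      unfolding P_def using degree_prod_sum_le[of "W - {w}" "\<lambda>v. [:- v, 1:]"] W by (simp add: o_def)
    then show ?thesis using W w by simp
  qed
  have "(\<Sum>v\<in>W. c v * poly P v) = (\<Sum>v\<in>W. \<Sum>k\<le>degree P. coeff P k * (c v * v ^ k))"
    by (simp add: poly_altdef sum_distrib_left mult_ac)
  also have "\<dots> = (\<Sum>k\<le>degree P. coeff P k * (\<Sum>v\<in>W. c v * v ^ k))"
    by (subst sum.swap) (simp add: sum_distrib_left)
  also have "\<dots> = 0" using dP by (intro sum.neutral) (auto simp: m)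
  finally have "(\<Sum>v\<in>W. c v * poly P v) = 0" .
  moreover have "poly P v = 0" if "v \<in> W - {w}" for v
    using that W by (auto simp: P_def poly_prod)
  ultimately have "c w * poly P w = 0"
    using sum.remove[OF W(1) w, of "\<lambda>v. c v * poly P v"] by simp
  moreover have "poly P w \<noteq> 0" using W by (auto simp: P_def poly_prod)
  ultimately show ?thesis by simp
qed

text \<open>Makes span, independence and dimension counting available for complex functions with
  pointwise operations.\<close>

interpretation fs: vector_space "\<lambda>(c::complex) (f::R3 \<Rightarrow> complex) x. c * f x"
  by unfold_locales (auto simp: fun_eq_iff algebra_simps)

lemma sum_fun_apply: "(\<Sum>i\<in>I. f i :: 'a \<Rightarrow> 'b :: comm_monoid_add) x = (\<Sum>i\<in>I. f i x)"
  by (induction I rule: infinite_finite_induct) auto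

text \<open>The hypothesis on the dimension enters here: \<open>2 n + 1\<close> independent elements of the
  eigenspace already span it.\<close>

lemma eigenspace_polynomial:
  assumes B: "orthonormal_basis_eigenspace n B" and f: "f \<in> eigenspace n"
  shows "\<exists>p. sph_harm n p \<and> (\<forall>r x. p (r *\<^sub>R x) = of_real r ^ n * p x) \<and> f = rs p"
proof -
  define W where "W = (of_nat :: nat \<Rightarrow> complex) ` {..2 * n}"
  have cW: "card W = 2 * n + 1" and fW: "finite W"
    by (simp_all add: W_def card_image inj_on_def)
  define h where "h w = rs (isotropic_power n w)" for w
  have h0: "c w = 0" if "(\<lambda>x. \<Sum>w\<in>W. c w * h w x) = (\<lambda>_. 0)" "w \<in> W" for c w
  proof (rule isotropic_power_independent[OF fW _ _ that(2)])
    fix x :: R3 assume "x \<in> S2"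
    then show "(\<Sum>w\<in>W. c w * isotropic_power n w x) = 0"
      using fun_cong[OF that(1), of x] by (simp add: h_def rs_def)
  qed (simp add: cW)
  have inj: "inj_on h W"
  proof (rule inj_onI, rule ccontr)
    fix v w assume vw: "v \<in> W" "w \<in> W" "h v = h w" "v \<noteq> w"
    define c where "c u = (if u = v then 1 else if u = w then - 1 else 0 :: complex)" for u
    have "(\<Sum>u\<in>W. c u * h u x) = (\<Sum>u\<in>{v, w}. c u * h u x)" for x
      using vw fW by (intro sum.mono_neutral_right) (auto simp: c_def)
    then have "(\<lambda>x. \<Sum>u\<in>W. c u * h u x) = (\<lambda>_. 0)" using vw by (simp add: c_def)
    from h0[OF this vw(1)] show False by (simp add: c_def)
  qed
  have ind: "fs.independent (h ` W)"
  proof (rule fs.independent_if_scalars_zero)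
    fix c v assume *: "(\<Sum>u\<in>h ` W. (\<lambda>x. c u * u x)) = 0" and v: "v \<in> h ` W"
    obtain w where w: "v = h w" "w \<in> W" using v by blast
    have "(\<lambda>x. \<Sum>u\<in>W. c (h u) * h u x) = (\<lambda>_. 0)"
      using * by (simp add: sum.reindex[OF inj] fun_eq_iff sum_fun_apply)
    from h0[OF this w(2)] show "c v = 0" by (simp add: w)
  qed (use fW in simp)
  define S where "S = B ` {-int n..int n}"
  have sp: "e \<in> fs.span S" if "e \<in> eigenspace n" for e
  proof -
    obtain c where c: "e = (\<lambda>x. \<Sum>k=-int n..int n. c k * B k x)"
      using B \<open>e \<in> eigenspace n\<close> unfolding orthonormal_basis_eigenspace_def by blast
    have "e = (\<Sum>k=-int n..int n. (\<lambda>x. c k * B k x))" by (simp add: c fun_eq_iff sum_fun_apply)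
    also have "\<dots> \<in> fs.span S"
      by (intro fs.span_sum fs.span_scale fs.span_base) (auto simp: S_def)
    finally show ?thesis .
  qed
  have hE: "h w \<in> eigenspace n" for w unfolding h_def by (intro sph_harm_eigenspace sph_harm_isotropic_power)
  \<comment> \<open>Otherwise adjoining \<open>f\<close> would produce 2 n + 2 independent vectors
    in the span of the 2 n + 1 functions \<open>B k\<close>.\<close>
  have "f \<in> fs.span (h ` W)"
  proof (rule ccontr)
    assume nf: "f \<notin> fs.span (h ` W)"
    then have "fs.independent (insert f (h ` W))" using ind by (rule fs.independent_insertI)
    moreover have "insert f (h ` W) \<subseteq> fs.span S" using sp f hE by auto
    ultimately have "card (insert f (h ` W)) \<le> card S"
      using fs.independent_span_bound[of S] by (simp add: S_def)
    moreover have "card S \<le> 2 * n + 1"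
      unfolding S_def by (rule order_trans[OF card_image_le]) auto
    moreover have "f \<notin> h ` W" using nf fs.span_base[of f "h ` W"] by metis
    ultimately show False using fW by (simp add: card_image[OF inj] cW)
  qed
  then obtain u where u: "f = (\<Sum>v\<in>h ` W. (\<lambda>x. u v * v x))"
    using fs.span_finite[of "h ` W"] fW by auto
  define p where "p x = (\<Sum>w\<in>W. u (h w) * isotropic_power n w x)" for x
  have "sph_harm n p" unfolding p_def[abs_def] by (intro sph_harm_sum sph_harm_cmult sph_harm_isotropic_power)
  moreover have "p (r *\<^sub>R x) = of_real r ^ n * p x" for r x
    by (simp add: p_def isotropic_power_scaleR sum_distrib_left mult_ac)
  moreover have "f = rs p"
    unfolding u sum.reindex[OF inj] by (auto simp: fun_eq_iff sum_fun_apply p_def h_def rs_def)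
  ultimately show ?thesis by blast
qed

section \<open>Trace estimate on the eigenspaces\<close>

lemma l2_inner_cong:
  assumes "\<And>x. x \<in> S2 \<Longrightarrow> F x = F' x" "\<And>x. x \<in> S2 \<Longrightarrow> G x = G' x"
  shows "l2_inner F G = l2_inner F' G'"
  unfolding l2_inner_def using assms by (intro sphint_cong) simp

lemma l2_inner_cmult_left: "l2_inner (\<lambda>x. c * F x) G = c * l2_inner F G"
  by (simp add: l2_inner_def mult.assoc)

lemma l2_inner_sum_left:
  assumes "\<And>i. i \<in> I \<Longrightarrow> polyf (F i)" "polyf G"
  shows "l2_inner (\<lambda>x. \<Sum>i\<in>I. F i x) G = (\<Sum>i\<in>I. l2_inner (F i) G)"
  unfolding l2_inner_def sum_distrib_right
  using assms by (intro Bochner_Integration.integral_sum integrable_sphere_polyf polyf_intros)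

lemma l2_inner_diff_left:
  assumes "polyf F" "polyf H" "polyf G"
  shows "l2_inner (\<lambda>x. F x - H x) G = l2_inner F G - l2_inner H G"
  unfolding l2_inner_def left_diff_distrib
  using assms by (intro Bochner_Integration.integral_diff integrable_sphere_polyf polyf_intros)

lemma l2_inner_commute: "l2_inner G F = cnj (l2_inner F G)"
proof -
  have "sphint (\<lambda>x. G x * cnj (F x)) = sphint (\<lambda>x. cnj (F x * cnj (G x)))" by (simp add: mult.commute)
  then show ?thesis unfolding l2_inner_def by (simp only: Bochner_Integration.integral_cnj)
qed

lemma l2_inner_sum_right:
  assumes "\<And>i. i \<in> I \<Longrightarrow> polyf (F i)" "polyf G"
  shows "l2_inner G (\<lambda>x. \<Sum>i\<in>I. c i * F i x) = (\<Sum>i\<in>I. cnj (c i) * l2_inner G (F i))"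
proof -
  have "l2_inner (\<lambda>x. \<Sum>i\<in>I. c i * F i x) G = (\<Sum>i\<in>I. c i * l2_inner (F i) G)"
    using assms by (subst l2_inner_sum_left) (auto simp: l2_inner_cmult_left)
  then show ?thesis
    by (subst l2_inner_commute) (simp add: l2_inner_commute[of _ G])
qed

lemma l2_inner_rot:
  assumes "polyf F" "polyf G"
  shows "l2_inner (rot p F) G = - l2_inner F (rot p G)"
  using sphint_rot_by_parts[of F "\<lambda>x. cnj (G x)" p] assms
  by (simp add: l2_inner_def rot_cnj)

lemma l2_inner_orthogonal_transformation:
  assumes S: "orthogonal_transformation S" and "polyf F" "polyf G"
  shows "l2_inner (\<lambda>x. F (inv S x)) G = l2_inner F (\<lambda>x. G (S x))"
proof -
  have i: "inv S (S x) = x" for x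
    using S by (simp add: inv_f_f orthogonal_transformation_inj)
  have "linear (inv S)" using orthogonal_transformation_inv[OF S] orthogonal_transformation_linear by blast
  then have "polyf (\<lambda>x. F (inv S x))" using assms(2) pf_compose_linear by (auto simp: polyf_def)
  then show ?thesis
    using sphint_orthogonal[OF S, of "\<lambda>x. F (inv S x) * cnj (G x)"] assms(3) by (simp add: l2_inner_def i)
qed

lemma l2_inner_self: "polyf F \<Longrightarrow> l2_inner F F = of_real (mean_square F)"
  unfolding l2_inner_def by (simp add: complex_norm_square[symmetric] flip: integral_complex_of_real)

text \<open>\<open>lapS\<close> is computed from derivatives in space, yet on the sphere it depends
  only on the restriction, since it equals the Laplace-Beltrami operator of that
  restriction.\<close>

lemma lapS_cong:
  assumes "polyf F" "polyf G" "\<And>x. x \<in> S2 \<Longrightarrow> F x = G x" "x \<in> S2"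
  shows "lapS F x = lapS G x"
proof -
  have "rs F = rs G" using assms(3) by (auto simp: rs_def)
  then show ?thesis using laplace_beltrami_rs[OF assms(1,4)] laplace_beltrami_rs[OF assms(2,4)] by simp
qed

lemma sph_harm_cong:
  assumes "sph_harm n F" "pf n G" "\<And>x. x \<in> S2 \<Longrightarrow> F x = G x"
  shows "sph_harm n G"
  using lapS_cong[OF sph_harm_polyf[OF assms(1)] pf_polyf[OF assms(2)] assms(3)] assms
  unfolding sph_harm_def by metis

lemma sph_harm_orthogonal:
  assumes "sph_harm n F" "sph_harm m G" "n \<noteq> m"
  shows "l2_inner F G = 0"
proof -
  note p = sph_harm_polyf[OF assms(1)] sph_harm_polyf[OF assms(2)]
  have "- of_nat (n * Suc n) * l2_inner F G = l2_inner (lapS F) G"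
    unfolding l2_inner_cmult_left[symmetric] by (rule l2_inner_cong) (use assms(1) in \<open>auto simp: sph_harm_def\<close>)
  also have "\<dots> = l2_inner F (lapS G)"
    using sphint_lapS_symmetric[of F "\<lambda>x. cnj (G x)"] p by (simp add: l2_inner_def lapS_cnj)
  also have "\<dots> = l2_inner F (\<lambda>x. - of_nat (m * Suc m) * G x)"
    by (rule l2_inner_cong) (use assms(2) in \<open>auto simp: sph_harm_def\<close>)
  also have "\<dots> = - of_nat (m * Suc m) * l2_inner F G"
    by (subst (1 2) l2_inner_commute) (simp add: l2_inner_cmult_left)
  finally have "(of_nat (n * Suc n) - of_nat (m * Suc m)) * l2_inner F G = 0" by algebra
  then have "(of_nat (n * Suc n) :: complex) = of_nat (m * Suc m) \<or> l2_inner F G = 0"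
    unfolding mult_eq_0_iff right_minus_eq .
  moreover have "n * Suc n \<noteq> m * Suc m"
    using \<open>n \<noteq> m\<close> mult_strict_mono[of n m "Suc n" "Suc m"] mult_strict_mono[of m n "Suc m" "Suc n"]
    by (cases n m rule: linorder_cases) auto
  ultimately show ?thesis unfolding of_nat_eq_iff by blast
qed

lemma sum_rot_norm:
  assumes "sph_harm n F"
  shows "(\<Sum>a\<in>UNIV. mean_square (rot (axis a 1) F))
    = real (n * Suc n) * mean_square F"
proof -
  note F = sph_harm_polyf[OF assms]
  have "of_real (\<Sum>a\<in>UNIV. mean_square (rot (axis a 1) F))
     = (\<Sum>a\<in>UNIV. l2_inner (rot (axis a 1) F) (rot (axis a 1) F))"
    using F by (simp add: l2_inner_self)
  also have "\<dots> = - sphint (\<lambda>x. lapS F x * cnj (F x))"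
    using sphint_lapS[of F "\<lambda>x. cnj (F x)"] F by (simp add: l2_inner_def rot_cnj)
  also have "sphint (\<lambda>x. lapS F x * cnj (F x)) = sphint (\<lambda>x. - of_nat (n * Suc n) * F x * cnj (F x))"
    by (rule sphint_cong) (use assms in \<open>auto simp: sph_harm_def\<close>)
  also have "\<dots> = - of_nat (n * Suc n) * l2_inner F F"
    unfolding l2_inner_def by (simp only: mult.assoc integral_mult_right_zero)
  also have "- \<dots> = of_real (real (n * Suc n) * mean_square F)"
    unfolding l2_inner_self[OF F] by (simp add: algebra_simps)
  finally show ?thesis unfolding of_real_eq_iff .
qed

lemma integrable_cmod_square [simp, intro]:
  "polyf F \<Longrightarrow> integrable sphere_measure (\<lambda>x. (cmod (F x))\<^sup>2)"
  by (intro integrable_sphere_continuous continuous_intros polyf_continuous_on)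

text \<open>Pointwise Cauchy-Schwarz over the three axes reduces an arbitrary vector
  \<open>p\<close> to \<open>sum_rot_norm\<close>.\<close>

lemma rot_norm_le:
  assumes "sph_harm n F"
  shows "mean_square (rot p F)
    \<le> (norm p)\<^sup>2 * real (n * Suc n) * mean_square F"
proof -
  note F = sph_harm_polyf[OF assms]
  have "(cmod (rot p F x))\<^sup>2 \<le> (norm p)\<^sup>2 * (\<Sum>a\<in>UNIV. (cmod (rot (axis a 1) F x))\<^sup>2)" for x
  proof -
    have "cmod (rot p F x) \<le> (\<Sum>a\<in>UNIV. \<bar>p $ a\<bar> * cmod (rot (axis a 1) F x))"
      unfolding rot_axis_sum[of p] by (rule order_trans[OF norm_sum]) (simp add: norm_mult)
    then have "(cmod (rot p F x))\<^sup>2 \<le> (\<Sum>a\<in>UNIV. \<bar>p $ a\<bar> * cmod (rot (axis a 1) F x))\<^sup>2"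
      by (rule power_mono) simp
    also have "\<dots> \<le> (\<Sum>a\<in>UNIV. \<bar>p $ a\<bar>\<^sup>2) * (\<Sum>a\<in>UNIV. (cmod (rot (axis a 1) F x))\<^sup>2)"
      by (rule Cauchy_Schwarz_ineq_sum)
    also have "(\<Sum>a\<in>UNIV. \<bar>p $ a\<bar>\<^sup>2) = (norm p)\<^sup>2"
      by (simp add: norm_vec_def L2_set_def sum_nonneg)
    finally show ?thesis .
  qed
  then have "mean_square (rot p F)
    \<le> (\<integral>x. (norm p)\<^sup>2 * (\<Sum>a\<in>UNIV. (cmod (rot (axis a 1) F x))\<^sup>2) \<partial>sphere_measure)"
    using F by (intro integral_mono) auto
  also have "\<dots> = (norm p)\<^sup>2 * (\<Sum>a\<in>UNIV. mean_square (rot (axis a 1) F))"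
    using F by (simp add: Bochner_Integration.integral_sum)
  finally show ?thesis unfolding sum_rot_norm[OF assms] by simp
qed

section \<open>Transitivity of orthogonal maps on orthogonal pairs\<close>

definition reflect :: "R3 \<Rightarrow> R3 \<Rightarrow> R3" where
  "reflect a x = x - (2 * (a \<bullet> x) / (a \<bullet> a)) *\<^sub>R a"

lemma reflect_orthogonal: "orthogonal_transformation (reflect a)"
proof -
  have "linear (reflect a)"
    by (rule linearI) (simp_all add: reflect_def inner_simps algebra_simps add_divide_distrib)
  moreover have "reflect a x \<bullet> reflect a x = x \<bullet> x" for x
  proof (cases "a = 0")
    case False
    then show ?thesis
      by (simp add: reflect_def inner_simps inner_commute[of x a] field_simps)
  qed (simp add: reflect_def)
  then have "norm (reflect a x) = norm x" for x by (simp add: norm_eq_sqrt_inner)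
  ultimately show ?thesis by (simp add: orthogonal_transformation)
qed

lemma reflect_diff:
  assumes "norm u = norm w"
  shows "reflect (u - w) u = w"
proof (cases "u = w")
  case False
  have "u \<bullet> u = w \<bullet> w" using assms by (simp add: norm_eq)
  then have "(u - w) \<bullet> (u - w) = 2 * ((u - w) \<bullet> u)"
    by (simp add: inner_simps inner_commute[of u w])
  moreover have "(u - w) \<bullet> (u - w) \<noteq> 0" using False by simp
  ultimately have "2 * ((u - w) \<bullet> u) / ((u - w) \<bullet> (u - w)) = 1" by simp
  then show ?thesis unfolding reflect_def by (simp only:) simp
qed (simp add: reflect_def)

text \<open>The first reflection sends \<open>x\<close> to \<open>x'\<close>. The second sends the
  image of \<open>v\<close> to \<open>v'\<close> and fixes \<open>x'\<close>, because both of these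
  vectors are orthogonal to \<open>x'\<close>. Vectors that already agree need no case,
  \<open>reflect 0\<close> being the identity.\<close>

lemma orthogonal_transformation_pair:
  fixes x v x' v' :: R3
  assumes "norm x = norm x'" "norm v = norm v'" "x \<bullet> v = 0" "x' \<bullet> v' = 0"
  shows "\<exists>S. orthogonal_transformation S \<and> S x = x' \<and> S v = v'"
proof -
  let ?R = "reflect (x - x')"
  let ?Q = "reflect (?R v - v')"
  have R: "orthogonal_transformation ?R" "?R x = x'" using assms by (auto intro: reflect_orthogonal reflect_diff)
  have "x' \<bullet> ?R v = x \<bullet> v" using R by (metis orthogonal_transformation_def)
  then have "?Q x' = x'" using assms by (simp add: reflect_def[of "?R v - v'"] inner_simps inner_commute)
  moreover have "?Q (?R v) = v'"
    using assms R(1) by (intro reflect_diff) (simp add: orthogonal_transformation_norm)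
  ultimately show ?thesis
    using R reflect_orthogonal by (intro exI[of _ "?Q \<circ> ?R"]) (auto intro: orthogonal_transformation_compose)
qed

section \<open>Polynomial representatives of the basis and expansions\<close>

locale sphere_basis =
  fixes b :: "nat \<Rightarrow> int \<Rightarrow> cfun"
  assumes onb: "orthonormal_basis_eigenspace n (b n)"
begin

abbreviation K :: "nat \<Rightarrow> int set" where
  "K n \<equiv> {-int n..int n}"

text \<open>\<open>b n k\<close> vanishes off the sphere, so derivatives in space require a
  polynomial representative. Homogeneity fixes its values along rays, which lets identities on the
  sphere extend to \<open>R3\<close> and be differentiated there.\<close>

definition B :: "nat \<Rightarrow> int \<Rightarrow> cfun" where
  "B n k = (SOME p. sph_harm n p \<and> (\<forall>r x. p (r *\<^sub>R x) = of_real r ^ n * p x) \<and> b n k = rs p)"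

lemma
  assumes "k \<in> K n"
  shows sph_harm_B: "sph_harm n (B n k)"
    and B_scaleR: "B n k (r *\<^sub>R x) = of_real r ^ n * B n k x"
    and b_eq: "b n k = rs (B n k)"
proof -
  have "b n k \<in> eigenspace n"
    using onb[of n] assms unfolding orthonormal_basis_eigenspace_def by blast
  then have "sph_harm n (B n k) \<and> (\<forall>r x. B n k (r *\<^sub>R x) = of_real r ^ n * B n k x) \<and> b n k = rs (B n k)"
    unfolding B_def by (rule someI_ex[OF eigenspace_polynomial[OF onb]])
  then show "sph_harm n (B n k)" "B n k (r *\<^sub>R x) = of_real r ^ n * B n k x" "b n k = rs (B n k)"
    by auto
qed

lemma polyf_B [simp, intro]: "k \<in> K n \<Longrightarrow> polyf (B n k)"
  using sph_harm_B sph_harm_polyf by blast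

lemma pf_B: "k \<in> K n \<Longrightarrow> pf n (B n k)"
  using sph_harm_B unfolding sph_harm_def by blast

lemma B_orthonormal:
  assumes "k \<in> K n" "j \<in> K m"
  shows "l2_inner (B n k) (B m j) = (if n = m \<and> k = j then 1 else 0)"
proof (cases "n = m")
  case True
  have "l2_inner (B n k) (B n j) = l2_inner (b n k) (b n j)"
    using assms True by (intro l2_inner_cong) (auto simp: b_eq rs_def)
  then show ?thesis
    using onb[of n] assms True unfolding orthonormal_basis_eigenspace_def by simp
next
  case False
  then show ?thesis using assms by (simp add: sph_harm_orthogonal[OF sph_harm_B sph_harm_B])
qed

lemma sph_harm_expansion:
  assumes p: "sph_harm n p" and x: "x \<in> S2"
  shows "p x = (\<Sum>k\<in>K n. l2_inner p (B n k) * B n k x)"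
proof -
  obtain c where c: "rs p = (\<lambda>x. \<Sum>k\<in>K n. c k * b n k x)"
    using onb[of n] sph_harm_eigenspace[OF p] unfolding orthonormal_basis_eigenspace_def by blast
  have cB: "p x = (\<Sum>k\<in>K n. c k * B n k x)" if "x \<in> S2" for x
    using fun_cong[OF c, of x] that by (simp add: b_eq rs_def)
  have "l2_inner p (B n k) = c k" if k: "k \<in> K n" for k
  proof -
    have "l2_inner p (B n k) = l2_inner (\<lambda>x. \<Sum>k\<in>K n. c k * B n k x) (B n k)"
      using cB by (intro l2_inner_cong) auto
    also have "\<dots> = (\<Sum>j\<in>K n. c j * l2_inner (B n j) (B n k))"
      using k by (subst l2_inner_sum_left) (auto simp: l2_inner_cmult_left)
    also have "\<dots> = (\<Sum>j\<in>K n. c j * (if j = k then 1 else 0))"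
      using k by (intro sum.cong refl) (simp add: B_orthonormal)
    also have "\<dots> = c k" using k by (simp add: if_distrib cong: if_cong)
    finally show ?thesis .
  qed
  then show ?thesis using cB[OF x] by simp
qed

lemma l2_inner_decomposition:
  assumes q: "\<And>m. m \<le> d \<Longrightarrow> sph_harm m (q m)" "\<And>x. x \<in> S2 \<Longrightarrow> p x = (\<Sum>m\<le>d. q m x)"
    and k: "k \<in> K n"
  shows "l2_inner p (B n k) = (if n \<le> d then l2_inner (q n) (B n k) else 0)"
proof -
  have "l2_inner p (B n k) = l2_inner (\<lambda>x. \<Sum>m\<le>d. q m x) (B n k)"
    using q(2) by (intro l2_inner_cong) auto
  also have "\<dots> = (\<Sum>m\<le>d. l2_inner (q m) (B n k))"
    using k q(1) sph_harm_polyf by (intro l2_inner_sum_left) auto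
  also have "\<dots> = (\<Sum>m\<le>d. if m = n then l2_inner (q n) (B n k) else 0)"
  proof (intro sum.cong refl)
    fix m assume "m \<in> {..d}"
    then show "l2_inner (q m) (B n k) = (if m = n then l2_inner (q n) (B n k) else 0)"
      using sph_harm_orthogonal[OF q(1)[of m] sph_harm_B[OF k]] by auto
  qed
  also have "\<dots> = (if n \<le> d then l2_inner (q n) (B n k) else 0)" by simp
  finally show ?thesis .
qed

lemma pf_expansion:
  assumes p: "pf d p" and x: "x \<in> S2"
  shows "p x = (\<Sum>m\<le>d. \<Sum>k\<in>K m. l2_inner p (B m k) * B m k x)"
proof -
  obtain q where q: "\<And>m. m \<le> d \<Longrightarrow> sph_harm m (q m)" "\<And>x. x \<in> S2 \<Longrightarrow> p x = (\<Sum>m\<le>d. q m x)"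
    using harmonic_decomposition[OF p] by blast
  have "p x = (\<Sum>m\<le>d. \<Sum>k\<in>K m. l2_inner (q m) (B m k) * B m k x)"
    unfolding q(2)[OF x] using q(1) sph_harm_expansion[OF _ x] by (intro sum.cong refl) auto
  also have "\<dots> = (\<Sum>m\<le>d. \<Sum>k\<in>K m. l2_inner p (B m k) * B m k x)"
  proof (intro sum.cong refl arg_cong2[where f = "(*)"])
    fix m k assume "m \<in> {..d}" "k \<in> K m"
    then show "l2_inner (q m) (B m k) = l2_inner p (B m k)"
      using l2_inner_decomposition[of d q p, OF q, of k m] by simp
  qed
  finally show ?thesis .
qed

text \<open>The harmonic components of \<open>p\<close> have degree at most \<open>d\<close>, and
  different degrees are orthogonal.\<close>

lemma l2_inner_low_degree:
  assumes p: "pf d p" and "d < n" and k: "k \<in> K n"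
  shows "l2_inner p (B n k) = 0"
proof -
  obtain q where q: "\<And>m. m \<le> d \<Longrightarrow> sph_harm m (q m)" "\<And>x. x \<in> S2 \<Longrightarrow> p x = (\<Sum>m\<le>d. q m x)"
    using harmonic_decomposition[OF p] by blast
  then show ?thesis using l2_inner_decomposition[of d q p, OF q k] \<open>d < n\<close> by simp
qed

text \<open>This is how an operator that preserves polynomial degree is seen to preserve an
  eigenspace: the degree bound excludes higher components, and orthogonality to lower ones is
  checked on the adjoint, which preserves degree too.\<close>

lemma top_degree_expansion:
  assumes p: "pf n p" and 0: "\<And>m k. m < n \<Longrightarrow> k \<in> K m \<Longrightarrow> l2_inner p (B m k) = 0" and x: "x \<in> S2"
  shows "p x = (\<Sum>k\<in>K n. l2_inner p (B n k) * B n k x)"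
proof -
  have "p x = (\<Sum>m\<le>n. if m = n then \<Sum>k\<in>K n. l2_inner p (B n k) * B n k x else 0)"
    unfolding pf_expansion[OF p x] using 0 by (intro sum.cong refl) auto
  then show ?thesis by simp
qed

lemma l2_inner_expansion:
  assumes "\<And>x. x \<in> S2 \<Longrightarrow> p x = (\<Sum>k\<in>K n. c k * B n k x)" "\<And>x. x \<in> S2 \<Longrightarrow> q x = (\<Sum>k\<in>K n. e k * B n k x)"
  shows "l2_inner p q = (\<Sum>k\<in>K n. c k * cnj (e k))"
proof -
  have "l2_inner p q = l2_inner (\<lambda>x. \<Sum>k\<in>K n. c k * B n k x) (\<lambda>x. \<Sum>k\<in>K n. e k * B n k x)"
    using assms by (rule l2_inner_cong)
  also have "\<dots> = (\<Sum>k\<in>K n. cnj (e k) * l2_inner (\<lambda>x. \<Sum>k\<in>K n. c k * B n k x) (B n k))"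
    by (rule l2_inner_sum_right) auto
  also have "\<dots> = (\<Sum>k\<in>K n. cnj (e k) * (\<Sum>j\<in>K n. c j * l2_inner (B n j) (B n k)))"
    by (intro sum.cong refl, subst l2_inner_sum_left) (auto simp: l2_inner_cmult_left)
  also have "\<dots> = (\<Sum>k\<in>K n. cnj (e k) * (\<Sum>j\<in>K n. c j * (if j = k then 1 else 0)))"
    by (intro sum.cong refl) (simp add: B_orthonormal)
  also have "\<dots> = (\<Sum>k\<in>K n. c k * cnj (e k))"
    by (intro sum.cong refl) (simp add: if_distrib mult.commute cong: if_cong)
  finally show ?thesis .
qed

subsection \<open>Rotation invariance of the gradient density\<close>

lemma polyf_compose_orthogonal:
  "polyf F \<Longrightarrow> orthogonal_transformation S \<Longrightarrow> polyf (\<lambda>x. F (S x))"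
  unfolding polyf_def using pf_compose_linear orthogonal_transformation_linear by blast

lemma B_compose_orthogonal:
  assumes S: "orthogonal_transformation S" and k: "k \<in> K n" and x: "x \<in> S2"
  shows "B n k (S x) = (\<Sum>l\<in>K n. l2_inner (\<lambda>x. B n k (S x)) (B n l) * B n l x)"
proof (rule top_degree_expansion[OF _ _ x])
  show "pf n (\<lambda>x. B n k (S x))"
    using pf_compose_linear[OF pf_B[OF k]] S orthogonal_transformation_linear by blast
  fix m j assume m: "m < n" and j: "j \<in> K m"
  have i: "orthogonal_transformation (inv S)" using S by (rule orthogonal_transformation_inv)
  have "l2_inner (\<lambda>x. B m j (inv S x)) (B n k) = 0"
    using pf_compose_linear[OF pf_B[OF j]] i orthogonal_transformation_linear
    by (intro l2_inner_low_degree[OF _ m k]) blast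
  then have "l2_inner (B m j) (\<lambda>x. B n k (S x)) = 0"
    using l2_inner_orthogonal_transformation[OF S, of "B m j" "B n k"] j k by simp
  then show "l2_inner (\<lambda>x. B n k (S x)) (B m j) = 0"
    by (subst l2_inner_commute) simp
qed

text \<open>The function \<open>B n l\<close> composed with \<open>inv S\<close> has the
  coefficients \<open>cnj (U k l)\<close>, and composition with an orthogonal map preserves inner
  products.\<close>

lemma unitary_B_compose:
  assumes S: "orthogonal_transformation S" and l: "l \<in> K n" and m: "m \<in> K n"
  defines "U \<equiv> \<lambda>k l. l2_inner (\<lambda>x. B n k (S x)) (B n l)"
  shows "(\<Sum>k\<in>K n. cnj (U k l) * U k m) = (if l = m then 1 else 0)"
proof -
  have i: "orthogonal_transformation (inv S)" using S by (rule orthogonal_transformation_inv)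
  have V: "B n l (inv S x) = (\<Sum>k\<in>K n. cnj (U k l) * B n k x)" if "l \<in> K n" "x \<in> S2" for l x
  proof -
    have "l2_inner (\<lambda>x. B n l (inv S x)) (B n k) = cnj (U k l)" if "k \<in> K n" for k
      using l2_inner_orthogonal_transformation[OF S, of "B n l" "B n k"] \<open>l \<in> K n\<close> that
      by (simp add: U_def l2_inner_commute[of "B n l"])
    then show ?thesis using B_compose_orthogonal[OF i that] by simp
  qed
  have "(\<Sum>k\<in>K n. cnj (U k l) * cnj (cnj (U k m))) =
      l2_inner (\<lambda>x. B n l (inv S x)) (\<lambda>x. B n m (inv S x))"
    using V l m by (intro l2_inner_expansion[symmetric])
  also have "\<dots> = l2_inner (B n l) (\<lambda>x. B n m (inv S (S x)))"
    by (rule l2_inner_orthogonal_transformation[OF S polyf_B[OF l] polyf_compose_orthogonal[OF polyf_B[OF m] i]])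
  also have "\<dots> = (if l = m then 1 else 0)"
    using l m S by (simp add: inv_f_f orthogonal_transformation_inj B_orthonormal)
  finally show ?thesis by simp
qed

text \<open>A sum over an orthonormal basis of a whole eigenspace is insensitive to unitary changes
  of that basis, and rotations induce such changes.\<close>

definition grad :: "nat \<Rightarrow> R3 \<Rightarrow> R3 \<Rightarrow> real" where
  "grad n x v = (\<Sum>k\<in>K n. (cmod (partial v (B n k) x))\<^sup>2)"

lemma grad_orthogonal:
  assumes S: "orthogonal_transformation S" and n: "n > 0"
  shows "grad n (S x) (S v) = grad n x v"
proof -
  define U where "U k l = l2_inner (\<lambda>x. B n k (S x)) (B n l)" for k l
  define a where "a l = partial v (B n l) x" for l
  have linS: "linear S" using S by (rule orthogonal_transformation_linear)
  \<comment> \<open>\<open>B_compose_orthogonal\<close> is an identity on the sphere. Homogeneity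
    extends it to all \<open>y\<close>, with \<open>n > 0\<close> covering the origin, and only then
    can it be differentiated in every direction.\<close>
  have ext: "B n k (S y) = (\<Sum>l\<in>K n. U k l * B n l y)" if k: "k \<in> K n" for k y
  proof (cases "y = 0")
    case True
    have "B n l 0 = 0" if "l \<in> K n" for l
      using B_scaleR[OF that, of 0 0] n by (simp add: power_0_left)
    then show ?thesis using True k by (simp add: linear_0[OF linS])
  next
    case False
    have "B n k (S y) = B n k (norm y *\<^sub>R S (sgn y))"
      using False by (simp add: linear_scale[OF linS, symmetric] sgn_div_norm)
    also have "\<dots> = of_real (norm y) ^ n * (\<Sum>l\<in>K n. U k l * B n l (sgn y))"
      unfolding B_scaleR[OF k] U_def using False k by (subst B_compose_orthogonal[OF S]) (auto simp: norm_sgn)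
    also have "\<dots> = (\<Sum>l\<in>K n. U k l * B n l (norm y *\<^sub>R sgn y))"
      unfolding sum_distrib_left by (intro sum.cong refl) (simp add: B_scaleR mult_ac)
    also have "norm y *\<^sub>R sgn y = y" using False by (simp add: sgn_div_norm)
    finally show ?thesis .
  qed
  have p: "partial (S v) (B n k) (S x) = (\<Sum>l\<in>K n. U k l * a l)" if k: "k \<in> K n" for k
  proof -
    have "(S has_derivative S) (at x)"
      using linS by (simp add: linear_conv_bounded_linear bounded_linear_imp_has_derivative)
    from has_derivative_compose[OF this polyf_has_derivative[OF polyf_B[OF k]]]
    have "partial v (\<lambda>x. B n k (S x)) x = partial (S v) (B n k) (S x)"
      unfolding polyf_partial[OF polyf_B[OF k], of "S v" "S x"] by (rule partial_of_has_derivative(1))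
    moreover have "(\<lambda>x. B n k (S x)) = (\<lambda>x. \<Sum>l\<in>K n. U k l * B n l x)"
      using ext[OF k] by blast
    moreover have "partial v (\<lambda>x. \<Sum>l\<in>K n. U k l * B n l x) x = (\<Sum>l\<in>K n. U k l * a l)"
    proof -
      have "pd i (\<lambda>x. \<Sum>l\<in>K n. U k l * B n l x) x = (\<Sum>l\<in>K n. U k l * pd i (B n l) x)" for i
        by (subst pd_sum) (auto simp: pd_cmult)
      moreover have "polyf (\<lambda>x. \<Sum>l\<in>K n. U k l * B n l x)" by auto
      ultimately have "partial v (\<lambda>x. \<Sum>l\<in>K n. U k l * B n l x) x
          = (\<Sum>i\<in>UNIV. \<Sum>l\<in>K n. cx i v * (U k l * pd i (B n l) x))"
        by (subst polyf_partial) (simp_all only: sum_distrib_left)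
      also have "\<dots> = (\<Sum>l\<in>K n. U k l * (\<Sum>i\<in>UNIV. cx i v * pd i (B n l) x))"
        by (subst sum.swap) (simp add: sum_distrib_left mult_ac)
      also have "\<dots> = (\<Sum>l\<in>K n. U k l * a l)"
        unfolding a_def by (intro sum.cong refl) (simp only: polyf_partial[OF polyf_B, symmetric])
      finally show ?thesis .
    qed
    ultimately show ?thesis by simp
  qed
  have "complex_of_real (grad n (S x) (S v)) = (\<Sum>k\<in>K n. (\<Sum>m\<in>K n. U k m * a m) * cnj (\<Sum>l\<in>K n. U k l * a l))"
    unfolding grad_def of_real_sum complex_norm_square by (intro sum.cong refl) (simp only: p)
  also have "\<dots> = (\<Sum>k\<in>K n. \<Sum>m\<in>K n. \<Sum>l\<in>K n. (a m * cnj (a l)) * (cnj (U k l) * U k m))"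
    by (simp add: sum_product mult_ac)
  also have "\<dots> = (\<Sum>m\<in>K n. \<Sum>l\<in>K n. \<Sum>k\<in>K n. (a m * cnj (a l)) * (cnj (U k l) * U k m))"
    by (subst sum.swap) (intro sum.cong refl sum.swap)
  also have "\<dots> = (\<Sum>m\<in>K n. \<Sum>l\<in>K n. (a m * cnj (a l)) * (if l = m then 1 else 0))"
    unfolding sum_distrib_left[symmetric] U_def
    by (intro sum.cong refl arg_cong2[where f = "(*)"] unitary_B_compose[OF S])
  also have "\<dots> = (\<Sum>m\<in>K n. a m * cnj (a m))"
    by (intro sum.cong refl) (simp add: if_distrib cong: if_cong)
  also have "\<dots> = complex_of_real (grad n x v)"
    unfolding grad_def of_real_sum complex_norm_square a_def ..
  finally show ?thesis unfolding of_real_eq_iff .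
qed

lemma rot_eq_partial: "polyf F \<Longrightarrow> rot p F x = partial (cross3 p x) F x"
  unfolding rot_def by (rule polyf_partial[symmetric])

text \<open>Orthogonal maps act transitively on pairs of a point and a tangent vector of given
  length, so a single reference frame determines the density.\<close>

lemma grad_tangent:
  assumes n: "n > 0" and x: "x \<in> S2" and v: "x \<bullet> v = 0"
  shows "grad n x v = grad n (axis 1 1) (axis 2 1) * (norm v)\<^sup>2"
proof -
  have "\<exists>S. orthogonal_transformation S \<and> S (axis 1 1 :: R3) = x \<and> S (norm v *\<^sub>R axis 2 1 :: R3) = v"
    using x v by (intro orthogonal_transformation_pair) (auto simp: inner_axis_axis norm_axis_1)
  then obtain S where S: "orthogonal_transformation S" "S (axis 1 1 :: R3) = x" "S (norm v *\<^sub>R axis 2 1 :: R3) = v"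
    by blast
  have "grad n x v = grad n (axis 1 1) (norm v *\<^sub>R axis 2 1)"
    using grad_orthogonal[OF S(1) n, of "axis 1 1" "norm v *\<^sub>R axis 2 1"] S by simp
  also have "\<dots> = (\<Sum>k\<in>K n. (cmod (of_real (norm v) * partial (axis 2 1) (B n k) (axis 1 1)))\<^sup>2)"
    unfolding grad_def
  proof (intro sum.cong refl)
    fix k assume "k \<in> K n"
    note p = polyf_partial[OF polyf_B[OF this]]
    have "partial (norm v *\<^sub>R axis 2 1) (B n k) (axis 1 1)
        = of_real (norm v) * partial (axis 2 1) (B n k) (axis 1 1)"
      unfolding p[of "norm v *\<^sub>R axis 2 1"] p[of "axis 2 1"] by (simp add: sum_distrib_left mult_ac)
    then show "(cmod (partial (norm v *\<^sub>R axis 2 1) (B n k) (axis 1 1)))\<^sup>2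
        = (cmod (of_real (norm v) * partial (axis 2 1) (B n k) (axis 1 1)))\<^sup>2" by simp
  qed
  also have "\<dots> = grad n (axis 1 1) (axis 2 1) * (norm v)\<^sup>2"
    unfolding grad_def sum_distrib_right by (intro sum.cong refl) (simp add: norm_mult power_mult_distrib mult_ac)
  finally show ?thesis .
qed

lemma sum_norm_cross_axis:
  assumes "x \<in> S2"
  shows "(\<Sum>a\<in>UNIV. (norm (cross3 (axis a 1) x))\<^sup>2) = 2"
proof -
  have "x $ 1 * x $ 1 + x $ 2 * x $ 2 + x $ 3 * x $ 3 = x \<bullet> x"
    by (simp add: inner_vec_def sum_3)
  also have "\<dots> = 1" using assms by (simp add: power2_norm_eq_inner[symmetric])
  finally show ?thesis
    by (simp add: power2_norm_eq_inner inner_vec_def sum_3 cross3_def axis_def)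
qed

lemma B_norm: "k \<in> K n \<Longrightarrow> mean_square (B n k) = 1"
proof -
  assume k: "k \<in> K n"
  have "complex_of_real (mean_square (B n k)) = 1"
    using l2_inner_self[of "B n k"] B_orthonormal[OF k k] k by simp
  then show ?thesis unfolding of_real_eq_1_iff .
qed

text \<open>\<open>grad_tangent\<close> leaves one unknown constant \<open>c\<close>. Summing over
  the three axes and integrating evaluates it: the density becomes 2 c by
  \<open>sum_norm_cross_axis\<close>, while \<open>sum_rot_norm\<close> contributes n (n + 1) for
  each of the 2 n + 1 basis functions.\<close>

lemma sum_rot_density:
  assumes n: "n > 0" and x: "x \<in> S2"
  shows "(\<Sum>k\<in>K n. (cmod (rot p (B n k) x))\<^sup>2)
    = real (n * Suc n * (2 * n + 1)) / 2 * (norm (cross3 p x))\<^sup>2"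
proof -
  define c where "c = grad n (axis 1 1) (axis 2 1)"
  have d: "(\<Sum>k\<in>K n. (cmod (rot p (B n k) x))\<^sup>2) = c * (norm (cross3 p x))\<^sup>2" if "x \<in> S2" for p x
    using grad_tangent[OF n that, of "cross3 p x"]
    by (simp add: grad_def c_def rot_eq_partial dot_cross_self)
  have "2 * c = (\<integral>x. 2 * c \<partial>sphere_measure)"
    using prob_space.prob_space[OF prob_space_sphere_measure] by simp
  also have "\<dots> = (\<integral>x. (\<Sum>a\<in>UNIV. \<Sum>k\<in>K n. (cmod (rot (axis a 1) (B n k) x))\<^sup>2) \<partial>sphere_measure)"
    by (intro Bochner_Integration.integral_cong)
      (auto simp: d sum_distrib_left[symmetric] sum_norm_cross_axis)
  also have "\<dots> = (\<Sum>a\<in>UNIV. \<Sum>k\<in>K n. mean_square (rot (axis a 1) (B n k)))"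
    by (subst Bochner_Integration.integral_sum, force, intro sum.cong refl Bochner_Integration.integral_sum) auto
  also have "\<dots> = (\<Sum>k\<in>K n. real (n * Suc n) * mean_square (B n k))"
    by (subst sum.swap) (intro sum.cong refl sum_rot_norm sph_harm_B)
  also have "\<dots> = (\<Sum>k\<in>K n. real (n * Suc n))"
    by (intro sum.cong refl) (simp only: B_norm mult_1_right)
  also have "\<dots> = real (n * Suc n * (2 * n + 1))" by (simp add: algebra_simps)
  finally show ?thesis using d[OF x] by simp
qed

end

text \<open>The cone over a nonempty relatively open part of the sphere meets the unit ball in a
  nonempty open set, which has positive Lebesgue measure.\<close>

lemma negligible_sphere_measure_open:
  fixes h :: "R3 \<Rightarrow> real"
  assumes h: "continuous_on S2 h" and x0: "x0 \<in> S2" "h x0 \<noteq> 0"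
  shows "\<not> (AE x in sphere_measure. h x = 0)"
proof
  assume ae: "AE x in sphere_measure. h x = 0"
  define A where "A = {x \<in> S2. h x \<noteq> 0}"
  define U where "U = {y \<in> - {0 :: R3}. (h \<circ> sgn) y \<noteq> 0}"
  have cs: "continuous_on (- {0 :: R3}) sgn" by (intro continuous_intros) auto
  have img: "sgn ` (- {0 :: R3}) \<subseteq> S2" by (auto simp: norm_sgn split: if_splits)
  have "continuous_on (- {0}) (h \<circ> sgn)"
    using h by (intro continuous_on_compose cs) (rule continuous_on_subset[OF h img])
  then have oU: "open U"
    using continuous_open_preimage[of "- {0 :: R3}" "h \<circ> sgn" "- {0}"]
    by (auto simp: U_def vimage_def Int_def)
  have eq: "ball 0 1 \<inter> sgn -` A = ball 0 1 \<inter> U"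
    by (auto simp: A_def U_def norm_sgn split: if_splits)
  have mA: "A \<in> sets sphere_measure"
  proof -
    have "integrable sphere_measure h" using h by (rule integrable_sphere_continuous)
    then have "{x \<in> space sphere_measure. h x \<noteq> 0} \<in> sets sphere_measure"
      using borel_measurable_integrable[of sphere_measure h] by measurable
    then show ?thesis by (simp add: A_def)
  qed
  then have A: "A \<in> sets borel" "A \<subseteq> S2"
    by (auto simp: sets_sphere_measure sets_restrict_space)
  have "emeasure sphere_measure A = 0"
    using ae mA by (subst (asm) AE_iff_measurable[of A]) (auto simp: A_def)
  then have "emeasure lborel (ball 0 1 \<inter> U) = 0"
    using emeasure_unit_ball_R3 unfolding emeasure_sphere_measure[OF A] eq by simp
  moreover have "open (ball 0 1 \<inter> U)" using oU by auto
  \<comment> \<open>Halving moves the point into the open ball and keeps its direction.\<close>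
  moreover have "x0 /\<^sub>R 2 \<in> ball 0 1 \<inter> U"
    using x0 by (auto simp: U_def sgn_scaleR) (auto simp: sgn_div_norm)
  ultimately have "\<not> negligible (ball 0 1 \<inter> U)" "ball 0 1 \<inter> U \<in> null_sets lborel"
    using open_not_negligible[of "ball 0 1 \<inter> U"] by (blast, simp add: null_sets_def)
  then show False
    by (simp add: negligible_iff_null_sets null_sets_completionI)
qed

lemma sphint_of_real: "sphint (\<lambda>x. complex_of_real (h x)) = of_real (\<integral>x. h x \<partial>sphere_measure)"
  by simp

context sphere_basis
begin

subsection \<open>Operators on the eigenspaces\<close>

lemma rot_B_expansion:
  assumes l: "l \<in> K n" and x: "x \<in> S2"
  shows "rot p (B n l) x = (\<Sum>k\<in>K n. l2_inner (rot p (B n l)) (B n k) * B n k x)"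
proof (rule top_degree_expansion[OF pf_rot[OF pf_B[OF l]] _ x])
  fix m k assume m: "m < n" "k \<in> K m"
  have "l2_inner (rot p (B m k)) (B n l) = 0"
    using l m by (intro l2_inner_low_degree[OF pf_rot[OF pf_B]])
  then have "l2_inner (B n l) (rot p (B m k)) = 0" by (subst l2_inner_commute) simp
  then show "l2_inner (rot p (B n l)) (B m k) = 0"
    using l m by (subst l2_inner_rot) auto
qed

lemma sph_harm_rot_B:
  assumes l: "l \<in> K n"
  shows "sph_harm n (rot p (B n l))"
proof (rule sph_harm_cong[OF _ pf_rot[OF pf_B[OF l]]])
  show "sph_harm n (\<lambda>x. \<Sum>k\<in>K n. l2_inner (rot p (B n l)) (B n k) * B n k x)"
    by (intro sph_harm_sum sph_harm_cmult sph_harm_B)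
qed (simp add: rot_B_expansion[OF l])

lemma rot_B_antisymmetric:
  assumes "l \<in> K n" "k \<in> K n"
  shows "l2_inner (rot p (B n k)) (B n l) = - cnj (l2_inner (rot p (B n l)) (B n k))"
  using assms by (subst l2_inner_rot) (auto simp: l2_inner_commute[of "B n k"])

lemma rot_rot_B_expansion:
  assumes l: "l \<in> K n" and x: "x \<in> S2"
  shows "rot p (rot p (B n l)) x = (\<Sum>k\<in>K n. l2_inner (rot p (rot p (B n l))) (B n k) * B n k x)"
proof (rule top_degree_expansion[OF pf_rot[OF pf_rot[OF pf_B[OF l]]] _ x])
  fix m k assume m: "m < n" "k \<in> K m"
  have "l2_inner (rot p (rot p (B m k))) (B n l) = 0"
    using l m by (intro l2_inner_low_degree[OF pf_rot[OF pf_rot[OF pf_B]]])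
  then have "l2_inner (B n l) (rot p (rot p (B m k))) = 0" by (subst l2_inner_commute) simp
  then show "l2_inner (rot p (rot p (B n l))) (B m k) = 0"
    using l m polyf_B by (simp add: l2_inner_rot)
qed

text \<open>The expansion of \<open>rot p (B n l)\<close> is known on the sphere only and is not
  differentiated again. Instead the coefficients of the square are found to be a matrix product,
  because the matrix of \<open>rot p\<close> is anti-Hermitian.\<close>

lemma rot_rot_B:
  assumes l: "l \<in> K n" and x: "x \<in> S2"
  shows "rot p (rot p (B n l)) x = (\<Sum>m\<in>K n. l2_inner (rot p (B n l)) (B n m) * rot p (B n m) x)"
proof -
  define a where "a l k = l2_inner (rot p (B n l)) (B n k)" for l k
  have "rot p (rot p (B n l)) x = (\<Sum>k\<in>K n. l2_inner (rot p (rot p (B n l))) (B n k) * B n k x)"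
    by (rule rot_rot_B_expansion[OF l x])
  also have "\<dots> = (\<Sum>k\<in>K n. (\<Sum>m\<in>K n. a l m * a m k) * B n k x)"
  proof (intro sum.cong refl arg_cong2[where f = "(*)"])
    fix k assume k: "k \<in> K n"
    have "l2_inner (rot p (rot p (B n l))) (B n k) = - l2_inner (rot p (B n l)) (rot p (B n k))"
      using k l by (intro l2_inner_rot polyf_rot polyf_B)
    also have "l2_inner (rot p (B n l)) (rot p (B n k)) = (\<Sum>m\<in>K n. a l m * cnj (a k m))"
      unfolding a_def using rot_B_expansion[OF l] rot_B_expansion[OF k] by (rule l2_inner_expansion)
    also have "- \<dots> = (\<Sum>m\<in>K n. a l m * a m k)"
      unfolding sum_negf[symmetric]
    proof (intro sum.cong refl)
      fix m assume m: "m \<in> K n"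
      show "- (a l m * cnj (a k m)) = a l m * a m k"
        using rot_B_antisymmetric[OF k m] by (simp add: a_def)
    qed
    finally show "l2_inner (rot p (rot p (B n l))) (B n k) = (\<Sum>m\<in>K n. a l m * a m k)" .
  qed
  also have "\<dots> = (\<Sum>m\<in>K n. a l m * (\<Sum>k\<in>K n. a m k * B n k x))"
    unfolding sum_distrib_left sum_distrib_right by (subst sum.swap) (simp only: mult_ac)
  also have "\<dots> = (\<Sum>m\<in>K n. a l m * rot p (B n m) x)"
    using x by (intro sum.cong refl) (simp add: a_def rot_B_expansion[of _ n x])
  finally show ?thesis by (simp add: a_def)
qed

text \<open>In a sum over the whole basis an anti-Hermitian matrix can change sides at each fixed
  point: one of the two rotations moves to the other factor at the price of a sign.\<close>

lemma kernel_rot_rot: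
  assumes x: "x \<in> S2"
  shows "(\<Sum>l\<in>K n. B n l x * cnj (rot p (rot p (B n l)) x)) = - of_real (\<Sum>k\<in>K n. (cmod (rot p (B n k) x))\<^sup>2)"
proof -
  define a where "a l k = l2_inner (rot p (B n l)) (B n k)" for l k
  have "(\<Sum>l\<in>K n. B n l x * cnj (rot p (rot p (B n l)) x))
     = (\<Sum>l\<in>K n. \<Sum>m\<in>K n. - (a m l * B n l x * cnj (rot p (B n m) x)))"
  proof (intro sum.cong refl)
    fix l assume l: "l \<in> K n"
    have "cnj (rot p (rot p (B n l)) x) = (\<Sum>m\<in>K n. cnj (a l m) * cnj (rot p (B n m) x))"
      unfolding rot_rot_B[OF l x] a_def by simp
    also have "\<dots> = (\<Sum>m\<in>K n. - a m l * cnj (rot p (B n m) x))"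
    proof (intro sum.cong refl)
      fix m assume m: "m \<in> K n"
      show "cnj (a l m) * cnj (rot p (B n m) x) = - a m l * cnj (rot p (B n m) x)"
        using rot_B_antisymmetric[OF l m, of p] by (simp add: a_def)
    qed
    finally show "B n l x * cnj (rot p (rot p (B n l)) x)
        = (\<Sum>m\<in>K n. - (a m l * B n l x * cnj (rot p (B n m) x)))"
      by (simp add: sum_distrib_left mult_ac)
  qed
  also have "\<dots> = - (\<Sum>m\<in>K n. (\<Sum>l\<in>K n. a m l * B n l x) * cnj (rot p (B n m) x))"
    by (subst sum.swap) (simp add: sum_negf sum_distrib_right)
  also have "(\<Sum>m\<in>K n. (\<Sum>l\<in>K n. a m l * B n l x) * cnj (rot p (B n m) x))
      = (\<Sum>m\<in>K n. rot p (B n m) x * cnj (rot p (B n m) x))"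
    using x by (intro sum.cong refl) (simp add: a_def rot_B_expansion[of _ n x])
  finally show ?thesis by (simp only: of_real_sum complex_norm_square)
qed

lemma norm_cross3_sphere:
  assumes "x \<in> S2"
  shows "(norm (cross3 p x))\<^sup>2 = (norm p)\<^sup>2 - (p \<bullet> x)\<^sup>2"
  using norm_cross_dot[of p x] assms by simp

definition matrix_elem :: "(R3 \<Rightarrow> real) \<Rightarrow> nat \<Rightarrow> int \<Rightarrow> int \<Rightarrow> complex" where
  "matrix_elem f n l k = l2_inner (\<lambda>x. of_real (f x) * B n l x) (B n k)"

text \<open>The diagonal of the kernel is a multiple of |p|^2 - (p . x)^2 by
  \<open>kernel_rot_rot\<close>, \<open>sum_rot_density\<close> and
  \<open>norm_cross3_sphere\<close>; the vanishing mean of \<open>f\<close> removes the constant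
  part.\<close>

lemma trace_rot_rot:
  assumes f: "polyf (\<lambda>x. of_real (f x))" and f0: "(\<integral>x. f x \<partial>sphere_measure) = 0" and n: "n > 0"
  shows "(\<Sum>l\<in>K n. l2_inner (\<lambda>x. of_real (f x) * B n l x) (rot p (rot p (B n l))))
    = of_real (real (n * Suc n * (2 * n + 1)) / 2 * quad_moment f p)"
proof -
  define c where "c = real (n * Suc n * (2 * n + 1)) / 2"
  have cf: "continuous_on A f" for A
  proof -
    have "continuous_on A (\<lambda>x. Re (of_real (f x)))"
      by (intro continuous_intros polyf_continuous_on[OF f])
    then show ?thesis by simp
  qed
  have "(\<Sum>l\<in>K n. l2_inner (\<lambda>x. of_real (f x) * B n l x) (rot p (rot p (B n l))))
     = sphint (\<lambda>x. \<Sum>l\<in>K n. of_real (f x) * B n l x * cnj (rot p (rot p (B n l)) x))"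
    unfolding l2_inner_def using f
    by (intro Bochner_Integration.integral_sum[symmetric] integrable_sphere_polyf polyf_intros polyf_rot polyf_B)
  also have "\<dots> = sphint (\<lambda>x. of_real (c * (f x * (p \<bullet> x)\<^sup>2 - (norm p)\<^sup>2 * f x)))"
  proof (rule sphint_cong)
    fix x assume x: "x \<in> S2"
    have "(\<Sum>l\<in>K n. of_real (f x) * B n l x * cnj (rot p (rot p (B n l)) x))
        = of_real (f x) * (\<Sum>l\<in>K n. B n l x * cnj (rot p (rot p (B n l)) x))"
      by (simp add: sum_distrib_left mult.assoc)
    also have "\<dots> = of_real (f x * - (c * ((norm p)\<^sup>2 - (p \<bullet> x)\<^sup>2)))"
      unfolding kernel_rot_rot[OF x] sum_rot_density[OF n x] norm_cross3_sphere[OF x] c_def by simp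
    also have "f x * - (c * ((norm p)\<^sup>2 - (p \<bullet> x)\<^sup>2)) = c * (f x * (p \<bullet> x)\<^sup>2 - (norm p)\<^sup>2 * f x)"
      by (simp add: algebra_simps)
    finally show "(\<Sum>l\<in>K n. of_real (f x) * B n l x * cnj (rot p (rot p (B n l)) x))
        = of_real (c * (f x * (p \<bullet> x)\<^sup>2 - (norm p)\<^sup>2 * f x))" .
  qed
  also have "\<dots> = of_real (c * quad_moment f p)"
  proof -
    have "integrable sphere_measure f" "integrable sphere_measure (\<lambda>x. f x * (p \<bullet> x)\<^sup>2)"
      by (intro integrable_sphere_continuous continuous_intros cf)+
    then show ?thesis unfolding sphint_of_real by (simp add: f0)
  qed
  finally show ?thesis by (simp add: c_def)
qed

text \<open>Cauchy--Schwarz for the Hilbert--Schmidt pairing of multiplication by \<open>f\<close> with \<open>(rot p)\<^sup>2\<close>.\<close>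

lemma hilbert_schmidt_lower_bound:
  assumes f: "polyf (\<lambda>x. of_real (f x))" and f0: "(\<integral>x. f x \<partial>sphere_measure) = 0" and n: "n > 0"
  shows "(quad_moment f p)\<^sup>2 * (2 * n + 1)
    \<le> 4 * (norm p) ^ 4 * (\<Sum>l\<in>K n. \<Sum>k\<in>K n. (cmod (matrix_elem f n l k))\<^sup>2)"
proof -
  define \<tau> where "\<tau> = quad_moment f p"
  define s where "s = real (n * Suc n)"
  define w where "w l k = l2_inner (rot p (rot p (B n l))) (B n k)" for l k
  have e: "rot p (rot p (B n l)) x = (\<Sum>k\<in>K n. w l k * B n k x)" if "l \<in> K n" "x \<in> S2" for l x
    unfolding w_def using that by (rule rot_rot_B_expansion)
  have s: "s > 0" using n unfolding s_def of_nat_0_less_iff by simp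
  \<comment> \<open>\<open>rot_norm_le\<close> applies twice because \<open>rot p (B n l)\<close> is
    again a harmonic of degree \<open>n\<close>. Summed over \<open>l\<close>, this bounds the
    squared Hilbert-Schmidt norm of the double rotation.\<close>
  have w: "(\<Sum>k\<in>K n. (cmod (w l k))\<^sup>2) \<le> ((norm p)\<^sup>2 * s)\<^sup>2" if l: "l \<in> K n" for l
  proof -
    have h1: "sph_harm n (rot p (B n l))" using l by (rule sph_harm_rot_B)
    have "complex_of_real (\<Sum>k\<in>K n. (cmod (w l k))\<^sup>2) = l2_inner (rot p (rot p (B n l))) (rot p (rot p (B n l)))"
      unfolding of_real_sum complex_norm_square using e[OF l] e[OF l] by (rule l2_inner_expansion[symmetric])
    also have "\<dots> = of_real (mean_square (rot p (rot p (B n l))))"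
      using l by (intro l2_inner_self polyf_rot polyf_B)
    finally have "(\<Sum>k\<in>K n. (cmod (w l k))\<^sup>2) = mean_square (rot p (rot p (B n l)))"
      unfolding of_real_eq_iff .
    also have "\<dots> \<le> (norm p)\<^sup>2 * s * mean_square (rot p (B n l))"
      unfolding s_def by (rule rot_norm_le[OF h1])
    also have "\<dots> \<le> (norm p)\<^sup>2 * s * ((norm p)\<^sup>2 * s * mean_square (B n l))"
      unfolding s_def by (intro mult_left_mono rot_norm_le sph_harm_B l) simp
    finally show ?thesis using B_norm[OF l] by (simp add: power2_eq_square)
  qed
  have tr: "l2_inner (\<lambda>x. of_real (f x) * B n l x) (rot p (rot p (B n l)))
     = (\<Sum>k\<in>K n. cnj (w l k) * matrix_elem f n l k)" if l: "l \<in> K n" for l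
  proof -
    have "l2_inner (\<lambda>x. of_real (f x) * B n l x) (rot p (rot p (B n l)))
      = l2_inner (\<lambda>x. of_real (f x) * B n l x) (\<lambda>x. \<Sum>k\<in>K n. w l k * B n k x)"
      using e[OF l] by (intro l2_inner_cong) auto
    also have "\<dots> = (\<Sum>k\<in>K n. cnj (w l k) * matrix_elem f n l k)"
      unfolding matrix_elem_def using l f by (intro l2_inner_sum_right polyf_intros polyf_B)
    finally show ?thesis .
  qed
  define HS where "HS = (\<Sum>l\<in>K n. \<Sum>k\<in>K n. (cmod (matrix_elem f n l k))\<^sup>2)"
  have "(s * (2 * n + 1) / 2 * \<tau>)\<^sup>2 = (cmod (\<Sum>l\<in>K n. \<Sum>k\<in>K n. cnj (w l k) * matrix_elem f n l k))\<^sup>2"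
  proof -
    have "(\<Sum>l\<in>K n. \<Sum>k\<in>K n. cnj (w l k) * matrix_elem f n l k) = of_real (s * (2 * n + 1) / 2 * \<tau>)"
    proof -
      have "(\<Sum>l\<in>K n. \<Sum>k\<in>K n. cnj (w l k) * matrix_elem f n l k)
        = (\<Sum>l\<in>K n. l2_inner (\<lambda>x. of_real (f x) * B n l x) (rot p (rot p (B n l))))"
        by (intro sum.cong refl tr[symmetric])
      also have "\<dots> = of_real (real (n * Suc n * (2 * n + 1)) / 2 * \<tau>)"
        unfolding \<tau>_def by (rule trace_rot_rot[OF f f0 n])
      also have "real (n * Suc n * (2 * n + 1)) = s * (2 * n + 1)" by (simp add: s_def algebra_simps)
      finally show ?thesis .
    qed
    then show ?thesis by (simp only: norm_of_real power2_abs)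
  qed
  also have "\<dots> \<le> (\<Sum>(l, k)\<in>K n \<times> K n. cmod (w l k) * cmod (matrix_elem f n l k))\<^sup>2"
    unfolding sum.cartesian_product
    by (intro power_mono order_trans[OF norm_sum]) (auto simp: norm_mult intro!: sum_mono)
  also have "\<dots> \<le> (\<Sum>(l, k)\<in>K n \<times> K n. (cmod (w l k))\<^sup>2) * (\<Sum>(l, k)\<in>K n \<times> K n. (cmod (matrix_elem f n l k))\<^sup>2)"
    unfolding case_prod_beta by (rule Cauchy_Schwarz_ineq_sum)
  also have "\<dots> = (\<Sum>l\<in>K n. \<Sum>k\<in>K n. (cmod (w l k))\<^sup>2) * HS"
    by (simp add: sum.cartesian_product HS_def)
  also have "\<dots> \<le> (\<Sum>l\<in>K n. ((norm p)\<^sup>2 * s)\<^sup>2) * HS"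
    using w by (intro mult_right_mono sum_mono) (auto simp: HS_def intro!: sum_nonneg)
  also have "\<dots> = (2 * n + 1) * ((norm p)\<^sup>2 * s)\<^sup>2 * HS"
    by (simp add: algebra_simps)
  finally have "(s * (2 * n + 1) / 2 * \<tau>)\<^sup>2 \<le> (2 * n + 1) * ((norm p)\<^sup>2 * s)\<^sup>2 * HS" .
  \<comment> \<open>Arranged so that the common positive factor s^2 (2 n + 1) can be cancelled; one
    factor 2 n + 1 survives on the left.\<close>
  then have "(s\<^sup>2 * real (2 * n + 1)) * (\<tau>\<^sup>2 * (2 * n + 1)) \<le> (s\<^sup>2 * real (2 * n + 1)) * (4 * norm p ^ 4 * HS)"
    by (simp add: power_mult_distrib power_divide power2_eq_square power4_eq_xxxx field_simps)
  then have "\<tau>\<^sup>2 * (2 * n + 1) \<le> 4 * norm p ^ 4 * HS"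
    using s by (subst (asm) mult_le_cancel_left_pos) auto
  then show ?thesis by (simp add: \<tau>_def HS_def add_ac)
qed

section \<open>The excess of the low mode\<close>

definition excess :: "R3 \<Rightarrow> real" where
  "excess x = (cmod (B 1 0 x))\<^sup>2 - 1"

lemma of_real_excess: "complex_of_real (excess x) = B 1 0 x * cnj (B 1 0 x) - 1"
  by (simp add: excess_def complex_norm_square[symmetric])

lemma polyf_excess: "polyf (\<lambda>x. of_real (excess x))"
  unfolding of_real_excess by (intro polyf_intros polyf_B) auto

text \<open>Homogeneity of degree 1 makes the mode linear along each ray, so its value at
  \<open>x\<close> is its derivative at the origin in direction \<open>x\<close>, and that
  derivative is a linear form.\<close>

lemma B_1_linear: "\<exists>p q :: R3. \<forall>x. B 1 0 x = of_real (p \<bullet> x) + \<i> * of_real (q \<bullet> x)"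
proof -
  define c where "c i = pd i (B 1 0) 0" for i
  have "B 1 0 x = (\<Sum>i\<in>UNIV. cx i x * c i)" for x
  proof -
    have "((\<lambda>h. B 1 0 (0 + h *\<^sub>R x)) has_vector_derivative (\<Sum>i\<in>UNIV. cx i x * c i)) (at 0)"
    proof -
      have F: "(B 1 0 has_derivative (\<lambda>h. \<Sum>i\<in>UNIV. cx i h * c i)) (at (0 :: R3))"
        unfolding c_def by (intro polyf_has_derivative polyf_B) auto
      from partial_of_has_derivative[OF F, of x] show ?thesis
        unfolding partial_def by (simp add: vector_derivative_works)
    qed
    moreover have "((\<lambda>h. B 1 0 (0 + h *\<^sub>R x)) has_vector_derivative B 1 0 x) (at 0)"
      by (simp add: B_scaleR) (auto intro!: derivative_eq_intros)
    ultimately show ?thesis using vector_derivative_unique_at by blast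
  qed
  then have "B 1 0 x = of_real ((\<chi> i. Re (c i)) \<bullet> x) + \<i> * of_real ((\<chi> i. Im (c i)) \<bullet> x)" for x
    by (simp add: complex_eq_iff inner_vec_def mult.commute)
  then show ?thesis by blast
qed

text \<open>As \<open>excess\<close> is (p . x)^2 + (q . x)^2 - 1, the integral of its square is the
  sum of two moments minus the mean. If all moments vanished, \<open>excess\<close> would be 0
  almost everywhere, hence by continuity everywhere on the sphere; but in a direction orthogonal to
  \<open>p\<close> and \<open>q\<close> it equals -1.\<close>

lemma excess_nontrivial:
  "(\<integral>x. excess x \<partial>sphere_measure) = 0"
  "\<exists>p. quad_moment excess p \<noteq> 0"
proof -
  obtain p q where pq: "\<And>x. B 1 0 x = of_real (p \<bullet> x) + \<i> * of_real (q \<bullet> x)"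
    using B_1_linear by blast
  have d: "excess x = (p \<bullet> x)\<^sup>2 + (q \<bullet> x)\<^sup>2 - 1" for x
    unfolding excess_def pq by (simp add: cmod_power2)
  have cd: "continuous_on A excess" for A
    unfolding d[abs_def] by (intro continuous_intros)
  have int: "integrable sphere_measure excess" "integrable sphere_measure (\<lambda>x. (excess x)\<^sup>2)"
    "integrable sphere_measure (\<lambda>x. excess x * (v \<bullet> x)\<^sup>2)" for v
    by (intro integrable_sphere_continuous continuous_intros cd)+
  have one: "measure sphere_measure (space sphere_measure) = 1"
    using prob_space.prob_space[OF prob_space_sphere_measure] .
  show d0: "(\<integral>x. excess x \<partial>sphere_measure) = 0"
    unfolding excess_def using B_norm[of 0 1] one
    by (subst Bochner_Integration.integral_diff) (auto simp del: space_sphere_measure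
        intro!: integrable_sphere_continuous continuous_intros polyf_continuous_on)
  show "\<exists>p. quad_moment excess p \<noteq> 0"
  proof (rule ccontr)
    assume "\<nexists>p. quad_moment excess p \<noteq> 0"
    then have z: "quad_moment excess v = 0" for v by blast
    have "(\<integral>x. (excess x)\<^sup>2 \<partial>sphere_measure)
      = (\<integral>x. excess x * (p \<bullet> x)\<^sup>2 + excess x * (q \<bullet> x)\<^sup>2 - excess x \<partial>sphere_measure)"
      by (intro Bochner_Integration.integral_cong refl) (simp add: d power2_eq_square algebra_simps)
    also have "\<dots> = 0" using int by (simp add: z d0)
    finally have "AE x in sphere_measure. (excess x)\<^sup>2 = 0"
      using integral_nonneg_eq_0_iff_AE[OF int(2)] by simp
    moreover obtain y where y: "y \<noteq> 0" "p \<bullet> y = 0" "q \<bullet> y = 0"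
    proof -
      have "dim {p, q} < DIM(R3)"
        using dim_le_card[of "{p, q}" "{p, q}"] card_insert_le_m1[of 2 "{q}" p] by (simp add: span_superset)
      from orthogonal_to_subspace_exists[OF this] obtain y where "y \<noteq> 0" "\<And>v. v \<in> span {p, q} \<Longrightarrow> orthogonal y v"
        by blast
      then show ?thesis using that span_base[of p "{p, q}"] span_base[of q "{p, q}"]
        by (auto simp: orthogonal_def inner_commute)
    qed
    moreover have "sgn y \<in> S2" "(excess (sgn y))\<^sup>2 \<noteq> 0"
      using y by (auto simp: norm_sgn d sgn_div_norm)
    ultimately show False
      using negligible_sphere_measure_open[of "\<lambda>x. (excess x)\<^sup>2" "sgn y"] cd continuous_on_power by blast
  qed
qed

lemma matrix_elem_lower_bound:
  "\<exists>C>0. \<forall>n>0. C * real n \<le> (\<Sum>l\<in>K n. \<Sum>k\<in>K n. (cmod (matrix_elem excess n l k))\<^sup>2)"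
proof -
  obtain p where p: "quad_moment excess p \<noteq> 0" (is "?\<tau> \<noteq> 0")
    using excess_nontrivial(2) by blast
  then have "p \<noteq> 0" by auto
  \<comment> \<open>The value results from weakening 2 n + 1 to 2 n in
    \<open>hilbert_schmidt_lower_bound\<close> and dividing by 4 |p|^4.\<close>
  define C where "C = ?\<tau>\<^sup>2 / (2 * norm p ^ 4)"
  have "C > 0" using p \<open>p \<noteq> 0\<close> by (simp add: C_def)
  moreover have "C * real n \<le> (\<Sum>l\<in>K n. \<Sum>k\<in>K n. (cmod (matrix_elem excess n l k))\<^sup>2)" if "n > 0" for n
  proof -
    have "?\<tau>\<^sup>2 * (2 * real n) \<le> ?\<tau>\<^sup>2 * (2 * n + 1)" by (intro mult_left_mono) auto
    also have "\<dots> \<le> 4 * norm p ^ 4 * (\<Sum>l\<in>K n. \<Sum>k\<in>K n. (cmod (matrix_elem excess n l k))\<^sup>2)"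
      using hilbert_schmidt_lower_bound[OF polyf_excess excess_nontrivial(1) that, of p] by (simp add: add_ac)
    finally show ?thesis using \<open>p \<noteq> 0\<close> by (simp add: C_def field_simps)
  qed
  ultimately show ?thesis by blast
qed

end

section \<open>The second Picard iteration in coordinates\<close>

definition tint :: "real \<Rightarrow> (real \<Rightarrow> complex) \<Rightarrow> complex" where
  "tint t h = (LBINT s=0..t. h s)"

lemma interval_integrable_continuous_UNIV:
  fixes h :: "real \<Rightarrow> complex"
  assumes "continuous_on UNIV h"
  shows "interval_lebesgue_integrable lborel 0 (ereal t) h"
proof -
  have "interval_lebesgue_integrable lborel (ereal 0) (ereal t) h"
    using assms by (intro interval_integrable_isCont) (simp add: continuous_on_eq_continuous_at)
  then show ?thesis by (simp add: zero_ereal_def)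
qed

lemma tint_cmult: "tint t (\<lambda>s. c * h s) = c * tint t h"
  by (simp add: tint_def)

lemma tint_sum:
  assumes "\<And>i. i \<in> I \<Longrightarrow> continuous_on UNIV (h i)"
  shows "tint t (\<lambda>s. \<Sum>i\<in>I. h i s) = (\<Sum>i\<in>I. tint t (h i))"
  using assms
proof (induction I rule: infinite_finite_induct)
  case (insert i I)
  have "continuous_on UNIV (\<lambda>s. \<Sum>j\<in>I. h j s)"
    using insert.prems by (intro continuous_intros) auto
  then show ?case using insert
    by (simp add: tint_def interval_lebesgue_integral_add interval_integrable_continuous_UNIV)
qed (simp_all add: tint_def)

lemma tint_diff:
  assumes "continuous_on UNIV f" "continuous_on UNIV h"
  shows "tint t (\<lambda>s. f s - h s) = tint t f - tint t h"
  using assms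
  by (simp add: tint_def interval_lebesgue_integral_diff interval_integrable_continuous_UNIV)

lemma tint_const: "tint t (\<lambda>_. c) = of_real t * c"
proof -
  have "tint t (\<lambda>_. of_real 1) = of_real (LBINT s=0..t. (1::real))"
    unfolding tint_def by (rule interval_lebesgue_integral_of_real)
  also have "(LBINT s=0..t. (1::real)) = t"
    using interval_integral_const(2)[of 0 t 1] by (simp add: zero_ereal_def)
  finally show ?thesis using tint_cmult[of t c "\<lambda>_. 1"] by (simp add: mult.commute)
qed

lemma lam_pos: "lam n > 0"
  by (simp add: lam_def add_nonneg_pos)

lemma lam_ge: "real n \<le> lam n"
  unfolding lam_def by (rule real_le_rsqrt) simp

lemma lam_le: "lam n \<le> real n + 1"
  unfolding lam_def by (rule real_le_lsqrt) (auto simp: power2_eq_square algebra_simps)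

lemma finite_lam_le: "finite {n. lam n \<le> N}"
proof (rule finite_subset)
  show "{n. lam n \<le> N} \<subseteq> {..nat \<lceil>N\<rceil>}"
  proof safe
    fix n assume "lam n \<le> N"
    then have "real n \<le> N" using lam_ge[of n] by linarith
    then show "n \<le> nat \<lceil>N\<rceil>" by linarith
  qed
qed simp

definition phase :: "real \<Rightarrow> nat \<Rightarrow> complex" where
  "phase t n = exp (- \<i> * of_real (t * (lam n)\<^sup>2))"

lemma phase_mult_cnj: "phase t n * cnj (phase t n) = 1"
  by (simp add: phase_def exp_cnj flip: exp_add)

lemma phase_diff: "phase (t - s) n * phase s n = phase t n"
  by (simp add: phase_def left_diff_distrib algebra_simps flip: exp_add)

lemma cmod_phase [simp]: "cmod (phase t n) = 1"
  by (simp add: phase_def)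

lemma continuous_phase [continuous_intros]:
  "continuous_on A h \<Longrightarrow> continuous_on A (\<lambda>s. phase (h s) n)"
  unfolding phase_def by (intro continuous_intros)

lemma triple_sum:
  fixes f g h :: "'i \<Rightarrow> complex"
  shows "(\<Sum>a\<in>I. f a) * (\<Sum>c\<in>I. g c) * (\<Sum>d\<in>I. h d) = (\<Sum>a\<in>I. \<Sum>c\<in>I. \<Sum>d\<in>I. f a * g c * h d)"
proof -
  have "(\<Sum>a\<in>I. \<Sum>c\<in>I. \<Sum>d\<in>I. f a * g c * h d) = (\<Sum>a\<in>I. \<Sum>c\<in>I. f a * g c) * (\<Sum>d\<in>I. h d)"
    by (simp only: sum_distrib_left[symmetric] sum_distrib_right[symmetric])
  then show ?thesis by (simp only: sum_product)
qed

section \<open>Projections and propagator in coordinates\<close>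

context sphere_basis
begin

lemma eigenspace_rs:
  "(\<lambda>x. \<Sum>k\<in>K n. c k * b n k x) = rs (\<lambda>x. \<Sum>k\<in>K n. c k * B n k x)"
  by (auto simp: fun_eq_iff b_eq rs_def intro!: sum.cong)

lemma eigenspace_sum: "(\<lambda>x. \<Sum>k\<in>K n. c k * b n k x) \<in> eigenspace n"
  unfolding eigenspace_rs by (intro sph_harm_eigenspace sph_harm_sum sph_harm_cmult sph_harm_B)

lemma eigenspaceE:
  assumes "e \<in> eigenspace n"
  obtains c where "e = (\<lambda>x. \<Sum>k\<in>K n. c k * b n k x)"
  using assms onb[of n] unfolding orthonormal_basis_eigenspace_def by blast

lemma l2_inner_b_sum:
  "l2_inner (\<lambda>x. \<Sum>k\<in>K n. c k * b n k x) (\<lambda>x. \<Sum>k\<in>K n. e k * b n k x) = (\<Sum>k\<in>K n. c k * cnj (e k))"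
  unfolding eigenspace_rs by (rule l2_inner_expansion) (simp_all add: rs_def)

lemma b_as_sum: "j \<in> K n \<Longrightarrow> b n j = (\<lambda>x. \<Sum>k\<in>K n. (if k = j then 1 else 0) * b n k x)"
  by (simp add: fun_eq_iff if_distrib if_distribR cong: if_cong)

text \<open>Resolves the definite description in \<open>proj_dist\<close>; testing with coordinate
  vectors gives uniqueness. Only the action of \<open>T\<close> on one eigenspace enters, which is
  what admits data outside L^2.\<close>

lemma proj_dist_eq:
  assumes T: "\<And>c. T (\<lambda>x. \<Sum>k\<in>K n. c k * b n k x) = (\<Sum>k\<in>K n. cnj (c k) * a k)"
  shows "proj_dist n T = (\<lambda>x. \<Sum>k\<in>K n. a k * b n k x)"
  unfolding proj_dist_def
proof (rule the_equality)
  show "(\<lambda>x. \<Sum>k\<in>K n. a k * b n k x) \<in> eigenspace n \<and>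
    (\<forall>e\<in>eigenspace n. l2_inner (\<lambda>x. \<Sum>k\<in>K n. a k * b n k x) e = T e)"
  proof (intro conjI ballI eigenspace_sum)
    fix e assume "e \<in> eigenspace n"
    then obtain c where e: "e = (\<lambda>x. \<Sum>k\<in>K n. c k * b n k x)" by (rule eigenspaceE)
    show "l2_inner (\<lambda>x. \<Sum>k\<in>K n. a k * b n k x) e = T e"
      unfolding e T l2_inner_b_sum by (simp add: mult.commute)
  qed
  fix p assume p: "p \<in> eigenspace n \<and> (\<forall>e\<in>eigenspace n. l2_inner p e = T e)"
  obtain c where c: "p = (\<lambda>x. \<Sum>k\<in>K n. c k * b n k x)" using p by (blast elim: eigenspaceE)
  have "c j = a j" if j: "j \<in> K n" for j
  proof -
    let ?e = "\<lambda>k. if k = j then 1 else 0 :: complex"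
    have "l2_inner p (\<lambda>x. \<Sum>k\<in>K n. ?e k * b n k x) = T (\<lambda>x. \<Sum>k\<in>K n. ?e k * b n k x)"
      by (rule p[THEN conjunct2, rule_format, OF eigenspace_sum])
    then have "(\<Sum>k\<in>K n. c k * cnj (?e k)) = (\<Sum>k\<in>K n. cnj (?e k) * a k)"
      unfolding c l2_inner_b_sum T .
    moreover have "(\<Sum>k\<in>K n. c k * cnj (?e k)) = (\<Sum>k\<in>K n. if k = j then c k else 0)"
      "(\<Sum>k\<in>K n. cnj (?e k) * a k) = (\<Sum>k\<in>K n. if k = j then a k else 0)"
      by (intro sum.cong refl; simp)+
    ultimately show ?thesis using j by simp
  qed
  then show "p = (\<lambda>x. \<Sum>k\<in>K n. a k * b n k x)" unfolding c by (simp add: fun_eq_iff)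
qed

lemma proj_eq:
  assumes p: "polyf p" and u: "\<And>x. x \<in> S2 \<Longrightarrow> u x = p x"
  shows "proj n u = (\<lambda>x. \<Sum>k\<in>K n. l2_inner p (B n k) * b n k x)"
  unfolding proj_def
proof (rule proj_dist_eq)
  fix c
  have "l2_inner u (\<lambda>x. \<Sum>k\<in>K n. c k * b n k x) = l2_inner p (\<lambda>x. \<Sum>k\<in>K n. c k * B n k x)"
    using u by (intro l2_inner_cong) (auto simp: b_eq rs_def)
  also have "\<dots> = (\<Sum>k\<in>K n. cnj (c k) * l2_inner p (B n k))"
    using p by (intro l2_inner_sum_right) auto
  finally show "l2_inner u (\<lambda>x. \<Sum>k\<in>K n. c k * b n k x) = (\<Sum>k\<in>K n. cnj (c k) * l2_inner p (B n k))" .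
qed

text \<open>Paired with an element of one eigenspace, all other degrees of the random series give 0,
  so the \<open>suminf\<close> has a single term and no convergence question arises.\<close>

lemma proj_phi:
  "proj_dist n (phi \<alpha> b g \<omega>) = (\<lambda>x. \<Sum>k\<in>K n. of_real (lam n powr (-\<alpha>)) * g n k \<omega> * b n k x)"
proof (rule proj_dist_eq)
  fix c
  have 0: "(\<Sum>k\<in>K m. g m k \<omega> * l2_inner (b m k) (\<lambda>x. \<Sum>k\<in>K n. c k * b n k x)) = 0" if "m \<noteq> n" for m
  proof (intro sum.neutral ballI)
    fix k assume k: "k \<in> K m"
    have "l2_inner (b m k) (\<lambda>x. \<Sum>k\<in>K n. c k * b n k x) = l2_inner (B m k) (\<lambda>x. \<Sum>k\<in>K n. c k * B n k x)"
      using k by (intro l2_inner_cong) (auto simp: b_eq rs_def)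
    also have "\<dots> = (\<Sum>j\<in>K n. cnj (c j) * l2_inner (B m k) (B n j))"
      using k by (intro l2_inner_sum_right) auto
    also have "\<dots> = 0" using k that by (intro sum.neutral) (simp add: B_orthonormal)
    finally show "g m k \<omega> * l2_inner (b m k) (\<lambda>x. \<Sum>k\<in>K n. c k * b n k x) = 0" by simp
  qed
  have 1: "l2_inner (b n j) (\<lambda>x. \<Sum>k\<in>K n. c k * b n k x) = cnj (c j)" if j: "j \<in> K n" for j
  proof -
    have "l2_inner (b n j) (\<lambda>x. \<Sum>k\<in>K n. c k * b n k x) = (\<Sum>k\<in>K n. (if k = j then 1 else 0) * cnj (c k))"
      by (subst b_as_sum[OF j]) (rule l2_inner_b_sum)
    also have "\<dots> = (\<Sum>k\<in>K n. if k = j then cnj (c k) else 0)" by (intro sum.cong refl) simp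
    finally show ?thesis using j by simp
  qed
  have "phi \<alpha> b g \<omega> (\<lambda>x. \<Sum>k\<in>K n. c k * b n k x) =
    (\<Sum>m\<in>{n}. of_real (lam m powr (-\<alpha>)) * (\<Sum>k\<in>K m. g m k \<omega> * l2_inner (b m k) (\<lambda>x. \<Sum>k\<in>K n. c k * b n k x)))"
    unfolding phi_def by (rule suminf_finite) (simp_all add: 0)
  also have "\<dots> = of_real (lam n powr (-\<alpha>)) * (\<Sum>k\<in>K n. g n k \<omega> * cnj (c k))"
    using 1 by simp
  finally show "phi \<alpha> b g \<omega> (\<lambda>x. \<Sum>k\<in>K n. c k * b n k x)
    = (\<Sum>k\<in>K n. cnj (c k) * (of_real (lam n powr (-\<alpha>)) * g n k \<omega>))"
    by (simp add: sum_distrib_left mult_ac)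
qed

text \<open>The degree bound truncates the spectral series, since higher eigenspaces are orthogonal
  to \<open>p\<close>.\<close>

lemma propagator_eq:
  assumes p: "pf d p" and u: "\<And>x. x \<in> S2 \<Longrightarrow> u x = p x"
  shows "propagator t u x = (\<Sum>n\<le>d. phase t n * (\<Sum>k\<in>K n. l2_inner p (B n k) * b n k x))"
proof -
  have "propagator t u x = (\<Sum>n. phase t n * (\<Sum>k\<in>K n. l2_inner p (B n k) * b n k x))"
    unfolding propagator_def phase_def by (simp only: proj_eq[OF pf_polyf[OF p] u])
  also have "\<dots> = (\<Sum>n\<le>d. phase t n * (\<Sum>k\<in>K n. l2_inner p (B n k) * b n k x))"
    by (rule suminf_finite) (auto simp: l2_inner_low_degree[OF p])
  finally show ?thesis .
qed

lemma l2_norm_proj: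
  assumes p: "polyf p" and u: "\<And>x. x \<in> S2 \<Longrightarrow> u x = p x"
  shows "(l2_norm (proj n u))\<^sup>2 = (\<Sum>k\<in>K n. (cmod (l2_inner p (B n k)))\<^sup>2)"
proof -
  let ?q = "\<lambda>x. \<Sum>k\<in>K n. l2_inner p (B n k) * B n k x"
  have q: "polyf ?q" by auto
  have "(l2_norm (proj n u))\<^sup>2 = mean_square (proj n u)"
    by (simp add: l2_norm_def)
  also have "\<dots> = mean_square ?q"
  proof (intro Bochner_Integration.integral_cong refl)
    fix x assume "x \<in> space sphere_measure"
    moreover have "proj n u = (\<lambda>x. \<Sum>k\<in>K n. l2_inner p (B n k) * b n k x)"
      by (rule proj_eq[OF p u])
    ultimately have "proj n u x = ?q x"
      by (auto simp: b_eq rs_def intro!: sum.cong)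
    then show "(cmod (proj n u x))\<^sup>2 = (cmod (?q x))\<^sup>2" by simp
  qed
  finally have "complex_of_real ((l2_norm (proj n u))\<^sup>2) = l2_inner ?q ?q"
    using l2_inner_self[OF q] by simp
  also have "\<dots> = (\<Sum>k\<in>K n. l2_inner p (B n k) * cnj (l2_inner p (B n k)))"
    by (rule l2_inner_expansion) auto
  also have "\<dots> = of_real (\<Sum>k\<in>K n. (cmod (l2_inner p (B n k)))\<^sup>2)"
    unfolding of_real_sum complex_norm_square ..
  finally show ?thesis unfolding of_real_eq_iff .
qed

section \<open>Finite mode sums and the cubic nonlinearity\<close>

definition modes :: "real \<Rightarrow> (nat \<times> int) set" where
  "modes N = (SIGMA n:{n. lam n \<le> N}. K n)"

lemma finite_modes: "finite (modes N)"
  unfolding modes_def by (intro finite_SigmaI finite_lam_le) auto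

abbreviation BB :: "nat \<times> int \<Rightarrow> cfun" where
  "BB A \<equiv> B (fst A) (snd A)"

lemma modes_K: "A \<in> modes N \<Longrightarrow> snd A \<in> K (fst A)"
  by (auto simp: modes_def)

lemma polyf_BB: "A \<in> modes N \<Longrightarrow> polyf (BB A)"
  using modes_K polyf_B by blast

lemma BB_orthonormal:
  "A \<in> modes N \<Longrightarrow> k \<in> K n \<Longrightarrow> l2_inner (BB A) (B n k) = (if A = (n, k) then 1 else 0)"
  using B_orthonormal[OF modes_K] by (cases A) auto

lemma pf_modes: "A \<in> modes (real N) \<Longrightarrow> pf N (BB A)"
proof -
  assume A: "A \<in> modes (real N)"
  then have "lam (fst A) \<le> real N" by (auto simp: modes_def)
  then have "fst A \<le> N" using lam_ge[of "fst A"] by linarith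
  then show ?thesis using pf_B[OF modes_K[OF A]] pf_mono by blast
qed

lemma l2_inner_modes_sum:
  assumes k: "k \<in> K n"
  shows "l2_inner (\<lambda>x. \<Sum>A\<in>modes N. c A * BB A x) (B n k) = (if (n, k) \<in> modes N then c (n, k) else 0)"
proof -
  have "l2_inner (\<lambda>x. \<Sum>A\<in>modes N. c A * BB A x) (B n k) = (\<Sum>A\<in>modes N. l2_inner (\<lambda>x. c A * BB A x) (B n k))"
    using k by (intro l2_inner_sum_left polyf_intros polyf_BB polyf_B)
  also have "\<dots> = (\<Sum>A\<in>modes N. if A = (n, k) then c A else 0)"
    using k by (intro sum.cong refl) (simp only: l2_inner_cmult_left BB_orthonormal, simp)
  also have "\<dots> = (if (n, k) \<in> modes N then c (n, k) else 0)"
    using finite_modes by simp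
  finally show ?thesis .
qed

lemma modes_sum_nested:
  "(\<Sum>A\<in>modes N. f (fst A) (snd A)) = (\<Sum>n | lam n \<le> N. \<Sum>k\<in>K n. f n k)"
  unfolding modes_def by (subst sum.Sigma) (auto simp: finite_lam_le case_prod_beta)

lemma propagator_modes:
  assumes u: "\<And>x. x \<in> S2 \<Longrightarrow> u x = (\<Sum>A\<in>modes (real N). c A * BB A x)" and x: "x \<in> S2"
  shows "propagator t u x = (\<Sum>A\<in>modes (real N). phase t (fst A) * c A * BB A x)"
proof -
  let ?m = "modes (real N)"
  let ?p = "\<lambda>x. \<Sum>A\<in>?m. c A * BB A x"
  have p: "pf N ?p" by (intro pf_sum pf_cmult pf_modes)
  have sub: "{n. lam n \<le> real N} \<subseteq> {..N}"
  proof safe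
    fix n assume "lam n \<le> real N"
    then show "n \<le> N" using lam_ge[of n] by linarith
  qed
  have m: "(n, k) \<in> ?m \<longleftrightarrow> lam n \<le> real N" if "k \<in> K n" for n k using that by (auto simp: modes_def)
  have "propagator t u x = (\<Sum>n\<le>N. phase t n * (\<Sum>k\<in>K n. l2_inner ?p (B n k) * b n k x))"
    by (rule propagator_eq[OF p u])
  also have "\<dots> = (\<Sum>n\<le>N. if lam n \<le> real N then \<Sum>k\<in>K n. phase t n * c (n, k) * B n k x else 0)"
  proof (intro sum.cong refl)
    fix n
    have "(\<Sum>k\<in>K n. l2_inner ?p (B n k) * b n k x) = (\<Sum>k\<in>K n. (if lam n \<le> real N then c (n, k) else 0) * B n k x)"
      using x by (intro sum.cong refl) (simp add: l2_inner_modes_sum m b_eq rs_def)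
    then show "phase t n * (\<Sum>k\<in>K n. l2_inner ?p (B n k) * b n k x) =
      (if lam n \<le> real N then \<Sum>k\<in>K n. phase t n * c (n, k) * B n k x else 0)"
      by (simp add: sum_distrib_left mult_ac)
  qed
  also have "\<dots> = (\<Sum>n | lam n \<le> real N. \<Sum>k\<in>K n. phase t n * c (n, k) * B n k x)"
    using sub by (subst sum.inter_filter[symmetric]) (auto intro!: sum.cong)
  also have "\<dots> = (\<Sum>A\<in>?m. phase t (fst A) * c A * BB A x)"
    using modes_sum_nested[of "\<lambda>n k. phase t n * c (n, k) * B n k x" "real N"] by simp
  finally show ?thesis .
qed

text \<open>Represents the Wick cubic of a finite mode sum by a genuine polynomial on
  \<open>R3\<close>, with the mass written in coefficients by Parseval; its degree bound makes
  \<open>propagator_eq\<close> applicable.\<close>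

definition wick_poly :: "(nat \<times> int) set \<Rightarrow> (nat \<times> int \<Rightarrow> complex) \<Rightarrow> cfun" where
  "wick_poly m v x = (\<Sum>A\<in>m. \<Sum>C\<in>m. \<Sum>D\<in>m. v A * cnj (v C) * v D * (BB A x * cnj (BB C x) * BB D x))
     - of_real (2 * (\<Sum>A\<in>m. (cmod (v A))\<^sup>2)) * (\<Sum>A\<in>m. v A * BB A x)"

lemma wick_cubic_modes:
  assumes u: "\<And>x. x \<in> S2 \<Longrightarrow> u x = (\<Sum>A\<in>modes N. v A * BB A x)" and x: "x \<in> S2"
  shows "wick_cubic u x = wick_poly (modes N) v x"
proof -
  let ?m = "modes N"
  let ?p = "\<lambda>x. \<Sum>A\<in>?m. v A * BB A x"
  have p: "polyf ?p" by (intro polyf_sum polyf_intros polyf_BB)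
  have "(l2_norm u)\<^sup>2 = mean_square ?p"
  proof -
    have "mean_square u = mean_square ?p"
      using u by (intro Bochner_Integration.integral_cong) auto
    then show ?thesis by (simp add: l2_norm_def)
  qed
  then have "complex_of_real ((l2_norm u)\<^sup>2) = l2_inner ?p ?p"
    using l2_inner_self[OF p] by simp
  also have "\<dots> = (\<Sum>A\<in>?m. cnj (v A) * l2_inner ?p (BB A))"
    using p by (intro l2_inner_sum_right polyf_BB)
  also have "\<dots> = (\<Sum>A\<in>?m. cnj (v A) * v A)"
  proof (intro sum.cong refl arg_cong2[where f = "(*)"])
    fix A assume A: "A \<in> ?m"
    show "l2_inner ?p (BB A) = v A"
      using A by (subst l2_inner_modes_sum[OF modes_K[OF A]]) simp
  qed
  also have "\<dots> = of_real (\<Sum>A\<in>?m. (cmod (v A))\<^sup>2)"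
    unfolding of_real_sum complex_norm_square by (simp add: mult.commute)
  finally have l2: "(l2_norm u)\<^sup>2 = (\<Sum>A\<in>?m. (cmod (v A))\<^sup>2)" unfolding of_real_eq_iff .
  have "complex_of_real ((cmod (?p x))\<^sup>2) * ?p x = ?p x * cnj (?p x) * ?p x"
    unfolding complex_norm_square ..
  also have "\<dots> = (\<Sum>A\<in>?m. \<Sum>C\<in>?m. \<Sum>D\<in>?m. v A * cnj (v C) * v D * (BB A x * cnj (BB C x) * BB D x))"
    unfolding cnj_sum triple_sum by (intro sum.cong refl) (simp add: mult_ac)
  finally show ?thesis
    by (simp add: wick_cubic_def wick_poly_def u[OF x] l2 left_diff_distrib)
qed

lemma pf_wick_poly: "pf (N + N + N) (wick_poly (modes (real N)) v)"
proof -
  have 1: "pf (N + N + N) (\<lambda>x. BB A x * cnj (BB C x) * BB D x)"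
    if "A \<in> modes (real N)" "C \<in> modes (real N)" "D \<in> modes (real N)" for A C D
    using that by (intro pf_mult pf_cnj pf_modes)
  have 2: "pf (N + N + N) (BB A)" if "A \<in> modes (real N)" for A
    using pf_mono[OF pf_modes[OF that]] by simp
  show ?thesis
    unfolding wick_poly_def[abs_def] by (intro pf_diff pf_sum pf_cmult 1 2)
qed

definition quartic :: "nat \<times> int \<Rightarrow> nat \<times> int \<Rightarrow> nat \<times> int \<Rightarrow> nat \<Rightarrow> int \<Rightarrow> complex" where
  "quartic A C D n k = l2_inner (\<lambda>x. BB A x * cnj (BB C x) * BB D x) (B n k)"

lemma l2_inner_wick_poly:
  assumes k: "k \<in> K n"
  shows "l2_inner (wick_poly (modes N) v) (B n k) =
    (\<Sum>A\<in>modes N. \<Sum>C\<in>modes N. \<Sum>D\<in>modes N. v A * cnj (v C) * v D * quartic A C D n k)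
     - of_real (2 * (\<Sum>A\<in>modes N. (cmod (v A))\<^sup>2)) * (if (n, k) \<in> modes N then v (n, k) else 0)"
proof -
  let ?m = "modes N"
  let ?t = "\<lambda>A C D x. v A * cnj (v C) * v D * (BB A x * cnj (BB C x) * BB D x)"
  have t: "polyf (?t A C D)" if "A \<in> ?m" "C \<in> ?m" "D \<in> ?m" for A C D
    using that by (intro polyf_intros polyf_BB)
  have q: "polyf (\<lambda>x. \<Sum>A\<in>?m. v A * BB A x)" by (intro polyf_sum polyf_intros polyf_BB)
  have "l2_inner (wick_poly ?m v) (B n k) =
    l2_inner (\<lambda>x. \<Sum>A\<in>?m. \<Sum>C\<in>?m. \<Sum>D\<in>?m. ?t A C D x) (B n k)
    - l2_inner (\<lambda>x. of_real (2 * (\<Sum>A\<in>?m. (cmod (v A))\<^sup>2)) * (\<Sum>A\<in>?m. v A * BB A x)) (B n k)"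
    unfolding wick_poly_def[abs_def] using k
    by (intro l2_inner_diff_left polyf_sum t polyf_intros(5)[OF polyf_intros(1) q] polyf_B)
  also have "l2_inner (\<lambda>x. \<Sum>A\<in>?m. \<Sum>C\<in>?m. \<Sum>D\<in>?m. ?t A C D x) (B n k)
    = (\<Sum>A\<in>?m. l2_inner (\<lambda>x. \<Sum>C\<in>?m. \<Sum>D\<in>?m. ?t A C D x) (B n k))"
    using k by (intro l2_inner_sum_left polyf_sum t polyf_B)
  also have "\<dots> = (\<Sum>A\<in>?m. \<Sum>C\<in>?m. l2_inner (\<lambda>x. \<Sum>D\<in>?m. ?t A C D x) (B n k))"
    using k by (intro sum.cong refl l2_inner_sum_left polyf_sum t polyf_B)
  also have "\<dots> = (\<Sum>A\<in>?m. \<Sum>C\<in>?m. \<Sum>D\<in>?m. l2_inner (?t A C D) (B n k))"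
    using k by (intro sum.cong refl l2_inner_sum_left t polyf_B)
  finally show ?thesis
    by (simp only: l2_inner_cmult_left quartic_def l2_inner_modes_sum[OF k])
qed

text \<open>Coefficient of \<open>b n k\<close> in the second Picard iteration of \<open>\<Sum>A\<in>modes N. c A b\<^sub>A\<close>.\<close>

definition picard_coeff :: "real \<Rightarrow> real \<Rightarrow> (nat \<times> int \<Rightarrow> complex) \<Rightarrow> nat \<Rightarrow> int \<Rightarrow> complex" where
  "picard_coeff N t c n k = - \<i> *
    ((\<Sum>A\<in>modes N. \<Sum>C\<in>modes N. \<Sum>D\<in>modes N. c A * cnj (c C) * c D * quartic A C D n k *
        tint t (\<lambda>s. phase (t - s) n * (phase s (fst A) * cnj (phase s (fst C)) * phase s (fst D))))
     - of_real (2 * (\<Sum>A\<in>modes N. (cmod (c A))\<^sup>2)) *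
        (if (n, k) \<in> modes N then c (n, k) else 0) * (of_real t * phase t n))"

text \<open>Phases have modulus one, so the mass is constant in time, and \<open>phase_diff\<close>
  removes \<open>s\<close> from the Wick term, whose time integral is therefore just a factor
  \<open>t\<close>.\<close>

lemma tint_wick:
  assumes k: "k \<in> K n"
  shows "- \<i> * tint t (\<lambda>s. phase (t - s) n * l2_inner (wick_poly (modes N) (\<lambda>A. phase s (fst A) * c A)) (B n k))
    = picard_coeff N t c n k"
proof -
  let ?m = "modes N"
  define \<xi> where "\<xi> = (if (n, k) \<in> ?m then c (n, k) else 0)"
  define S where "S = complex_of_real (2 * (\<Sum>A\<in>?m. (cmod (c A))\<^sup>2)) * \<xi>"
  let ?h = "\<lambda>A C D s. phase (t - s) n * (phase s (fst A) * cnj (phase s (fst C)) * phase s (fst D))"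
  have h: "continuous_on UNIV (\<lambda>s. e * ?h A C D s)" for e A C D by (intro continuous_intros)
  have "phase (t - s) n * l2_inner (wick_poly ?m (\<lambda>A. phase s (fst A) * c A)) (B n k)
    = (\<Sum>A\<in>?m. \<Sum>C\<in>?m. \<Sum>D\<in>?m. (c A * cnj (c C) * c D * quartic A C D n k) * ?h A C D s) - S * phase t n" for s
  proof -
    have "(if (n, k) \<in> ?m then phase s (fst (n, k)) * c (n, k) else 0) = phase s n * \<xi>"
      by (simp add: \<xi>_def)
    then have "l2_inner (wick_poly ?m (\<lambda>A. phase s (fst A) * c A)) (B n k)
      = (\<Sum>A\<in>?m. \<Sum>C\<in>?m. \<Sum>D\<in>?m. (phase s (fst A) * c A) * cnj (phase s (fst C) * c C) *
          (phase s (fst D) * c D) * quartic A C D n k) - S * phase s n"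
      unfolding l2_inner_wick_poly[OF k] norm_mult cmod_phase mult_1 by (simp add: S_def mult_ac)
    moreover have "phase (t - s) n * (S * phase s n) = S * phase t n"
      unfolding phase_diff[symmetric, of t n s] by (simp only: mult_ac)
    ultimately show ?thesis
      by (simp add: right_diff_distrib sum_distrib_left mult_ac)
  qed
  then have "tint t (\<lambda>s. phase (t - s) n * l2_inner (wick_poly ?m (\<lambda>A. phase s (fst A) * c A)) (B n k))
    = tint t (\<lambda>s. (\<Sum>A\<in>?m. \<Sum>C\<in>?m. \<Sum>D\<in>?m. (c A * cnj (c C) * c D * quartic A C D n k) * ?h A C D s)) - tint t (\<lambda>s. S * phase t n)"
    using h by (simp only:) (intro tint_diff continuous_on_sum continuous_on_const)
  also have "tint t (\<lambda>s. (\<Sum>A\<in>?m. \<Sum>C\<in>?m. \<Sum>D\<in>?m. (c A * cnj (c C) * c D * quartic A C D n k) * ?h A C D s))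
    = (\<Sum>A\<in>?m. \<Sum>C\<in>?m. \<Sum>D\<in>?m. (c A * cnj (c C) * c D * quartic A C D n k) * tint t (?h A C D))"
  proof -
    let ?e = "\<lambda>A C D. c A * cnj (c C) * c D * quartic A C D n k"
    have "tint t (\<lambda>s. \<Sum>A\<in>?m. \<Sum>C\<in>?m. \<Sum>D\<in>?m. ?e A C D * ?h A C D s)
        = (\<Sum>A\<in>?m. tint t (\<lambda>s. \<Sum>C\<in>?m. \<Sum>D\<in>?m. ?e A C D * ?h A C D s))"
      by (intro tint_sum continuous_on_sum h)
    also have "\<dots> = (\<Sum>A\<in>?m. \<Sum>C\<in>?m. tint t (\<lambda>s. \<Sum>D\<in>?m. ?e A C D * ?h A C D s))"
      by (intro sum.cong refl tint_sum continuous_on_sum h)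
    also have "\<dots> = (\<Sum>A\<in>?m. \<Sum>C\<in>?m. \<Sum>D\<in>?m. tint t (\<lambda>s. ?e A C D * ?h A C D s))"
      by (intro sum.cong refl tint_sum h)
    finally show ?thesis unfolding tint_cmult .
  qed
  finally show ?thesis by (simp add: picard_coeff_def tint_const S_def \<xi>_def mult_ac)
qed

lemma picard2_modes:
  fixes N :: nat
  assumes u: "\<And>x. x \<in> S2 \<Longrightarrow> u x = (\<Sum>A\<in>modes (real N). c A * BB A x)" and x: "x \<in> S2"
  shows "picard2 t u x = (\<Sum>n\<le>N + N + N. \<Sum>k\<in>K n. picard_coeff (real N) t c n k * B n k x)"
proof -
  let ?m = "modes (real N)"
  let ?v = "\<lambda>s A. phase s (fst A) * c A"
  have w: "wick_cubic (propagator s u) x = wick_poly ?m (?v s) x" if "x \<in> S2" for s x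
    using propagator_modes[OF u] that by (intro wick_cubic_modes)
  let ?h = "\<lambda>n k s. phase (t - s) n * l2_inner (wick_poly ?m (?v s)) (B n k)"
  \<comment> \<open>Continuity in \<open>s\<close> supplies the integrability for moving the time
    integral through the finite sums.\<close>
  have h: "continuous_on UNIV (\<lambda>s. e * ?h n k s)" if "k \<in> K n" for n k e
    unfolding l2_inner_wick_poly[OF that] norm_mult cmod_phase
    by (cases "(n, k) \<in> ?m"; simp only: if_True if_False; intro continuous_intros)
  have "propagator (t - s) (wick_cubic (propagator s u)) x = (\<Sum>n\<le>N + N + N. \<Sum>k\<in>K n. b n k x * ?h n k s)" for s
  proof -
    have "propagator (t - s) (wick_cubic (propagator s u)) x = (\<Sum>n\<le>N + N + N. phase (t - s) n *
        (\<Sum>k\<in>K n. l2_inner (wick_poly ?m (?v s)) (B n k) * b n k x))"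
      by (rule propagator_eq[OF pf_wick_poly w])
    then show ?thesis by (simp add: sum_distrib_left mult_ac)
  qed
  then have "picard2 t u x = - \<i> * tint t (\<lambda>s. \<Sum>n\<le>N + N + N. \<Sum>k\<in>K n. b n k x * ?h n k s)"
    by (simp add: picard2_def tint_def)
  also have "tint t (\<lambda>s. \<Sum>n\<le>N + N + N. \<Sum>k\<in>K n. b n k x * ?h n k s)
     = (\<Sum>n\<le>N + N + N. tint t (\<lambda>s. \<Sum>k\<in>K n. b n k x * ?h n k s))"
    by (intro tint_sum continuous_on_sum h)
  also have "\<dots> = (\<Sum>n\<le>N + N + N. \<Sum>k\<in>K n. tint t (\<lambda>s. b n k x * ?h n k s))"
    by (intro sum.cong refl tint_sum h)
  finally show ?thesis
    unfolding tint_cmult sum_distrib_left using x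
    by (simp add: tint_wick[symmetric] b_eq rs_def mult_ac)
qed

lemma P_le_phi:
  assumes x: "x \<in> S2"
  shows "P_le N (phi \<alpha> b g \<omega>) x =
    (\<Sum>A\<in>modes N. of_real (lam (fst A) powr (-\<alpha>)) * g (fst A) (snd A) \<omega> * BB A x)"
  unfolding modes_sum_nested[of "\<lambda>n k. of_real (lam n powr (-\<alpha>)) * g n k \<omega> * B n k x"] P_le_def proj_phi
  using x by (intro sum.cong refl) (simp add: b_eq rs_def)

lemma l2_norm_proj_picard2:
  fixes N n :: nat
  assumes "n \<le> N"
  shows "(l2_norm (proj n (picard2 t (P_le (real N) (phi \<alpha> b g \<omega>)))))\<^sup>2 =
    (\<Sum>k\<in>K n. (cmod (picard_coeff (real N) t
        (\<lambda>A. of_real (lam (fst A) powr (-\<alpha>)) * g (fst A) (snd A) \<omega>) n k))\<^sup>2)"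
proof -
  define a where "a = picard_coeff (real N) t (\<lambda>A. of_real (lam (fst A) powr (-\<alpha>)) * g (fst A) (snd A) \<omega>)"
  let ?p = "\<lambda>x. \<Sum>m\<le>N + N + N. \<Sum>k\<in>K m. a m k * B m k x"
  have p: "polyf ?p" by (intro polyf_sum polyf_intros polyf_B)
  have "l2_inner ?p (B n k) = a n k" if k: "k \<in> K n" for k
  proof -
    have "l2_inner ?p (B n k) = (\<Sum>m\<le>N + N + N. \<Sum>j\<in>K m. a m j * l2_inner (B m j) (B n k))"
    proof (subst l2_inner_sum_left)
      show "(\<Sum>m\<le>N + N + N. l2_inner (\<lambda>x. \<Sum>j\<in>K m. a m j * B m j x) (B n k))
        = (\<Sum>m\<le>N + N + N. \<Sum>j\<in>K m. a m j * l2_inner (B m j) (B n k))"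
        using k by (intro sum.cong refl, subst l2_inner_sum_left) (auto simp: l2_inner_cmult_left)
    qed (use k in auto)
    also have "\<dots> = (\<Sum>m\<le>N + N + N. \<Sum>j\<in>K m. if n = m \<and> j = k then a n k else 0)"
      using k by (intro sum.cong refl) (auto simp: B_orthonormal)
    also have "\<dots> = (\<Sum>m\<le>N + N + N. if m = n then a n k else 0)"
      using k by (intro sum.cong refl) auto
    finally show ?thesis using assms by simp
  qed
  moreover have "picard2 t (P_le (real N) (phi \<alpha> b g \<omega>)) x = ?p x" if "x \<in> S2" for x
    unfolding a_def by (rule picard2_modes[OF _ that]) (rule P_le_phi)
  then have "(l2_norm (proj n (picard2 t (P_le (real N) (phi \<alpha> b g \<omega>)))))\<^sup>2 =
      (\<Sum>k\<in>K n. (cmod (l2_inner ?p (B n k)))\<^sup>2)"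
    by (rule l2_norm_proj[OF p])
  ultimately show ?thesis by (simp add: a_def)
qed

end

section \<open>Gaussian moments\<close>

context prob_space
begin

lemma std_normal_integral_power:
  assumes "distributed M lborel X std_normal_density"
  shows "integrable M (\<lambda>x. X x ^ k)" "integrable M (\<lambda>x. \<bar>X x\<bar> ^ k)"
    and "expectation (\<lambda>x. X x ^ (2 * k)) = fact (2 * k) / (2 ^ k * fact k)"
proof -
  show "integrable M (\<lambda>x. X x ^ k)"
    using distributed_integrable[OF assms, of "\<lambda>x. x ^ k"] integrable_std_normal_moment[of k] by simp
  show "integrable M (\<lambda>x. \<bar>X x\<bar> ^ k)"
    using distributed_integrable[OF assms, of "\<lambda>x. \<bar>x\<bar> ^ k"] integrable_std_normal_moment_abs[of k] by simp
  show "expectation (\<lambda>x. X x ^ (2 * k)) = fact (2 * k) / (2 ^ k * fact k)"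
    using distributed_integral[OF assms, of "\<lambda>x. x ^ (2 * k)"] integral_std_normal_moment_even[of k] by simp
qed

lemma std_complex_gaussian_measurable:
  assumes "std_complex_gaussian M X"
  shows "X \<in> borel_measurable M"
proof -
  obtain G H where *: "distributed M lborel G std_normal_density" "distributed M lborel H std_normal_density"
    "X = (\<lambda>x. of_real (1 / sqrt 2) * (of_real (G x) + \<i> * of_real (H x)))"
    using assms unfolding std_complex_gaussian_def by blast
  have [measurable]: "G \<in> borel_measurable M" "H \<in> borel_measurable M"
    using distributed_measurable[OF *(1)] distributed_measurable[OF *(2)] by simp_all
  show ?thesis unfolding *(3) by measurable
qed

lemma std_complex_gaussian_cmod_square:
  fixes G H :: real
  assumes "z = of_real (1 / sqrt 2) * (of_real G + \<i> * of_real H)"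
  shows "(cmod z)\<^sup>2 = (G\<^sup>2 + H\<^sup>2) / 2"
  unfolding assms by (simp add: cmod_power2 power_divide add_divide_distrib)

lemma std_complex_gaussian_integrable:
  assumes "std_complex_gaussian M X"
  shows "integrable M (\<lambda>x. cmod (X x) ^ k)"
proof -
  obtain G H where *: "distributed M lborel G std_normal_density" "distributed M lborel H std_normal_density"
    "X = (\<lambda>x. of_real (1 / sqrt 2) * (of_real (G x) + \<i> * of_real (H x)))"
    using assms unfolding std_complex_gaussian_def by blast
  have [measurable]: "X \<in> borel_measurable M" using assms by (rule std_complex_gaussian_measurable)
  show ?thesis
  proof (rule Bochner_Integration.integrable_bound)
    show "integrable M (\<lambda>x. 2 ^ k * (\<bar>G x\<bar> ^ k + \<bar>H x\<bar> ^ k))"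
      using std_normal_integral_power(2)[OF *(1)] std_normal_integral_power(2)[OF *(2)] by auto
    show "AE x in M. norm (cmod (X x) ^ k) \<le> norm (2 ^ k * (\<bar>G x\<bar> ^ k + \<bar>H x\<bar> ^ k))"
    proof (rule AE_I2)
      fix x
      define m where "m = max \<bar>G x\<bar> \<bar>H x\<bar>"
      have "cmod (X x) \<le> 1 * (\<bar>G x\<bar> + \<bar>H x\<bar>)"
        unfolding *(3) norm_mult norm_of_real
        by (intro mult_mono order_trans[OF norm_triangle_ineq]) (simp_all add: norm_mult)
      also have "\<dots> \<le> 2 * m" by (simp add: m_def)
      finally have "cmod (X x) ^ k \<le> (2 * m) ^ k" by (rule power_mono) simp
      also have "\<dots> = 2 ^ k * m ^ k" by (rule power_mult_distrib)
      also have "\<dots> \<le> 2 ^ k * (\<bar>G x\<bar> ^ k + \<bar>H x\<bar> ^ k)"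
        by (intro mult_left_mono) (auto simp: m_def max_def)
      finally show "norm (cmod (X x) ^ k) \<le> norm (2 ^ k * (\<bar>G x\<bar> ^ k + \<bar>H x\<bar> ^ k))"
        by simp
    qed
  qed measurable
qed

lemma std_complex_gaussian_moments:
  assumes "std_complex_gaussian M X"
  shows "expectation (\<lambda>x. (cmod (X x))\<^sup>2) = 1" "expectation (\<lambda>x. (cmod (X x)) ^ 4) = 2"
proof -
  obtain G H where *: "distributed M lborel G std_normal_density" "distributed M lborel H std_normal_density"
    "indep_var borel G borel H"
    "X = (\<lambda>x. of_real (1 / sqrt 2) * (of_real (G x) + \<i> * of_real (H x)))"
    using assms unfolding std_complex_gaussian_def by blast
  note G = std_normal_integral_power[OF *(1)] and H = std_normal_integral_power[OF *(2)]
  have X2: "(cmod (X x))\<^sup>2 = ((G x)\<^sup>2 + (H x)\<^sup>2) / 2" for x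
    by (rule std_complex_gaussian_cmod_square) (simp add: *(4))
  have m: "expectation (\<lambda>x. (G x)\<^sup>2) = 1" "expectation (\<lambda>x. (H x)\<^sup>2) = 1"
    "expectation (\<lambda>x. G x ^ 4) = 3" "expectation (\<lambda>x. H x ^ 4) = 3"
    using G(3)[of 1] H(3)[of 1] G(3)[of 2] H(3)[of 2] by (simp_all add: fact_numeral)
  show "expectation (\<lambda>x. (cmod (X x))\<^sup>2) = 1"
    unfolding X2 using G(1)[of 2] H(1)[of 2] m by simp
  have "indep_var borel ((\<lambda>x. x\<^sup>2) \<circ> G) borel ((\<lambda>x. x\<^sup>2) \<circ> H)"
    by (rule indep_var_compose[OF *(3)]) measurable
  then have iv: "indep_var borel (\<lambda>x. (G x)\<^sup>2) borel (\<lambda>x. (H x)\<^sup>2)" by (simp add: o_def)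
  have GH: "integrable M (\<lambda>x. (G x)\<^sup>2 * (H x)\<^sup>2)" "expectation (\<lambda>x. (G x)\<^sup>2 * (H x)\<^sup>2) = 1"
    using indep_var_integrable[OF iv G(1) H(1)] indep_var_lebesgue_integral[OF iv G(1) H(1)] m by simp_all
  have X4: "cmod (X x) ^ 4 = (G x ^ 4 + 2 * ((G x)\<^sup>2 * (H x)\<^sup>2) + H x ^ 4) / 4" for x
  proof -
    have "cmod (X x) ^ 4 = ((cmod (X x))\<^sup>2)\<^sup>2" by simp
    then show ?thesis unfolding X2 by (simp add: power2_eq_square power4_eq_xxxx field_simps)
  qed
  show "expectation (\<lambda>x. (cmod (X x)) ^ 4) = 2"
    unfolding X4 using G(1)[of 4] H(1)[of 4] m GH by simp
qed

text \<open>Invariance under the quarter turn \<open>z \<mapsto> i z\<close> suffices to kill all unbalanced moments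
  of low degree.\<close>

lemma std_complex_gaussian_quarter_turn:
  assumes X: "std_complex_gaussian M X" and h [measurable]: "h \<in> borel_measurable borel"
  shows "expectation (\<lambda>x. h (X x) :: complex) = expectation (\<lambda>x. h (\<i> * X x))"
proof -
  obtain G H where *: "distributed M lborel G std_normal_density" "distributed M lborel H std_normal_density"
    "indep_var borel G borel H"
    "X = (\<lambda>x. of_real (1 / sqrt 2) * (of_real (G x) + \<i> * of_real (H x)))"
    using X unfolding std_complex_gaussian_def by blast
  have [measurable]: "G \<in> borel_measurable M" "H \<in> borel_measurable M"
    using distributed_measurable[OF *(1)] distributed_measurable[OF *(2)] by simp_all
  define \<nu> where "\<nu> = distr M borel G"
  have law: "distr M borel Y = density lborel std_normal_density"
    if "distributed M lborel Y std_normal_density" for Y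
  proof -
    have "distr M borel Y = distr M lborel Y" by (rule distr_cong) simp_all
    then show ?thesis using distributed_distr_eq_density[OF that] by simp
  qed
  have H: "distr M borel H = \<nu>" unfolding \<nu>_def law[OF *(1)] law[OF *(2)] ..
  have neg: "distr \<nu> borel uminus = \<nu>"
  proof -
    have "distributed M lborel (\<lambda>x. 0 + (-1) * G x) (normal_density (0 + (-1) * 0) (\<bar>-1\<bar> * 1))"
      by (rule normal_density_affine[OF *(1)]) simp_all
    then have "distributed M lborel (\<lambda>x. - G x) std_normal_density" by simp
    from law[OF this] have "distr M borel (\<lambda>x. - G x) = \<nu>" by (simp add: \<nu>_def law[OF *(1)])
    moreover have "distr \<nu> borel uminus = distr M borel (\<lambda>x. - G x)"
      unfolding \<nu>_def by (subst distr_distr) (simp_all add: o_def)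
    ultimately show ?thesis by simp
  qed
  interpret N: prob_space \<nu> unfolding \<nu>_def by (rule prob_space_distr) measurable
  interpret NN: pair_sigma_finite \<nu> \<nu> ..
  have sets_\<nu> [measurable_cong]: "sets \<nu> = sets borel" by (simp add: \<nu>_def)
  have joint: "distr M (borel \<Otimes>\<^sub>M borel) (\<lambda>x. (G x, H x)) = \<nu> \<Otimes>\<^sub>M \<nu>"
    using *(3) unfolding indep_var_distribution_eq H \<nu>_def[symmetric] by simp
  \<comment> \<open>Multiplication by i on pairs of real and imaginary part. It preserves the
    product law because each factor is symmetric under a change of sign and the product under
    exchange of the coordinates.\<close>
  define r where "r = (\<lambda>(a, b). (- b, a) :: real \<times> real)"
  have "\<nu> \<Otimes>\<^sub>M \<nu> = distr \<nu> borel uminus \<Otimes>\<^sub>M distr \<nu> borel (\<lambda>x. x)"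
    unfolding neg by (simp add: distr_id2 sets_\<nu>)
  also have "\<dots> = distr (\<nu> \<Otimes>\<^sub>M \<nu>) (borel \<Otimes>\<^sub>M borel) (\<lambda>(x, y). (- x, y))"
  proof (rule pair_measure_distr)
    show "sigma_finite_measure (distr \<nu> borel (\<lambda>x. x))"
      using N.sigma_finite_measure_axioms by (simp add: distr_id2 sets_\<nu>)
  qed measurable
  also have "\<dots> = distr (distr (\<nu> \<Otimes>\<^sub>M \<nu>) (\<nu> \<Otimes>\<^sub>M \<nu>) (\<lambda>(x, y). (y, x))) (borel \<Otimes>\<^sub>M borel) (\<lambda>(x, y). (- x, y))"
    using NN.distr_pair_swap by simp
  also have "\<dots> = distr (\<nu> \<Otimes>\<^sub>M \<nu>) (borel \<Otimes>\<^sub>M borel) r"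
    by (subst distr_distr) (simp_all add: r_def o_def case_prod_unfold)
  finally have r: "distr (\<nu> \<Otimes>\<^sub>M \<nu>) (borel \<Otimes>\<^sub>M borel) r = \<nu> \<Otimes>\<^sub>M \<nu>" by simp
  define \<phi> where "\<phi> = (\<lambda>(a, b). complex_of_real (1 / sqrt 2) * (of_real a + \<i> * of_real b))"
  have [measurable]: "\<phi> \<in> borel_measurable (borel \<Otimes>\<^sub>M borel)" unfolding \<phi>_def by measurable
  have [measurable]: "r \<in> measurable (borel \<Otimes>\<^sub>M borel) (borel \<Otimes>\<^sub>M borel)" unfolding r_def by measurable
  have E: "expectation (\<lambda>x. k (G x, H x)) = integral\<^sup>L (\<nu> \<Otimes>\<^sub>M \<nu>) k"
    if [measurable]: "k \<in> borel_measurable (borel \<Otimes>\<^sub>M borel)" for k :: "_ \<Rightarrow> complex"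
  proof -
    have "(\<lambda>x. (G x, H x)) \<in> measurable M (borel \<Otimes>\<^sub>M borel)" by measurable
    from integral_distr[OF this that] show ?thesis unfolding joint by simp
  qed
  have "expectation (\<lambda>x. h (\<i> * X x)) = expectation (\<lambda>x. h (\<phi> (r (G x, H x))))"
  proof -
    have "\<i> * X x = \<phi> (r (G x, H x))" for x
      by (simp add: *(4) \<phi>_def r_def field_simps)
    then show ?thesis by simp
  qed
  also have "\<dots> = integral\<^sup>L (\<nu> \<Otimes>\<^sub>M \<nu>) (\<lambda>z. h (\<phi> (r z)))" by (rule E) measurable
  also have "\<dots> = integral\<^sup>L (distr (\<nu> \<Otimes>\<^sub>M \<nu>) (borel \<Otimes>\<^sub>M borel) r) (\<lambda>z. h (\<phi> z))"
    by (subst integral_distr) simp_all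
  also have "\<dots> = integral\<^sup>L (\<nu> \<Otimes>\<^sub>M \<nu>) (\<lambda>z. h (\<phi> z))" unfolding r ..
  also have "\<dots> = expectation (\<lambda>x. h (\<phi> (G x, H x)))" by (rule E[symmetric]) measurable
  also have "\<dots> = expectation (\<lambda>x. h (X x))" by (simp add: *(4) \<phi>_def)
  finally show ?thesis by simp
qed

text \<open>The inequality \<open>|Z|\<^sup>2 \<ge> 2 Re (Z cnj Y) - |Y|\<^sup>2\<close> avoids any square integrability of \<open>Z\<close>.\<close>

lemma bessel_nn_integral:
  fixes Z :: "'a \<Rightarrow> complex" and X :: "'j \<Rightarrow> 'a \<Rightarrow> complex"
  assumes J: "finite J"
    and ZX: "\<And>j. j \<in> J \<Longrightarrow> has_bochner_integral M (\<lambda>x. Z x * cnj (X j x)) (c j)"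
    and XX: "\<And>i j. i \<in> J \<Longrightarrow> j \<in> J \<Longrightarrow>
      has_bochner_integral M (\<lambda>x. X i x * cnj (X j x)) (if i = j then 1 else 0)"
  shows "ennreal (\<Sum>j\<in>J. (cmod (c j))\<^sup>2) \<le> (\<integral>\<^sup>+x. ennreal ((cmod (Z x))\<^sup>2) \<partial>M)"
proof -
  define Y where "Y x = (\<Sum>j\<in>J. c j * X j x)" for x
  define S where "S = (\<Sum>j\<in>J. (cmod (c j))\<^sup>2)"
  have cS: "(\<Sum>j\<in>J. cnj (c j) * c j) = of_real S"
    unfolding S_def of_real_sum complex_norm_square by (simp only: mult.commute)
  have "has_bochner_integral M (\<lambda>x. \<Sum>j\<in>J. cnj (c j) * (Z x * cnj (X j x))) (\<Sum>j\<in>J. cnj (c j) * c j)"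
    by (intro has_bochner_integral_sum has_bochner_integral_mult_right ZX)
  moreover have "(\<Sum>j\<in>J. cnj (c j) * (Z x * cnj (X j x))) = Z x * cnj (Y x)" for x
    by (simp add: Y_def sum_distrib_left mult_ac)
  ultimately have ZY: "has_bochner_integral M (\<lambda>x. Z x * cnj (Y x)) (of_real S)" by (simp add: cS)
  have "has_bochner_integral M (\<lambda>x. \<Sum>i\<in>J. \<Sum>j\<in>J. (cnj (c j) * c i) * (X i x * cnj (X j x)))
    (\<Sum>i\<in>J. \<Sum>j\<in>J. (cnj (c j) * c i) * (if i = j then 1 else 0))"
    by (intro has_bochner_integral_sum has_bochner_integral_mult_right XX)
  moreover have "(\<Sum>i\<in>J. \<Sum>j\<in>J. (cnj (c j) * c i) * (if i = j then 1 else 0)) = (\<Sum>i\<in>J. cnj (c i) * c i)"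
    using J by (intro sum.cong refl) (simp add: if_distrib cong: if_cong)
  moreover have "(\<Sum>i\<in>J. \<Sum>j\<in>J. (cnj (c j) * c i) * (X i x * cnj (X j x))) = Y x * cnj (Y x)" for x
    by (simp add: Y_def sum_product mult_ac)
  ultimately have YY: "has_bochner_integral M (\<lambda>x. Y x * cnj (Y x)) (of_real S)" by (simp only: cS)
  \<comment> \<open>The pointwise lower bound for |Z|^2; its expectation is 2 S - S = S.\<close>
  let ?h = "\<lambda>x. 2 * Re (Z x * cnj (Y x)) - Re (Y x * cnj (Y x))"
  have h: "has_bochner_integral M ?h (2 * Re (of_real S) - Re (of_real S))"
    by (intro has_bochner_integral_diff has_bochner_integral_mult_right has_bochner_integral_Re ZY YY)
  then have ih: "integrable M ?h" and eh: "expectation ?h = S"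
    by (simp_all only: has_bochner_integral_iff) simp
  have le: "?h x \<le> (cmod (Z x))\<^sup>2" for x
  proof -
    have "0 \<le> (cmod (Z x - Y x))\<^sup>2" by simp
    also have "(cmod (Z x - Y x))\<^sup>2 = (cmod (Z x))\<^sup>2 - ?h x"
      unfolding cmod_power2 by (simp add: power2_eq_square algebra_simps)
    finally show ?thesis by simp
  qed
  \<comment> \<open>\<open>?h\<close> may be negative whereas \<open>ennreal\<close> cuts off at 0,
    hence the detour through the positive part.\<close>
  have "S \<le> expectation (\<lambda>x. max 0 (?h x))"
    unfolding eh[symmetric] using ih by (intro integral_mono) auto
  then have "ennreal S \<le> ennreal (expectation (\<lambda>x. max 0 (?h x)))" by (rule ennreal_leI)
  also have "\<dots> = (\<integral>\<^sup>+x. ennreal (max 0 (?h x)) \<partial>M)"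
    using ih by (intro nn_integral_eq_integral[symmetric]) auto
  also have "\<dots> \<le> (\<integral>\<^sup>+x. ennreal ((cmod (Z x))\<^sup>2) \<partial>M)"
    using le by (intro nn_integral_mono ennreal_leI) auto
  finally show ?thesis by (simp add: S_def)
qed

end

text \<open>The factor of one variable in a cubic monomial times a conjugated test variable:
  \<open>p\<close> and \<open>q\<close> count its plain and conjugated occurrences, and
  \<open>w\<close> marks the index that carries |z|^2 - 1. Coincidences between indices thus become
  exponents, and independence applies to distinct variables.\<close>

definition gauss_factor :: "bool \<Rightarrow> nat \<Rightarrow> nat \<Rightarrow> complex \<Rightarrow> complex" where
  "gauss_factor w p q z = z ^ p * cnj z ^ q * (if w then of_real ((cmod z)\<^sup>2 - 1) else 1)"

lemma gauss_factor_measurable [measurable]: "gauss_factor w p q \<in> borel_measurable borel"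
proof -
  have "continuous_on UNIV (gauss_factor w p q)"
    unfolding gauss_factor_def by (cases w) (auto intro!: continuous_intros)
  then show ?thesis by (rule borel_measurable_continuous_onI)
qed

section \<open>Products of independent Gaussians\<close>

locale gaussian_family = prob_space M for M :: "'w measure" +
  fixes G :: "'i \<Rightarrow> 'w \<Rightarrow> complex" and I :: "'i set"
  assumes gauss: "A \<in> I \<Longrightarrow> std_complex_gaussian M (G A)"
    and indep: "indep_vars (\<lambda>_. borel) G I"
begin

lemma G_measurable [measurable]: "A \<in> I \<Longrightarrow> G A \<in> borel_measurable M"
  using gauss std_complex_gaussian_measurable by blast

lemma gauss_factor_integrable:
  assumes A: "A \<in> I"
  shows "integrable M (\<lambda>x. gauss_factor w p q (G A x))"
proof (rule Bochner_Integration.integrable_bound)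
  show "integrable M (\<lambda>x. cmod (G A x) ^ (p + q + 2) + cmod (G A x) ^ (p + q))"
    by (intro Bochner_Integration.integrable_add std_complex_gaussian_integrable[OF gauss[OF A]])
  show "(\<lambda>x. gauss_factor w p q (G A x)) \<in> borel_measurable M" using A by measurable
  show "AE x in M. norm (gauss_factor w p q (G A x)) \<le> norm (cmod (G A x) ^ (p + q + 2) + cmod (G A x) ^ (p + q))"
  proof (rule AE_I2)
    fix x
    let ?z = "G A x"
    have "norm (gauss_factor w p q ?z) = cmod ?z ^ (p + q) * norm (if w then complex_of_real ((cmod ?z)\<^sup>2 - 1) else 1)"
      by (simp add: gauss_factor_def norm_mult norm_power power_add)
    also have "\<dots> \<le> cmod ?z ^ (p + q) * ((cmod ?z)\<^sup>2 + 1)"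
    proof (intro mult_left_mono)
      have "\<bar>(cmod ?z)\<^sup>2 - 1\<bar> \<le> (cmod ?z)\<^sup>2 + 1" by (simp add: abs_le_iff)
      then show "norm (if w then complex_of_real ((cmod ?z)\<^sup>2 - 1) else 1) \<le> (cmod ?z)\<^sup>2 + 1"
        by (simp only: norm_of_real split: if_splits) auto
    qed simp
    also have "\<dots> = norm (cmod ?z ^ (p + q + 2) + cmod ?z ^ (p + q))"
      by (simp add: power_add power2_eq_square algebra_simps)
    finally show "norm (gauss_factor w p q ?z) \<le> norm (cmod ?z ^ (p + q + 2) + cmod ?z ^ (p + q))" .
  qed
qed

text \<open>A quarter turn multiplies the factor by i^(p - q), which is 1 only if 4 divides p - q;
  exponents of at most 2 exclude this for \<open>p \<noteq> q\<close>.\<close>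

lemma gauss_factor_expectation_0:
  assumes A: "A \<in> I" and "p \<noteq> q" "p \<le> 2" "q \<le> 2"
  shows "expectation (\<lambda>x. gauss_factor w p q (G A x)) = 0"
proof -
  define \<zeta> where "\<zeta> = \<i> ^ p * cnj \<i> ^ q"
  have "p \<in> {0, 1, 2}" "q \<in> {0, 1, 2}" using assms by auto
  then have \<zeta>: "\<zeta> \<noteq> 1" using \<open>p \<noteq> q\<close> by (auto simp: \<zeta>_def complex_eq_iff)
  have "gauss_factor w p q (\<i> * z) = \<zeta> * gauss_factor w p q z" for z
    unfolding gauss_factor_def \<zeta>_def complex_cnj_mult power_mult_distrib norm_mult by (simp add: mult_ac)
  then have "expectation (\<lambda>x. gauss_factor w p q (\<i> * G A x)) = \<zeta> * expectation (\<lambda>x. gauss_factor w p q (G A x))"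
    by (simp only: integral_mult_right_zero)
  with std_complex_gaussian_quarter_turn[OF gauss[OF A] gauss_factor_measurable]
  have "expectation (\<lambda>x. gauss_factor w p q (G A x)) = \<zeta> * expectation (\<lambda>x. gauss_factor w p q (G A x))"
    by (rule trans)
  then show ?thesis unfolding mult_cancel_right1 using \<zeta> by blast
qed

lemma gauss_factor_expectations:
  assumes A: "A \<in> I"
  shows "expectation (\<lambda>x. gauss_factor True 0 0 (G A x)) = 0"
    and "expectation (\<lambda>x. gauss_factor True 1 1 (G A x)) = 1"
    and "expectation (\<lambda>x. gauss_factor False 1 1 (G A x)) = 1"
proof -
  note m = std_complex_gaussian_moments[OF gauss[OF A]] and i = std_complex_gaussian_integrable[OF gauss[OF A]]
  have f: "gauss_factor True 0 0 z = of_real ((cmod z)\<^sup>2 - 1)"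
    "gauss_factor True 1 1 z = of_real (cmod z ^ 4 - (cmod z)\<^sup>2)"
    "gauss_factor False 1 1 z = of_real ((cmod z)\<^sup>2)" for z
    using complex_norm_square[of z]
    by (simp_all add: gauss_factor_def flip: of_real_mult) (simp add: algebra_simps power2_eq_square power4_eq_xxxx)
  show "expectation (\<lambda>x. gauss_factor True 0 0 (G A x)) = 0"
    unfolding f integral_complex_of_real using m i[of 2] by (simp add: prob_space)
  show "expectation (\<lambda>x. gauss_factor True 1 1 (G A x)) = 1"
    unfolding f integral_complex_of_real using m i[of 2] i[of 4] by simp
  show "expectation (\<lambda>x. gauss_factor False 1 1 (G A x)) = 1"
    unfolding f integral_complex_of_real using m by simp
qed

lemma gauss_product:
  assumes F: "finite F" "F \<subseteq> I"
  shows "has_bochner_integral M (\<lambda>x. \<Prod>v\<in>F. gauss_factor (w v) (p v) (q v) (G v x))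
      (\<Prod>v\<in>F. expectation (\<lambda>x. gauss_factor (w v) (p v) (q v) (G v x)))"
proof -
  have "indep_vars (\<lambda>_. borel) (\<lambda>v x. gauss_factor (w v) (p v) (q v) (G v x)) F"
    by (rule indep_vars_compose2[OF indep_vars_subset[OF indep F(2)]]) measurable
  moreover have "integrable M (\<lambda>x. gauss_factor (w v) (p v) (q v) (G v x))" if "v \<in> F" for v
    using that F by (intro gauss_factor_integrable) auto
  ultimately show ?thesis
    unfolding has_bochner_integral_iff
    using indep_vars_integrable[OF F(1)] indep_vars_lebesgue_integral[OF F(1)] by blast
qed

definition test_var :: "'i \<Rightarrow> 'i \<Rightarrow> 'w \<Rightarrow> complex" where
  "test_var r l x = of_real ((cmod (G r x))\<^sup>2 - 1) * G l x"

lemma prod_power_indicator: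
  assumes "finite F" "A \<in> F"
  shows "(\<Prod>v\<in>F. (z v :: complex) ^ of_bool (A = v)) = z A"
proof -
  have "(\<Prod>v\<in>F. z v ^ of_bool (A = v)) = (\<Prod>v\<in>F. if A = v then z v else 1)"
    by (intro prod.cong refl) auto
  then show ?thesis using assms by simp
qed

lemma prod_factor_indicator:
  assumes "finite F" "r \<in> F"
  shows "(\<Prod>v\<in>F. if v = r then complex_of_real ((cmod (G v x))\<^sup>2 - 1) else 1) = of_real ((cmod (G r x))\<^sup>2 - 1)"
  using assms by (subst prod.delta) auto

text \<open>Unless the exponents balance at every index, the mean is 0; balance forces A, D to be C,
  l in some order. If then C differs from r, the factor at \<open>r\<close> is the bare |g|^2 - 1 of
  mean 0. If C is r, the factors (|g|^2 - 1) |g|^2 at \<open>r\<close> and |g|^2 at \<open>l\<close>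
  remain, both of mean 1.\<close>

lemma cubic_test_var:
  assumes I: "A \<in> I" "C \<in> I" "D \<in> I" "r \<in> I" "l \<in> I" and "r \<noteq> l"
  shows "has_bochner_integral M (\<lambda>x. G A x * cnj (G C x) * G D x * cnj (test_var r l x))
      (if C = r \<and> (A = r \<and> D = l \<or> A = l \<and> D = r) then 1 else 0)"
proof -
  define F where "F = {A, C, D, r, l}"
  define p where "p v = of_bool (A = v) + (of_bool (D = v) :: nat)" for v
  define q where "q v = of_bool (C = v) + (of_bool (l = v) :: nat)" for v
  have F: "finite F" "F \<subseteq> I" "A \<in> F" "C \<in> F" "D \<in> F" "r \<in> F" "l \<in> F" using I by (auto simp: F_def)
  let ?f = "\<lambda>v x. gauss_factor (v = r) (p v) (q v) (G v x)"
  have eq: "G A x * cnj (G C x) * G D x * cnj (test_var r l x) = (\<Prod>v\<in>F. ?f v x)" for x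
    using prod_factor_indicator[OF F(1,6), of x]
      prod_power_indicator[OF F(1,3), of "\<lambda>v. G v x"] prod_power_indicator[OF F(1,5), of "\<lambda>v. G v x"]
      prod_power_indicator[OF F(1,4), of "\<lambda>v. cnj (G v x)"] prod_power_indicator[OF F(1,7), of "\<lambda>v. cnj (G v x)"]
    by (simp add: gauss_factor_def p_def q_def power_add prod.distrib test_var_def)
  have pv: "(\<Prod>v\<in>F. expectation (?f v)) = (if C = r \<and> (A = r \<and> D = l \<or> A = l \<and> D = r) then 1 else 0)"
  proof (cases "C = r \<and> (A = r \<and> D = l \<or> A = l \<and> D = r)")
    case True
    then have "F = {r, l}" "p r = 1" "q r = 1" "p l = 1" "q l = 1"
      using \<open>r \<noteq> l\<close> by (auto simp: F_def p_def q_def)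
    then have "(\<Prod>v\<in>F. expectation (?f v)) = 1"
      using \<open>r \<noteq> l\<close> I gauss_factor_expectations(2)[of r] gauss_factor_expectations(3)[of l] by simp
    then show ?thesis using True by simp
  next
    case False
    have "\<exists>v\<in>F. expectation (?f v) = 0"
    proof (cases "\<forall>v\<in>F. p v = q v")
      case True
      then have "p A = q A" "p C = q C" "p l = q l" using F by auto
      have "A = C \<and> D = l \<or> A = l \<and> D = C"
      proof (cases "D = l")
        case True
        then have "C = A" using \<open>p A = q A\<close> by (cases "C = A") (simp_all add: p_def q_def)
        then show ?thesis using True by simp
      next
        case False
        then have "A = l" using \<open>p l = q l\<close> by (cases "A = l") (simp_all add: p_def q_def)
        moreover from this have "D = C" using \<open>p C = q C\<close> by (cases "D = C") (simp_all add: p_def q_def)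
        ultimately show ?thesis by simp
      qed
      then have "p r = 0" "q r = 0" using False \<open>r \<noteq> l\<close> by (auto simp: p_def q_def)
      then have "expectation (?f r) = 0" using gauss_factor_expectations(1)[OF I(4)] by simp
      then show ?thesis using F by blast
    next
      case False
      then obtain v where v: "v \<in> F" "p v \<noteq> q v" by blast
      then have "expectation (?f v) = 0"
        using F by (intro gauss_factor_expectation_0) (auto simp: p_def q_def of_bool_def)
      then show ?thesis using v by blast
    qed
    then have "(\<Prod>v\<in>F. expectation (?f v)) = 0" using F by (intro prod_zero) auto
    then show ?thesis using False by simp
  qed
  show ?thesis using gauss_product[OF F(1,2), of "\<lambda>v. v = r" p q] unfolding eq pv .
qed

text \<open>Split the first test variable into |g_r|^2 g_i minus g_i. The cubic part is an instance
  of \<open>cubic_test_var\<close>, and the linear part is uncorrelated because |g_r|^2 - 1 has mean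
  0.\<close>

lemma test_var_orthonormal:
  assumes I: "r \<in> I" "i \<in> I" "j \<in> I" and ne: "r \<noteq> i" "r \<noteq> j"
  shows "has_bochner_integral M (\<lambda>x. test_var r i x * cnj (test_var r j x)) (if i = j then 1 else 0)"
proof -
  define F where "F = {r, i, j}"
  define p where "p v = (of_bool (i = v) :: nat)" for v
  define q where "q v = (of_bool (j = v) :: nat)" for v
  have F: "finite F" "F \<subseteq> I" "r \<in> F" "i \<in> F" "j \<in> F" using I by (auto simp: F_def)
  let ?f = "\<lambda>v x. gauss_factor (v = r) (p v) (q v) (G v x)"
  have eq: "G i x * cnj (test_var r j x) = (\<Prod>v\<in>F. ?f v x)" for x
    using prod_factor_indicator[OF F(1,3), of x]
      prod_power_indicator[OF F(1,4), of "\<lambda>v. G v x"] prod_power_indicator[OF F(1,5), of "\<lambda>v. cnj (G v x)"]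
    by (simp add: gauss_factor_def p_def q_def prod.distrib test_var_def)
  have "p r = 0" "q r = 0" using ne by (auto simp: p_def q_def)
  then have "expectation (?f r) = 0" using gauss_factor_expectations(1)[OF I(1)] by simp
  then have pv: "(\<Prod>v\<in>F. expectation (?f v)) = 0" using F(1,3) by (intro prod_zero bexI[of _ r])
  have "has_bochner_integral M (\<lambda>x. G i x * cnj (test_var r j x)) 0"
    using gauss_product[OF F(1,2), of "\<lambda>v. v = r" p q] unfolding eq pv .
  from has_bochner_integral_diff[OF cubic_test_var[OF I(1) I(1) I(2) I(1) I(3) ne(2)] this]
  have "has_bochner_integral M
      (\<lambda>x. G r x * cnj (G r x) * G i x * cnj (test_var r j x) - G i x * cnj (test_var r j x)) (if i = j then 1 else 0)"
    using ne by auto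
  moreover have "G r x * cnj (G r x) * G i x * cnj (test_var r j x) - G i x * cnj (test_var r j x)
      = test_var r i x * cnj (test_var r j x)" for x
    unfolding test_var_def[of r i] of_real_diff complex_norm_square by (simp add: algebra_simps)
  ultimately show ?thesis by simp
qed

end

section \<open>Correlation of the Picard iteration with the test variables\<close>

lemma sum_two_indicator:
  fixes x y :: complex
  assumes "finite m" "o1 \<in> m" "l \<in> m" "o1 \<noteq> l"
  shows "(\<Sum>A\<in>m. if A = o1 then x else if A = l then y else 0) = x + y"
proof -
  have "(\<Sum>A\<in>m. if A = o1 then x else if A = l then y else 0)
    = (\<Sum>A\<in>m. (if A = o1 then x else 0) + (if A = l then y else 0))"
    using assms by (intro sum.cong refl) auto
  then show ?thesis using assms by (simp add: sum.distrib)
qed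

locale wick_picard = sphere_basis b + gaussian_family M "\<lambda>A. g (fst A) (snd A)" "{(n, k). \<bar>k\<bar> \<le> int n}"
  for b :: "nat \<Rightarrow> int \<Rightarrow> cfun" and M :: "'w measure" and g :: "nat \<Rightarrow> int \<Rightarrow> 'w \<Rightarrow> complex"
begin

abbreviation G :: "nat \<times> int \<Rightarrow> 'w \<Rightarrow> complex" where
  "G A \<equiv> g (fst A) (snd A)"

definition weight :: "real \<Rightarrow> nat \<Rightarrow> real" where
  "weight \<alpha> n = lam n powr (- \<alpha>)"

definition picard_mode :: "nat \<Rightarrow> real \<Rightarrow> real \<Rightarrow> nat \<Rightarrow> int \<Rightarrow> 'w \<Rightarrow> complex" where
  "picard_mode N t \<alpha> n k x = picard_coeff (real N) t (\<lambda>A. of_real (weight \<alpha> (fst A)) * G A x) n k"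

lemma modes_subset: "A \<in> modes N \<Longrightarrow> A \<in> {(n, k). \<bar>k\<bar> \<le> int n}"
  by (auto simp: modes_def)

lemma picard_mode_measurable [measurable]: "picard_mode N t \<alpha> n k \<in> borel_measurable M"
proof -
  have m: "G A \<in> borel_measurable M" if "A \<in> modes (real N)" for A
    using G_measurable[OF modes_subset[OF that]] .
  have cnj: "(\<lambda>x. cnj (f x)) \<in> borel_measurable M" if "f \<in> borel_measurable M" for f :: "'w \<Rightarrow> complex"
    using that by (intro borel_measurable_continuous_on[of cnj] continuous_intros)
  have ofr: "(\<lambda>x. complex_of_real (f x)) \<in> borel_measurable M" if "f \<in> borel_measurable M" for f :: "'w \<Rightarrow> real"
    using that by (intro borel_measurable_continuous_on[of of_real] continuous_intros)
  have nrm: "(\<lambda>x. cmod (f x)) \<in> borel_measurable M" if "f \<in> borel_measurable M" for f :: "'w \<Rightarrow> complex"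
    using that by (intro borel_measurable_continuous_on[of cmod] continuous_intros)
  have [measurable]: "(\<lambda>x. if (n, k) \<in> modes (real N) then of_real (weight \<alpha> (fst (n, k))) * G (n, k) x else 0)
      \<in> borel_measurable M"
    using m[of "(n, k)"] by (cases "(n, k) \<in> modes (real N)") auto
  show ?thesis
    unfolding picard_mode_def[abs_def] picard_coeff_def
    by (intro borel_measurable_times borel_measurable_diff borel_measurable_sum borel_measurable_const
          ofr borel_measurable_power nrm cnj m)
      (auto intro: m)
qed

text \<open>Writing the squared modulus of the low mode as 1 + \<open>excess\<close> isolates the
  Kronecker delta that the Wick correction cancels in \<open>correlation\<close>.\<close>

lemma quartic_excess:
  assumes "j \<in> K n" "k \<in> K n"
  shows "quartic (1, 0) (1, 0) (n, j) n k = matrix_elem excess n j k + (if j = k then 1 else 0)"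
    and "quartic (n, j) (1, 0) (1, 0) n k = matrix_elem excess n j k + (if j = k then 1 else 0)"
proof -
  have p: "polyf (\<lambda>x. of_real (excess x) * B n j x)" using assms polyf_excess by (intro polyf_intros polyf_B)
  have "matrix_elem excess n j k = l2_inner (\<lambda>x. B 1 0 x * cnj (B 1 0 x) * B n j x - B n j x) (B n k)"
    unfolding matrix_elem_def of_real_excess by (simp add: left_diff_distrib)
  also have "\<dots> = l2_inner (\<lambda>x. B 1 0 x * cnj (B 1 0 x) * B n j x) (B n k) - l2_inner (B n j) (B n k)"
    using assms by (intro l2_inner_diff_left polyf_intros polyf_B) auto
  finally have m: "matrix_elem excess n j k + (if j = k then 1 else 0)
      = l2_inner (\<lambda>x. B 1 0 x * cnj (B 1 0 x) * B n j x) (B n k)"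
    using assms by (simp add: B_orthonormal)
  show "quartic (1, 0) (1, 0) (n, j) n k = matrix_elem excess n j k + (if j = k then 1 else 0)"
    "quartic (n, j) (1, 0) (1, 0) n k = matrix_elem excess n j k + (if j = k then 1 else 0)"
    unfolding m quartic_def by (simp_all add: mult_ac)
qed

text \<open>The phases of the low mode cancel and the rest combine to \<open>phase t n\<close>: the
  integrand does not oscillate, which is the origin of the factor \<open>t\<close>.\<close>

lemma tint_resonant:
  "tint t (\<lambda>s. phase (t - s) n * (phase s m * cnj (phase s m) * phase s n)) = of_real t * phase t n"
  "tint t (\<lambda>s. phase (t - s) n * (phase s n * cnj (phase s m) * phase s m)) = of_real t * phase t n"
proof -
  have "phase (t - s) n * (phase s m * cnj (phase s m) * phase s n) = phase t n"
    "phase (t - s) n * (phase s n * cnj (phase s m) * phase s m) = phase t n" for s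
  proof -
    have "phase (t - s) n * (phase s m * cnj (phase s m) * phase s n)
        = (phase s m * cnj (phase s m)) * (phase (t - s) n * phase s n)"
      "phase (t - s) n * (phase s n * cnj (phase s m) * phase s m)
        = (phase s m * cnj (phase s m)) * (phase (t - s) n * phase s n)"
      by (simp_all only: mult_ac)
    then show "phase (t - s) n * (phase s m * cnj (phase s m) * phase s n) = phase t n"
      "phase (t - s) n * (phase s n * cnj (phase s m) * phase s m) = phase t n"
      unfolding phase_mult_cnj phase_diff by simp_all
  qed
  then show "tint t (\<lambda>s. phase (t - s) n * (phase s m * cnj (phase s m) * phase s n)) = of_real t * phase t n"
    "tint t (\<lambda>s. phase (t - s) n * (phase s n * cnj (phase s m) * phase s m)) = of_real t * phase t n"
    by (simp_all add: tint_const)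
qed

text \<open>Only the two pairings of the cubic term in which the low mode \<open>(1, 0)\<close> appears with its
  conjugate correlate with the test variable; they and the Wick correction combine to \<open>excess\<close>.\<close>

lemma correlation:
  assumes n: "n \<ge> 2" and lam: "lam n \<le> real N" and j: "j \<in> K n" and k: "k \<in> K n"
  shows "has_bochner_integral M (\<lambda>x. picard_mode N t \<alpha> n k x * cnj (test_var (1, 0) (n, j) x))
    (- 2 * \<i> * of_real ((weight \<alpha> 1)\<^sup>2 * weight \<alpha> n * t) * phase t n * matrix_elem excess n j k)"
proof -
  define m where "m = modes (real N)"
  define o1 :: "nat \<times> int" where "o1 = (1, 0)"
  define l where "l = (n, j)"
  define \<tau> where "\<tau> x = cnj (test_var o1 l x)" for x
  define w where "w A = complex_of_real (weight \<alpha> (fst A))" for A :: "nat \<times> int"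
  \<comment> \<open>\<kappa> and \<rho> collect the deterministic factors of the cubic and of the
    Wick term, so that only Gaussian monomials remain to be integrated.\<close>
  define \<kappa> where "\<kappa> A C D = w A * w C * w D * quartic A C D n k *
      tint t (\<lambda>s. phase (t - s) n * (phase s (fst A) * cnj (phase s (fst C)) * phase s (fst D)))" for A C D
  define \<rho> where "\<rho> A = 2 * (w A * w A) * w l * (of_real t * phase t n)" for A
  have fm: "finite m" unfolding m_def by (rule finite_modes)
  \<comment> \<open>Puts the low mode below the cutoff \<open>N\<close> along with degree
    \<open>n\<close>.\<close>
  have "lam 1 \<le> lam n"
  proof -
    have "2 \<le> (real n)\<^sup>2 + real n" using n by (intro add_increasing) auto
    then show ?thesis by (simp add: lam_def)
  qed
  then have o1: "o1 \<in> m" using lam by (simp add: o1_def m_def modes_def)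
  have l: "l \<in> m" using lam j by (simp add: l_def m_def modes_def)
  have nk: "(n, k) \<in> m" using lam k by (simp add: m_def modes_def)
  have ne: "o1 \<noteq> l" using n by (simp add: o1_def l_def)
  let ?ind = "\<lambda>A C D. if C = o1 \<and> (A = o1 \<and> D = l \<or> A = l \<and> D = o1) then 1 else 0 :: complex"
  have mono: "has_bochner_integral M (\<lambda>x. G A x * cnj (G C x) * G D x * \<tau> x) (?ind A C D)"
    if "A \<in> m" "C \<in> m" "D \<in> m" for A C D
    unfolding \<tau>_def using that o1 l modes_subset unfolding m_def by (intro cubic_test_var ne) blast+
  have hb: "has_bochner_integral M
      (\<lambda>x. - \<i> * ((\<Sum>A\<in>m. \<Sum>C\<in>m. \<Sum>D\<in>m. \<kappa> A C D * (G A x * cnj (G C x) * G D x * \<tau> x))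
         - (\<Sum>A\<in>m. \<rho> A * (G A x * cnj (G A x) * G (n, k) x * \<tau> x))))
      (- \<i> * ((\<Sum>A\<in>m. \<Sum>C\<in>m. \<Sum>D\<in>m. \<kappa> A C D * ?ind A C D) - (\<Sum>A\<in>m. \<rho> A * ?ind A A (n, k))))"
    by (intro has_bochner_integral_mult_right has_bochner_integral_diff has_bochner_integral_sum mono nk)
  have Zeq: "picard_mode N t \<alpha> n k x * \<tau> x =
      - \<i> * ((\<Sum>A\<in>m. \<Sum>C\<in>m. \<Sum>D\<in>m. \<kappa> A C D * (G A x * cnj (G C x) * G D x * \<tau> x))
         - (\<Sum>A\<in>m. \<rho> A * (G A x * cnj (G A x) * G (n, k) x * \<tau> x)))" for x
  proof -
    have 1: "(w A * G A x) * cnj (w C * G C x) * (w D * G D x) * quartic A C D n k *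
        tint t (\<lambda>s. phase (t - s) n * (phase s (fst A) * cnj (phase s (fst C)) * phase s (fst D))) * \<tau> x
      = \<kappa> A C D * (G A x * cnj (G C x) * G D x * \<tau> x)" for A C D
      by (simp add: \<kappa>_def w_def mult_ac)
    have 2: "complex_of_real (2 * (\<Sum>A\<in>m. (cmod (w A * G A x))\<^sup>2)) * (w (n, k) * G (n, k) x) * (of_real t * phase t n) * \<tau> x
      = (\<Sum>A\<in>m. \<rho> A * (G A x * cnj (G A x) * G (n, k) x * \<tau> x))"
    proof -
      have "complex_of_real (2 * (\<Sum>A\<in>m. (cmod (w A * G A x))\<^sup>2))
          = (\<Sum>A\<in>m. 2 * (w A * w A) * (G A x * cnj (G A x)))"
        unfolding of_real_mult of_real_sum complex_norm_square sum_distrib_left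
        by (intro sum.cong refl) (simp add: w_def mult_ac)
      moreover have "w (n, k) = w l" by (simp add: w_def l_def)
      ultimately show ?thesis
        by (simp only: sum_distrib_right \<rho>_def) (intro sum.cong refl, simp only: mult_ac)
    qed
    have "picard_mode N t \<alpha> n k x * \<tau> x = - \<i> *
      ((\<Sum>A\<in>m. \<Sum>C\<in>m. \<Sum>D\<in>m. (w A * G A x) * cnj (w C * G C x) * (w D * G D x) * quartic A C D n k *
        tint t (\<lambda>s. phase (t - s) n * (phase s (fst A) * cnj (phase s (fst C)) * phase s (fst D))) * \<tau> x)
     - complex_of_real (2 * (\<Sum>A\<in>m. (cmod (w A * G A x))\<^sup>2)) * (w (n, k) * G (n, k) x) * (of_real t * phase t n) * \<tau> x)"
      using nk unfolding picard_mode_def picard_coeff_def m_def[symmetric] w_def[symmetric]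
      by (simp only: if_True sum_distrib_right left_diff_distrib mult.assoc)
    then show ?thesis unfolding 1 2 .
  qed
  have s1: "(\<Sum>A\<in>m. \<Sum>C\<in>m. \<Sum>D\<in>m. \<kappa> A C D * ?ind A C D) = \<kappa> o1 o1 l + \<kappa> l o1 o1"
  proof -
    have "(\<Sum>D\<in>m. \<kappa> A C D * ?ind A C D) =
        (if C = o1 then if A = o1 then \<kappa> o1 o1 l else if A = l then \<kappa> l o1 o1 else 0 else 0)" for A C
    proof -
      have "(\<Sum>D\<in>m. \<kappa> A C D * ?ind A C D) = (\<Sum>D\<in>m. if D = (if A = o1 then l else o1) then
          (if C = o1 then if A = o1 then \<kappa> o1 o1 l else if A = l then \<kappa> l o1 o1 else 0 else 0) else 0)"
        using ne by (intro sum.cong refl) auto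
      then show ?thesis using fm o1 l by simp
    qed
    then have "(\<Sum>A\<in>m. \<Sum>C\<in>m. \<Sum>D\<in>m. \<kappa> A C D * ?ind A C D)
        = (\<Sum>A\<in>m. if A = o1 then \<kappa> o1 o1 l else if A = l then \<kappa> l o1 o1 else 0)"
      using fm o1 by simp
    then show ?thesis using sum_two_indicator[OF fm o1 l ne] by simp
  qed
  have s2: "(\<Sum>A\<in>m. \<rho> A * ?ind A A (n, k)) = \<rho> o1 * (if j = k then 1 else 0)"
  proof -
    have "(\<Sum>A\<in>m. \<rho> A * ?ind A A (n, k)) = (\<Sum>A\<in>m. if A = o1 then \<rho> o1 * (if j = k then 1 else 0) else 0)"
      using ne by (intro sum.cong refl) (auto simp: l_def)
    then show ?thesis using fm o1 by simp
  qed
  \<comment> \<open>Each of the two pairings carries the matrix element plus the delta, and the Wick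
    term subtracts the delta twice; what remains is twice the matrix element.\<close>
  have total: "- \<i> * (\<kappa> o1 o1 l + \<kappa> l o1 o1 - \<rho> o1 * (if j = k then 1 else 0)) =
      - 2 * \<i> * of_real ((weight \<alpha> 1)\<^sup>2 * weight \<alpha> n * t) * phase t n * matrix_elem excess n j k"
  proof -
    have \<kappa>: "\<kappa> o1 o1 l = w o1 * w o1 * w l * (matrix_elem excess n j k + (if j = k then 1 else 0)) * (of_real t * phase t n)"
      "\<kappa> l o1 o1 = w o1 * w o1 * w l * (matrix_elem excess n j k + (if j = k then 1 else 0)) * (of_real t * phase t n)"
      unfolding \<kappa>_def o1_def l_def fst_conv quartic_excess[OF j k] tint_resonant by (simp_all add: mult_ac)
    have w: "complex_of_real ((weight \<alpha> 1)\<^sup>2 * weight \<alpha> n * t) = w o1 * w o1 * w l * of_real t"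
      by (simp add: w_def o1_def l_def power2_eq_square)
    show ?thesis unfolding \<kappa> w \<rho>_def by (simp add: algebra_simps)
  qed
  show ?thesis
    using hb unfolding s1 s2 total Zeq[symmetric] unfolding \<tau>_def o1_def l_def .
qed

section \<open>Lower bounds for each degree and their summation\<close>

abbreviation energy :: "nat \<Rightarrow> real \<Rightarrow> real \<Rightarrow> nat \<Rightarrow> ennreal" where
  "energy N t \<alpha> n \<equiv> \<integral>\<^sup>+x. ennreal (\<Sum>k\<in>K n. (cmod (picard_mode N t \<alpha> n k x))\<^sup>2) \<partial>M"

abbreviation HS :: "nat \<Rightarrow> real" where
  "HS n \<equiv> \<Sum>j\<in>K n. \<Sum>k\<in>K n. (cmod (matrix_elem excess n j k))\<^sup>2"

text \<open>Bessel's inequality is applied to each coefficient \<open>k\<close> separately, with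
  test variables indexed by \<open>j\<close>; summing over \<open>k\<close> assembles the
  Hilbert-Schmidt norm. The prefactor is the squared modulus of the scalar in
  \<open>correlation\<close>, and \<open>n \<ge> 2\<close> keeps the low mode apart from degree
  \<open>n\<close>.\<close>

lemma mode_lower_bound:
  assumes n: "n \<ge> 2" and lam: "lam n \<le> real N"
  shows "ennreal (4 * (weight \<alpha> 1) ^ 4 * (weight \<alpha> n)\<^sup>2 * t\<^sup>2 * HS n)
    \<le> energy N t \<alpha> n"
proof -
  define c where "c = 4 * (weight \<alpha> 1) ^ 4 * (weight \<alpha> n)\<^sup>2 * t\<^sup>2"
  have c0: "c \<ge> 0" by (simp add: c_def)
  have mem: "(1, 0) \<in> {(n, k). \<bar>k\<bar> \<le> int n}" "\<And>j. j \<in> K n \<Longrightarrow> (n, j) \<in> {(n, k). \<bar>k\<bar> \<le> int n}"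
    by auto
  have ne: "(1, 0) \<noteq> (n, j)" for j :: int using n by auto
  have k: "ennreal (c * (\<Sum>j\<in>K n. (cmod (matrix_elem excess n j k))\<^sup>2)) \<le> (\<integral>\<^sup>+x. ennreal ((cmod (picard_mode N t \<alpha> n k x))\<^sup>2) \<partial>M)"
    if k: "k \<in> K n" for k
  proof -
    define e where "e j = - 2 * \<i> * of_real ((weight \<alpha> 1)\<^sup>2 * weight \<alpha> n * t) * phase t n
      * matrix_elem excess n j k" for j
    have "ennreal (\<Sum>j\<in>K n. (cmod (e j))\<^sup>2) \<le> (\<integral>\<^sup>+x. ennreal ((cmod (picard_mode N t \<alpha> n k x))\<^sup>2) \<partial>M)"
    proof (rule bessel_nn_integral)
      show "has_bochner_integral M (\<lambda>x. picard_mode N t \<alpha> n k x * cnj (test_var (1, 0) (n, j) x)) (e j)"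
        if "j \<in> K n" for j
        unfolding e_def by (rule correlation[OF n lam that k])
      show "has_bochner_integral M (\<lambda>x. test_var (1, 0) (n, i) x * cnj (test_var (1, 0) (n, j) x))
          (if i = j then 1 else 0)" if "i \<in> K n" "j \<in> K n" for i j
        using test_var_orthonormal[OF mem(1) mem(2)[OF that(1)] mem(2)[OF that(2)] ne ne] by simp
    qed simp
    also have "(cmod (e j))\<^sup>2 = c * (cmod (matrix_elem excess n j k))\<^sup>2" for j
      unfolding e_def norm_mult norm_of_real cmod_phase c_def by (simp add: power_mult_distrib power2_abs)
    then have "(\<Sum>j\<in>K n. (cmod (e j))\<^sup>2) = c * (\<Sum>j\<in>K n. (cmod (matrix_elem excess n j k))\<^sup>2)"
      by (simp only: sum_distrib_left)
    finally show ?thesis .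
  qed
  have "ennreal (c * HS n)
    = (\<Sum>k\<in>K n. ennreal (c * (\<Sum>j\<in>K n. (cmod (matrix_elem excess n j k))\<^sup>2)))"
    using c0 by (subst sum.swap) (simp add: sum_distrib_left sum_nonneg)
  also have "\<dots> \<le> (\<Sum>k\<in>K n. \<integral>\<^sup>+x. ennreal ((cmod (picard_mode N t \<alpha> n k x))\<^sup>2) \<partial>M)"
    by (intro sum_mono k)
  also have "\<dots> = (\<integral>\<^sup>+x. (\<Sum>k\<in>K n. ennreal ((cmod (picard_mode N t \<alpha> n k x))\<^sup>2)) \<partial>M)"
    by (intro nn_integral_sum[symmetric]) measurable
  finally show ?thesis by (simp add: c_def)
qed

lemma ennreal_sqrt_square: "(ennreal_sqrt a)\<^sup>2 = a"
proof (cases "a = \<infinity>")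
  case False
  then have "(ennreal_sqrt a)\<^sup>2 = ennreal ((sqrt (enn2real a))\<^sup>2)"
    unfolding ennreal_sqrt_def by (simp add: ennreal_power)
  then show ?thesis using False by (simp add: less_top infinity_ennreal_def)
qed (simp add: ennreal_sqrt_def power2_eq_square)

lemma Hs_norm_lower_bound:
  "(\<integral>\<^sup>+x. (Hs_norm s (picard2 t (P_le (real N) (phi \<alpha> b g x))))\<^sup>2 \<partial>M)
    \<ge> (\<Sum>n\<in>{2..<N}. ennreal (lam n powr (2 * s)) * energy N t \<alpha> n)"
proof -
  have "(\<Sum>n\<in>{2..<N}. ennreal (lam n powr (2 * s)) * energy N t \<alpha> n)
    = (\<integral>\<^sup>+x. (\<Sum>n\<in>{2..<N}. ennreal (lam n powr (2 * s)) * ennreal (\<Sum>k\<in>K n. (cmod (picard_mode N t \<alpha> n k x))\<^sup>2)) \<partial>M)"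
    by (subst nn_integral_sum) (auto intro!: sum.cong nn_integral_cmult[symmetric])
  also have "\<dots> \<le> (\<integral>\<^sup>+x. (Hs_norm s (picard2 t (P_le (real N) (phi \<alpha> b g x))))\<^sup>2 \<partial>M)"
  proof (intro nn_integral_mono)
    fix x
    let ?f = "picard2 t (P_le (real N) (phi \<alpha> b g x))"
    have "(\<Sum>n\<in>{2..<N}. ennreal (lam n powr (2 * s)) * ennreal (\<Sum>k\<in>K n. (cmod (picard_mode N t \<alpha> n k x))\<^sup>2))
      = (\<Sum>n\<in>{2..<N}. ennreal (lam n powr (2 * s) * (l2_norm (proj n ?f))\<^sup>2))"
    proof (intro sum.cong refl)
      fix n assume "n \<in> {2..<N}"
      then have "(l2_norm (proj n ?f))\<^sup>2 = (\<Sum>k\<in>K n. (cmod (picard_mode N t \<alpha> n k x))\<^sup>2)"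
        unfolding picard_mode_def weight_def by (intro l2_norm_proj_picard2) auto
      then show "ennreal (lam n powr (2 * s)) * ennreal (\<Sum>k\<in>K n. (cmod (picard_mode N t \<alpha> n k x))\<^sup>2)
        = ennreal (lam n powr (2 * s) * (l2_norm (proj n ?f))\<^sup>2)"
        by (simp add: ennreal_mult' sum_nonneg)
    qed
    also have "\<dots> \<le> (\<Sum>n. ennreal (lam n powr (2 * s) * (l2_norm (proj n ?f))\<^sup>2))"
      by (rule sum_le_suminf) auto
    also have "\<dots> = (Hs_norm s ?f)\<^sup>2" by (simp add: Hs_norm_def ennreal_sqrt_square)
    finally show "(\<Sum>n\<in>{2..<N}. ennreal (lam n powr (2 * s)) * ennreal (\<Sum>k\<in>K n. (cmod (picard_mode N t \<alpha> n k x))\<^sup>2))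
      \<le> (Hs_norm s ?f)\<^sup>2" .
  qed
  finally show ?thesis .
qed

text \<open>Omitting the first term 1 of the harmonic sum costs at most half of \<open>ln N\<close>,
  which is what the assumption \<open>2 \<le> ln N\<close> provides.\<close>

lemma harmonic_tail_lower_bound:
  assumes "2 \<le> ln (real N)"
  shows "ln (real N) / 2 \<le> (\<Sum>n\<in>{2..<N}. 1 / real n)"
proof -
  have N: "N \<ge> 2"
  proof (rule ccontr)
    assume "\<not> N \<ge> 2"
    then have "N = 0 \<or> N = 1" by auto
    then show False using assms by auto
  qed
  have "ln (real N) \<le> harm (N - 1)" using ln_le_harm[of "N - 1"] N by (simp add: of_nat_diff)
  also have "harm (N - 1) = (\<Sum>n\<in>{1..<N}. 1 / real n)"
    unfolding harm_def using N by (intro sum.cong) (auto simp: inverse_eq_divide)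
  also have "\<dots> = 1 + (\<Sum>n\<in>{2..<N}. 1 / real n)"
    using N by (simp add: sum.atLeast_Suc_lessThan numeral_2_eq_2)
  finally show ?thesis using assms by simp
qed

lemma picard_lower_bound:
  "\<exists>c>0. \<forall>N::nat. 2 \<le> ln (real N) \<longrightarrow>
    ennreal (c * t\<^sup>2 * ln (real N)) \<le> (\<integral>\<^sup>+x. (Hs_norm (\<alpha> - 1) (picard2 t (P_le (real N) (phi \<alpha> b g x))))\<^sup>2 \<partial>M)"
proof -
  obtain C where C: "C > 0" "\<And>n. n > 0 \<Longrightarrow> C * real n \<le> HS n"
    using matrix_elem_lower_bound by blast
  \<comment> \<open>The factor 4 of \<open>mode_lower_bound\<close> is spent on the estimate of (lam
    n)^2 by 4 n^2.\<close>
  define a where "a = C * (weight \<alpha> 1) ^ 4"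
  have a: "a > 0" using C lam_pos[of 1] by (simp add: a_def weight_def)
  have mode: "ennreal (a * t\<^sup>2 * (1 / real n)) \<le>
      ennreal (lam n powr (2 * (\<alpha> - 1))) * energy N t \<alpha> n"
    if n: "n \<in> {2..<N}" for n N
  proof -
    have "HS n \<ge> 0" by (simp add: sum_nonneg)
    have HS: "C * real n \<le> HS n" using C(2)[of n] n by simp
    \<comment> \<open>\<open>lam n\<close> exceeds \<open>n\<close> but not n + 1, so stopping the
      sum before \<open>N\<close> stays below the cutoff.\<close>
    have lamN: "lam n \<le> real N" using lam_le[of n] n by auto
    \<comment> \<open>Here \<alpha> drops out: the Sobolev weight and the squared weight of the data
      leave lam^(-2), which with the growth of \<open>HS n\<close> gives 1/n.\<close>
    have w: "lam n powr (2 * (\<alpha> - 1)) * (weight \<alpha> n)\<^sup>2 = 1 / (lam n)\<^sup>2"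
    proof -
      have "lam n powr (2 * (\<alpha> - 1)) * (weight \<alpha> n)\<^sup>2 = lam n powr (2 * (\<alpha> - 1) + (- \<alpha>) + (- \<alpha>))"
        unfolding weight_def power2_eq_square by (simp only: powr_add mult.assoc)
      also have "2 * (\<alpha> - 1) + (- \<alpha>) + (- \<alpha>) = - 2" by simp
      also have "lam n powr (- 2) = 1 / (lam n)\<^sup>2"
        using lam_pos[of n] by (simp add: powr_minus_divide powr_numeral)
      finally show ?thesis .
    qed
    have l4: "(lam n)\<^sup>2 \<le> 4 * (real n)\<^sup>2"
    proof -
      have "(lam n)\<^sup>2 \<le> (real n + 1)\<^sup>2" using lam_le[of n] lam_pos[of n] by (intro power_mono) auto
      also have "\<dots> \<le> (2 * real n)\<^sup>2" using n by (intro power_mono) auto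
      finally show ?thesis by (simp add: power_mult_distrib)
    qed
    have "a * t\<^sup>2 * (1 / real n) = 4 * (weight \<alpha> 1) ^ 4 * t\<^sup>2 * (C * real n) * (1 / (4 * (real n)\<^sup>2))"
      using n by (simp add: a_def field_simps power2_eq_square)
    also have "\<dots> \<le> 4 * (weight \<alpha> 1) ^ 4 * t\<^sup>2 * HS n * (1 / (lam n)\<^sup>2)"
      using HS l4 C n lam_pos[of n] \<open>HS n \<ge> 0\<close> by (intro mult_mono divide_left_mono) (auto intro!: mult_nonneg_nonneg)
    also have "\<dots> = lam n powr (2 * (\<alpha> - 1)) * (4 * (weight \<alpha> 1) ^ 4 * (weight \<alpha> n)\<^sup>2 * t\<^sup>2 * HS n)"
      unfolding w[symmetric] by (simp only: mult_ac)
    finally have "ennreal (a * t\<^sup>2 * (1 / real n)) \<le>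
        ennreal (lam n powr (2 * (\<alpha> - 1)) * (4 * (weight \<alpha> 1) ^ 4 * (weight \<alpha> n)\<^sup>2 * t\<^sup>2 * HS n))"
      by (rule ennreal_leI)
    also have "\<dots> = ennreal (lam n powr (2 * (\<alpha> - 1))) * ennreal (4 * (weight \<alpha> 1) ^ 4 * (weight \<alpha> n)\<^sup>2 * t\<^sup>2 * HS n)"
      by (rule ennreal_mult') simp
    also have "\<dots> \<le> ennreal (lam n powr (2 * (\<alpha> - 1))) * energy N t \<alpha> n"
      using n by (intro mult_left_mono mode_lower_bound lamN) auto
    finally show ?thesis .
  qed
  have "ennreal (a / 2 * t\<^sup>2 * ln (real N)) \<le> (\<integral>\<^sup>+x. (Hs_norm (\<alpha> - 1) (picard2 t (P_le (real N) (phi \<alpha> b g x))))\<^sup>2 \<partial>M)"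
    if N: "2 \<le> ln (real N)" for N
  proof -
    have "a / 2 * t\<^sup>2 * ln (real N) = a * t\<^sup>2 * (ln (real N) / 2)" by simp
    also have "\<dots> \<le> a * t\<^sup>2 * (\<Sum>n\<in>{2..<N}. 1 / real n)"
      using a by (intro mult_left_mono harmonic_tail_lower_bound N) auto
    also have "\<dots> = (\<Sum>n\<in>{2..<N}. a * t\<^sup>2 * (1 / real n))" by (rule sum_distrib_left)
    finally have "ennreal (a / 2 * t\<^sup>2 * ln (real N)) \<le> ennreal (\<Sum>n\<in>{2..<N}. a * t\<^sup>2 * (1 / real n))"
      by (rule ennreal_leI)
    also have "\<dots> = (\<Sum>n\<in>{2..<N}. ennreal (a * t\<^sup>2 * (1 / real n)))"
      using a by (intro sum_ennreal[symmetric]) auto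
    also have "\<dots> \<le> (\<Sum>n\<in>{2..<N}. ennreal (lam n powr (2 * (\<alpha> - 1))) * energy N t \<alpha> n)"
      by (intro sum_mono mode)
    also note Hs_norm_lower_bound
    finally show ?thesis .
  qed
  then show ?thesis using a by (intro exI[of _ "a / 2"]) auto
qed

end

theorem theorem1p1:
  fixes M :: "'w measure"
    and b :: "nat \<Rightarrow> int \<Rightarrow> R3 \<Rightarrow> complex"
    and g :: "nat \<Rightarrow> int \<Rightarrow> 'w \<Rightarrow> complex"
    and t \<alpha> :: real
  assumes "prob_space M"
    and "\<And>n. orthonormal_basis_eigenspace n (b n)"
    and "iid_std_complex_gaussian M g"
    and "t \<ge> 0"
    and "\<alpha> > 1/2"
  shows "\<exists>N\<^sub>0::nat. \<exists>\<eta>::real. \<eta> > 0 \<and> (\<forall>N::nat. N \<ge> N\<^sub>0 \<longrightarrow>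
    ennreal (\<eta> * \<bar>t\<bar> * ln (real N) powr (1/2))
      \<le> L2_Hs_norm M (\<alpha> - 1) (\<lambda>\<omega>. picard2 t (P_le (real N) (phi \<alpha> b g \<omega>))))"
proof -
  interpret prob_space M by fact
  have "wick_picard b M g"
  proof
    fix A :: "nat \<times> int" assume "A \<in> {(n, k). \<bar>k\<bar> \<le> int n}"
    then show "std_complex_gaussian M (g (fst A) (snd A))"
      using assms(3) unfolding iid_std_complex_gaussian_def by (cases A) (simp add: abs_le_iff)
  next
    show "indep_vars (\<lambda>_. borel) (\<lambda>A. g (fst A) (snd A)) {(n, k). \<bar>k\<bar> \<le> int n}"
      using assms(3) unfolding iid_std_complex_gaussian_def by (simp add: case_prod_unfold)
  qed (fact assms(2))
  then interpret wick_picard b M g .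
  obtain c where c: "c > 0" "\<And>N::nat. 2 \<le> ln (real N) \<Longrightarrow>
    ennreal (c * t\<^sup>2 * ln (real N)) \<le> (\<integral>\<^sup>+x. (Hs_norm (\<alpha> - 1) (picard2 t (P_le (real N) (phi \<alpha> b g x))))\<^sup>2 \<partial>M)"
    using picard_lower_bound by blast
  have "ennreal (sqrt c * \<bar>t\<bar> * ln (real N) powr (1/2))
      \<le> L2_Hs_norm M (\<alpha> - 1) (\<lambda>x. picard2 t (P_le (real N) (phi \<alpha> b g x)))"
    if N: "N \<ge> nat \<lceil>exp 2 :: real\<rceil>" for N :: nat
  proof -
    define Y where "Y = (\<integral>\<^sup>+x. (Hs_norm (\<alpha> - 1) (picard2 t (P_le (real N) (phi \<alpha> b g x))))\<^sup>2 \<partial>M)"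
    \<comment> \<open>The threshold exp 2 is chosen to guarantee
      \<open>2 \<le> ln N\<close>.\<close>
    have "exp 2 \<le> real N" using N by linarith
    then have "ln (exp 2) \<le> ln (real N)" by (intro ln_mono) auto
    then have l: "2 \<le> ln (real N)" by simp
    have "ennreal (sqrt c * \<bar>t\<bar> * ln (real N) powr (1/2)) = ennreal (sqrt (c * t\<^sup>2 * ln (real N)))"
      using l c(1) by (simp add: real_sqrt_mult powr_half_sqrt)
    also have "\<dots> \<le> ennreal_sqrt Y"
    \<comment> \<open>The expected square may be infinite, and then the bound is trivial; otherwise
      the comparison is carried back to real numbers.\<close>
    proof (cases "Y = \<infinity>")
      case False
      then have "c * t\<^sup>2 * ln (real N) \<le> enn2real Y"
        using c(2)[OF l] by (metis Y_def enn2real_leI ennreal_enn2real_if ennreal_le_iff enn2real_nonneg infinity_ennreal_def)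
      then show ?thesis using False by (simp add: ennreal_sqrt_def ennreal_leI)
    qed (simp add: ennreal_sqrt_def)
    finally show ?thesis by (simp add: L2_Hs_norm_def Y_def)
  qed
  then show ?thesis using c(1) by (intro exI[of _ "nat \<lceil>exp 2 :: real\<rceil>"] exI[of _ "sqrt c"]) auto
qed

end
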